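(* Let $f_\bullet\colon X_\bullet\to Y_\bullet$ be a map of simplicial symmetric spectra in pointed simplicial sets. Suppose that all of the following conditions are satisfied: (1) the symmetric spectra $X_n$ and $Y_n$ are flat-cofibrant for all $n\ge 0$; (2) each of the degeneracy maps $s_i\colon X_n\to X_{n+1}$ and $s_i\colon Y_n\to Y_{n+1}$ is a levelwise cofibration; (3) $f_n\colon X_n\to Y_n$ is a flat cofibration for all $n\ge 0$. Then $f_\bullet$ is a Reedy flat cofibration. Consequently the map of symmetric spectra $|f_\bullet|\colon |X_\bullet|\to |Y_\bullet|$ is a flat cofibration. If we furthermore assume that each $X_n$ and each $Y_n$ is positive flat-cofibrant and that each $f_n$ is a positive flat cofibration, then $f_\bullet$ is a Reedy positive flat cofibration, and consequently the map of symmetric spectra $|f_\bullet|$ is a positive flat cofibration.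
   Context: Let $\mathrm{sSet}_*$ be the category of pointed simplicial sets with the Quillen model structure; its cofibrations are exactly the monomorphisms. $\mathrm{Sp}$ denotes the category of symmetric spectra in $\mathrm{sSet}_*$ (in the sense of Hovey–Shipley–Smith), with smash product $\wedge$ and unit the sphere spectrum $S$. For a symmetric spectrum $X$, $X(m)$ denotes its level $m$ pointed simplicial set. For a simplicial object $X_\bullet$, $X_n$ denotes its object of $n$-simplices. A simplicial symmetric spectrum is a simplicial object in $\mathrm{Sp}$, and $|X_\bullet|$ denotes its geometric realization (the coend $\int^{[n]\in\Delta} X_n\wedge \Delta[n]_+$ in $\mathrm{Sp}$). Spectral latching objects: let $\bar S$ be the symmetric spectrum with $\bar S(m)=S^m$ for $m\ge 1$ and $\bar S(0)=*$, with the evident structure maps. For a symmetric spectrum $X$ put $L_mX:=(\bar S\wedge X)(m)$; the evident map $\bar S\to S$ induces a natural map $\nu_m(X)\colon L_mX\to (S\wedge X)(m)\cong X(m)$. A map $f\colon X\to Y$ of symmetric spectra is: - a levelwise cofibration if $f(m)\colon X(m)\to Y(m)$ is a cofibration in $\mathrm{sSet}_*$ for all $m\ge 0$; - a flat cofibration if for all $m\ge 0$ the map $X(m)\coprod_{L_mX}L_mY\to Y(m)$ is a cofibration in $\mathrm{sSet}_*$; - a positive flat cofibration if it is a flat cofibration and $f(0)\colon X(0)\to Y(0)$ is an isomorphism. A symmetric spectrum $X$ is flat-cofibrant (resp. positive flat-cofibrant) if $*\to X$ is a flat (resp. positive flat) cofibration. Simplicial latching objects: for a simplicial object $X_\bullet$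 in a pointed cocomplete category, $\tilde L_0X_\bullet$ is the zero object; $\tilde L_1X_\bullet=X_0$ with latching map $s_0\colon X_0\to X_1$; and for $n>1$, $\tilde L_nX_\bullet$ is the coequalizer of the two maps $$S',S''\colon \coprod_{0\le i<j\le n-1}X_{n-2}\{i,j\}\rightrightarrows \coprod_{k=0}^{n-1}X_{n-1}\{k\},$$ where $\{i,j\}$, $\{k\}$ are formal symbols indexing summands, $S'$ restricted to the summand $\{i,j\}$ is $s_i\colon X_{n-2}\to X_{n-1}\{j\}$ followed by the inclusion of summand $j$, and $S''$ restricted to the summand $\{i,j\}$ is $s_{j-1}\colon X_{n-2}\to X_{n-1}\{i\}$ followed by the inclusion of summand $i$. The map $\coprod_{k=0}^{n-1}X_{n-1}\{k\}\to X_n$ given by $s_k$ on the summand $k$ induces the latching map $\tilde L_nX_\bullet\to X_n$. A map $f_\bullet\colon X_\bullet\to Y_\bullet$ of simplicial symmetric spectra is a Reedy flat (resp. Reedy positive flat) cofibration if for every $n\ge 0$ the induced map $X_n\coprod_{\tilde L_nX_\bullet}\tilde L_nY_\bullet\to Y_n$ is a flat (resp. positive flat) cofibration of symmetric spectra. *)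

theory Defs
  imports "HOL-Library.FuncSet" "HOL-Combinatorics.Permutations"
begin

section \<open>Pointed simplicial sets\<close>

text \<open>Morphisms \<open>[m] \<rightarrow> [n]\<close> of the simplex category, as extensional functions; their composition is
  \<^const>\<open>compose\<close>.\<close>

definition simp_op :: "nat \<Rightarrow> nat \<Rightarrow> (nat \<Rightarrow> nat) set" where
  "simp_op m n = {\<theta> \<in> {..m} \<rightarrow>\<^sub>E {..n}. mono_on {..m} \<theta>}"

text \<open>For \<open>\<theta> : [m] \<rightarrow> [n]\<close>, \<open>operator A m n \<theta>\<close> is the map from \<open>n\<close>-simplices to \<open>m\<close>-simplices.\<close>

record 'a psset =
  simplices :: "nat \<Rightarrow> 'a set"
  operator :: "nat \<Rightarrow> nat \<Rightarrow> (nat \<Rightarrow> nat) \<Rightarrow> 'a \<Rightarrow> 'a"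
  basepoint :: "nat \<Rightarrow> 'a"

definition is_psset :: "'a psset \<Rightarrow> bool" where
  "is_psset A \<longleftrightarrow>
     (\<forall>n. basepoint A n \<in> simplices A n) \<and>
     (\<forall>m n. \<forall>\<theta> \<in> simp_op m n.
        operator A m n \<theta> \<in> simplices A n \<rightarrow> simplices A m \<and>
        operator A m n \<theta> (basepoint A n) = basepoint A m) \<and>
     (\<forall>n. \<forall>x \<in> simplices A n. operator A n n (\<lambda>i\<in>{..n}. i) x = x) \<and>
     (\<forall>l m n. \<forall>\<phi> \<in> simp_op l m. \<forall>\<theta> \<in> simp_op m n. \<forall>x \<in> simplices A n.
        operator A l n (compose {..l} \<theta> \<phi>) x = operator A l m \<phi> (operator A m n \<theta> x))"

definition is_psset_map :: "'a psset \<Rightarrow> 'b psset \<Rightarrow> (nat \<Rightarrow> 'a \<Rightarrow> 'b) \<Rightarrow> bool" where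
  "is_psset_map A B f \<longleftrightarrow>
     is_psset A \<and> is_psset B \<and>
     (\<forall>n. f n \<in> simplices A n \<rightarrow> simplices B n \<and> f n (basepoint A n) = basepoint B n) \<and>
     (\<forall>m n. \<forall>\<theta> \<in> simp_op m n. \<forall>x \<in> simplices A n.
        f m (operator A m n \<theta> x) = operator B m n \<theta> (f n x))"

definition is_cofibration :: "'a psset \<Rightarrow> 'b psset \<Rightarrow> (nat \<Rightarrow> 'a \<Rightarrow> 'b) \<Rightarrow> bool" where
  "is_cofibration A B f \<longleftrightarrow> is_psset_map A B f \<and> (\<forall>n. inj_on (f n) (simplices A n))"

definition is_psset_iso :: "'a psset \<Rightarrow> 'b psset \<Rightarrow> (nat \<Rightarrow> 'a \<Rightarrow> 'b) \<Rightarrow> bool" where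
  "is_psset_iso A B f \<longleftrightarrow>
     is_psset_map A B f \<and>
     (\<exists>g. is_psset_map B A g \<and>
        (\<forall>n. \<forall>x \<in> simplices A n. g n (f n x) = x) \<and>
        (\<forall>n. \<forall>y \<in> simplices B n. f n (g n y) = y))"


subsection \<open>Quotients and pushouts\<close>

definition qclass :: "('a \<Rightarrow> 'a \<Rightarrow> bool) \<Rightarrow> 'a \<Rightarrow> 'a set" where
  "qclass r x = {y. equivclp r x y}"

text \<open>The function on equivalence classes induced by a function that is constant on each class.\<close>

definition qlift :: "('a \<Rightarrow> 'b) \<Rightarrow> 'a set \<Rightarrow> 'b" where
  "qlift h c = the_elem (h ` c)"

definition pquot_map :: "(nat \<Rightarrow> 'b \<Rightarrow> 'b \<Rightarrow> bool) \<Rightarrow> (nat \<Rightarrow> 'a \<Rightarrow> 'b) \<Rightarrow> nat \<Rightarrow> 'a set \<Rightarrow> 'b set" where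
  "pquot_map r h k = qlift (\<lambda>x. qclass (r k) (h k x))"

definition pquot :: "'a psset \<Rightarrow> (nat \<Rightarrow> 'a \<Rightarrow> 'a \<Rightarrow> bool) \<Rightarrow> 'a set psset" where
  "pquot A r = \<lparr>
     simplices = \<lambda>k. qclass (r k) ` simplices A k,
     operator = \<lambda>m n \<theta>. qlift (\<lambda>x. qclass (r m) (operator A m n \<theta> x)),
     basepoint = \<lambda>k. qclass (r k) (basepoint A k)\<rparr>"

definition coeq_rel ::
  "'a psset \<Rightarrow> (nat \<Rightarrow> 'a \<Rightarrow> 'b) \<Rightarrow> (nat \<Rightarrow> 'a \<Rightarrow> 'b) \<Rightarrow> nat \<Rightarrow> 'b \<Rightarrow> 'b \<Rightarrow> bool" where
  "coeq_rel A f g k y y' \<longleftrightarrow> (\<exists>a \<in> simplices A k. y = f k a \<and> y' = g k a)"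

text \<open>The pushout of \<open>B \<leftarrow> A \<rightarrow> C\<close> is a quotient of the disjoint union of \<open>B\<close> and \<open>C\<close>. The basepoint of
  the disjoint union is taken in \<open>B\<close>; the quotient identifies it with that of \<open>C\<close>, since \<open>A\<close> is
  pointed.\<close>

definition psum :: "'b psset \<Rightarrow> 'c psset \<Rightarrow> ('b + 'c) psset" where
  "psum B C = \<lparr>
     simplices = \<lambda>k. simplices B k <+> simplices C k,
     operator = \<lambda>m n \<theta>. map_sum (operator B m n \<theta>) (operator C m n \<theta>),
     basepoint = \<lambda>k. Inl (basepoint B k)\<rparr>"

definition pushout_rel ::
  "'a psset \<Rightarrow> (nat \<Rightarrow> 'a \<Rightarrow> 'b) \<Rightarrow> (nat \<Rightarrow> 'a \<Rightarrow> 'c) \<Rightarrow> nat \<Rightarrow> 'b + 'c \<Rightarrow> 'b + 'c \<Rightarrow> bool" where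
  "pushout_rel A f g = coeq_rel A (\<lambda>k a. Inl (f k a)) (\<lambda>k a. Inr (g k a))"

definition ppushout ::
  "'a psset \<Rightarrow> 'b psset \<Rightarrow> 'c psset \<Rightarrow> (nat \<Rightarrow> 'a \<Rightarrow> 'b) \<Rightarrow> (nat \<Rightarrow> 'a \<Rightarrow> 'c) \<Rightarrow> ('b + 'c) set psset" where
  "ppushout A B C f g = pquot (psum B C) (pushout_rel A f g)"

definition ppushout_desc ::
  "(nat \<Rightarrow> 'b \<Rightarrow> 'd) \<Rightarrow> (nat \<Rightarrow> 'c \<Rightarrow> 'd) \<Rightarrow> nat \<Rightarrow> ('b + 'c) set \<Rightarrow> 'd" where
  "ppushout_desc u v k = qlift (case_sum (u k) (v k))"


subsection \<open>Coproducts and smash products\<close>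

text \<open>In coproducts (wedges) and smash products of pointed simplicial sets the basepoint is
  represented by \<^const>\<open>None\<close>, so that no element has two representations.\<close>

definition cin :: "('i \<Rightarrow> 'a psset) \<Rightarrow> nat \<Rightarrow> 'i \<Rightarrow> 'a \<Rightarrow> ('i \<times> 'a) option" where
  "cin A k i x = (if x = basepoint (A i) k then None else Some (i, x))"

text \<open>The map of coproducts which maps the summand \<open>i\<close> by \<open>h i\<close> to the summand \<open>u i\<close>.\<close>

definition pcoprod_map ::
  "('j \<Rightarrow> 'b psset) \<Rightarrow> ('i \<Rightarrow> 'j) \<Rightarrow> ('i \<Rightarrow> nat \<Rightarrow> 'a \<Rightarrow> 'b) \<Rightarrow>
     nat \<Rightarrow> ('i \<times> 'a) option \<Rightarrow> ('j \<times> 'b) option" where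
  "pcoprod_map B u h k = case_option None (\<lambda>(i, x). cin B k (u i) (h i k x))"

definition pcoprod :: "'i set \<Rightarrow> ('i \<Rightarrow> 'a psset) \<Rightarrow> ('i \<times> 'a) option psset" where
  "pcoprod I A = \<lparr>
     simplices = \<lambda>k. insert None {cin A k i x | i x. i \<in> I \<and> x \<in> simplices (A i) k},
     operator = \<lambda>m n \<theta>. pcoprod_map A (\<lambda>i. i) (\<lambda>i k. operator (A i) m n \<theta>) m,
     basepoint = \<lambda>_. None\<rparr>"

definition smash_elt :: "'a psset \<Rightarrow> 'b psset \<Rightarrow> nat \<Rightarrow> 'a \<Rightarrow> 'b \<Rightarrow> ('a \<times> 'b) option" where
  "smash_elt A B k x y = (if x = basepoint A k \<or> y = basepoint B k then None else Some (x, y))"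

definition psmash_map ::
  "'c psset \<Rightarrow> 'd psset \<Rightarrow> (nat \<Rightarrow> 'a \<Rightarrow> 'c) \<Rightarrow> (nat \<Rightarrow> 'b \<Rightarrow> 'd) \<Rightarrow>
     nat \<Rightarrow> ('a \<times> 'b) option \<Rightarrow> ('c \<times> 'd) option" where
  "psmash_map C D f g k = case_option None (\<lambda>(x, y). smash_elt C D k (f k x) (g k y))"

definition psmash :: "'a psset \<Rightarrow> 'b psset \<Rightarrow> ('a \<times> 'b) option psset" where
  "psmash A B = \<lparr>
     simplices = \<lambda>k. insert None {smash_elt A B k x y | x y. x \<in> simplices A k \<and> y \<in> simplices B k},
     operator = \<lambda>m n \<theta>. psmash_map A B (\<lambda>_. operator A m n \<theta>) (\<lambda>_. operator B m n \<theta>) m,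
     basepoint = \<lambda>_. None\<rparr>"

definition smash_pow_elt :: "'a psset \<Rightarrow> nat \<Rightarrow> 'a list \<Rightarrow> 'a list option" where
  "smash_pow_elt A k xs = (if basepoint A k \<in> set xs then None else Some xs)"

definition psmash_pow :: "'a psset \<Rightarrow> nat \<Rightarrow> 'a list option psset" where
  "psmash_pow A p = \<lparr>
     simplices = \<lambda>k. insert None {smash_pow_elt A k xs | xs. length xs = p \<and> set xs \<subseteq> simplices A k},
     operator = \<lambda>m n \<theta>. case_option None (\<lambda>xs. smash_pow_elt A m (map (operator A m n \<theta>) xs)),
     basepoint = \<lambda>_. None\<rparr>"


subsection \<open>Simplices and spheres\<close>

definition std_simplex_plus :: "nat \<Rightarrow> (nat \<Rightarrow> nat) option psset" where
  "std_simplex_plus n = \<lparr>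
     simplices = \<lambda>k. insert None (Some ` simp_op k n),
     operator = \<lambda>l k \<phi>. map_option (\<lambda>t. compose {..l} t \<phi>),
     basepoint = \<lambda>_. None\<rparr>"

definition std_simplex_map :: "(nat \<Rightarrow> nat) \<Rightarrow> nat \<Rightarrow> (nat \<Rightarrow> nat) option \<Rightarrow> (nat \<Rightarrow> nat) option" where
  "std_simplex_map \<theta> k = map_option (\<lambda>t. compose {..k} \<theta> t)"

text \<open>\<open>S\<^sup>1 = \<Delta>[1]/\<partial>\<Delta>[1]\<close>; the simplices of \<open>\<partial>\<Delta>[1]\<close> are the non-surjective maps \<open>[k] \<rightarrow> [1]\<close>.\<close>

type_synonym circ = "(nat \<Rightarrow> nat) option"

definition circle_elt :: "nat \<Rightarrow> (nat \<Rightarrow> nat) \<Rightarrow> circ" where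
  "circle_elt k t = (if t ` {..k} = {..1} then Some t else None)"

definition circle :: "circ psset" where
  "circle = \<lparr>
     simplices = \<lambda>k. circle_elt k ` simp_op k 1,
     operator = \<lambda>l k \<phi>. case_option None (\<lambda>t. circle_elt l (compose {..l} t \<phi>)),
     basepoint = \<lambda>_. None\<rparr>"

type_synonym sph = "circ list option"

definition sph :: "nat \<Rightarrow> sph psset" where
  "sph p = psmash_pow circle p"


section \<open>Symmetric spectra\<close>

text \<open>Structure maps \<open>S\<^sup>1 \<and> X(m) \<rightarrow> X(m + 1)\<close> and the \<open>\<Sigma>\<^sub>m\<close>-actions follow the conventions of Hovey,
  Shipley and Smith. Here \<open>\<Sigma>\<^sub>m\<close> is the group of permutations of \<open>{..<m}\<close>, \<open>symact X m \<gamma>\<close> is the left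
  action of \<open>\<gamma>\<close> on level \<open>m\<close>, and \<open>strmap X m k s x\<close> is the image of \<open>s \<and> x\<close> in degree \<open>k\<close> under the
  structure map; maps out of a smash product of two pointed simplicial sets are given as maps of two
  arguments sending \<open>(*, x)\<close> and \<open>(s, *)\<close> to the basepoint. The last clause of \<open>is_symspec\<close> is
  \<open>\<Sigma>\<^sub>p \<times> \<Sigma>\<^sub>m\<close>-equivariance of the iterated structure maps.\<close>

record 'a symspec =
  level :: "nat \<Rightarrow> 'a psset"
  symact :: "nat \<Rightarrow> (nat \<Rightarrow> nat) \<Rightarrow> nat \<Rightarrow> 'a \<Rightarrow> 'a"
  strmap :: "nat \<Rightarrow> nat \<Rightarrow> circ \<Rightarrow> 'a \<Rightarrow> 'a"

abbreviation spx :: "'a symspec \<Rightarrow> nat \<Rightarrow> nat \<Rightarrow> 'a set" where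
  "spx X m k \<equiv> simplices (level X m) k"

abbreviation spb :: "'a symspec \<Rightarrow> nat \<Rightarrow> nat \<Rightarrow> 'a" where
  "spb X m k \<equiv> basepoint (level X m) k"

text \<open>The iterated structure map \<open>\<sigma>\<^sup>p : S\<^sup>p \<and> X(m) \<rightarrow> X(p + m)\<close>.\<close>

primrec strmap_list :: "'a symspec \<Rightarrow> nat \<Rightarrow> nat \<Rightarrow> circ list \<Rightarrow> 'a \<Rightarrow> 'a" where
  "strmap_list X m k [] x = x"
| "strmap_list X m k (s # ss) x = strmap X (length ss + m) k s (strmap_list X m k ss x)"

definition strmap_iter :: "'a symspec \<Rightarrow> nat \<Rightarrow> nat \<Rightarrow> nat \<Rightarrow> sph \<Rightarrow> 'a \<Rightarrow> 'a" where
  "strmap_iter X p m k z x = (case z of None \<Rightarrow> spb X (p + m) k | Some ss \<Rightarrow> strmap_list X m k ss x)"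

text \<open>The block sum \<open>\<Sigma>\<^sub>p \<times> \<Sigma>\<^sub>q \<rightarrow> \<Sigma>\<^sub>p\<^sub>+\<^sub>q\<close>.\<close>

definition block_sum :: "nat \<Rightarrow> (nat \<Rightarrow> nat) \<Rightarrow> (nat \<Rightarrow> nat) \<Rightarrow> nat \<Rightarrow> nat" where
  "block_sum p \<alpha> \<beta> i = (if i < p then \<alpha> i else p + \<beta> (i - p))"

definition sph_act :: "(nat \<Rightarrow> nat) \<Rightarrow> sph \<Rightarrow> sph" where
  "sph_act \<gamma> = map_option (permute_list (inv \<gamma>))"

definition is_symspec :: "'a symspec \<Rightarrow> bool" where
  "is_symspec X \<longleftrightarrow>
     (\<forall>m. is_psset (level X m)) \<and>
     (\<forall>m \<gamma>. \<gamma> permutes {..<m} \<longrightarrow> is_psset_map (level X m) (level X m) (symact X m \<gamma>)) \<and>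
     (\<forall>m k. \<forall>x \<in> spx X m k. symact X m id k x = x) \<and>
     (\<forall>m \<gamma> \<delta> k. \<gamma> permutes {..<m} \<longrightarrow> \<delta> permutes {..<m} \<longrightarrow>
        (\<forall>x \<in> spx X m k. symact X m (\<gamma> \<circ> \<delta>) k x = symact X m \<gamma> k (symact X m \<delta> k x))) \<and>
     (\<forall>m k. \<forall>s \<in> simplices circle k. \<forall>x \<in> spx X m k. strmap X m k s x \<in> spx X (Suc m) k) \<and>
     (\<forall>m k. \<forall>x \<in> spx X m k. strmap X m k (basepoint circle k) x = spb X (Suc m) k) \<and>
     (\<forall>m k. \<forall>s \<in> simplices circle k. strmap X m k s (spb X m k) = spb X (Suc m) k) \<and>
     (\<forall>m l k. \<forall>\<phi> \<in> simp_op l k. \<forall>s \<in> simplices circle k. \<forall>x \<in> spx X m k.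
        operator (level X (Suc m)) l k \<phi> (strmap X m k s x) =
          strmap X m l (operator circle l k \<phi> s) (operator (level X m) l k \<phi> x)) \<and>
     (\<forall>p m k \<alpha> \<beta>. \<alpha> permutes {..<p} \<longrightarrow> \<beta> permutes {..<m} \<longrightarrow>
        (\<forall>z \<in> simplices (sph p) k. \<forall>x \<in> spx X m k.
           strmap_iter X p m k (sph_act \<alpha> z) (symact X m \<beta> k x) =
             symact X (p + m) (block_sum p \<alpha> \<beta>) k (strmap_iter X p m k z x)))"

type_synonym ('a, 'b) spmap = "nat \<Rightarrow> nat \<Rightarrow> 'a \<Rightarrow> 'b"

definition is_spmap :: "'a symspec \<Rightarrow> 'b symspec \<Rightarrow> ('a, 'b) spmap \<Rightarrow> bool" where
  "is_spmap X Y f \<longleftrightarrow>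
     is_symspec X \<and> is_symspec Y \<and>
     (\<forall>m. is_psset_map (level X m) (level Y m) (f m)) \<and>
     (\<forall>m k \<gamma>. \<gamma> permutes {..<m} \<longrightarrow>
        (\<forall>x \<in> spx X m k. f m k (symact X m \<gamma> k x) = symact Y m \<gamma> k (f m k x))) \<and>
     (\<forall>m k. \<forall>s \<in> simplices circle k. \<forall>x \<in> spx X m k.
        f (Suc m) k (strmap X m k s x) = strmap Y m k s (f m k x))"


subsection \<open>Colimits and smash products with pointed simplicial sets\<close>

definition zero_spectrum :: "unit symspec" where
  "zero_spectrum = \<lparr>
     level = \<lambda>_. \<lparr>simplices = \<lambda>_. {()}, operator = \<lambda>_ _ _ _. (), basepoint = \<lambda>_. ()\<rparr>,
     symact = \<lambda>_ _ _ _. (),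
     strmap = \<lambda>_ _ _ _. ()\<rparr>"

definition sp_coprod :: "'i set \<Rightarrow> ('i \<Rightarrow> 'a symspec) \<Rightarrow> ('i \<times> 'a) option symspec" where
  "sp_coprod I X = \<lparr>
     level = \<lambda>m. pcoprod I (\<lambda>i. level (X i) m),
     symact = \<lambda>m \<gamma>. pcoprod_map (\<lambda>i. level (X i) m) (\<lambda>i. i) (\<lambda>i. symact (X i) m \<gamma>),
     strmap = \<lambda>m k s. pcoprod_map (\<lambda>i. level (X i) (Suc m)) (\<lambda>i. i) (\<lambda>i k. strmap (X i) m k s) k\<rparr>"

definition sp_coprod_map ::
  "('j \<Rightarrow> 'b symspec) \<Rightarrow> ('i \<Rightarrow> 'j) \<Rightarrow> ('i \<Rightarrow> ('a, 'b) spmap) \<Rightarrow>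
     (('i \<times> 'a) option, ('j \<times> 'b) option) spmap" where
  "sp_coprod_map Y u h m = pcoprod_map (\<lambda>j. level (Y j) m) u (\<lambda>i. h i m)"

text \<open>The map out of a coproduct into \<open>Z\<close> given by \<open>h i\<close> on the summand \<open>i\<close>.\<close>

definition sp_coprod_desc ::
  "'b symspec \<Rightarrow> ('i \<Rightarrow> ('a, 'b) spmap) \<Rightarrow> (('i \<times> 'a) option, 'b) spmap" where
  "sp_coprod_desc Z h m k = case_option (spb Z m k) (\<lambda>(i, x). h i m k x)"

definition sp_coeq ::
  "'a symspec \<Rightarrow> 'b symspec \<Rightarrow> ('a, 'b) spmap \<Rightarrow> ('a, 'b) spmap \<Rightarrow> 'b set symspec" where
  "sp_coeq A B f g = (let r = \<lambda>m. coeq_rel (level A m) (f m) (g m) in \<lparr>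
     level = \<lambda>m. pquot (level B m) (r m),
     symact = \<lambda>m \<gamma>. pquot_map (r m) (symact B m \<gamma>),
     strmap = \<lambda>m k s. pquot_map (r (Suc m)) (\<lambda>k. strmap B m k s) k\<rparr>)"

text \<open>The map from a coequalizer to the coequalizer of \<open>f, g : A \<rightarrow> B\<close> induced by a map \<open>h\<close> into \<open>B\<close>.\<close>

definition sp_coeq_map ::
  "'a symspec \<Rightarrow> ('a, 'b) spmap \<Rightarrow> ('a, 'b) spmap \<Rightarrow> ('c, 'b) spmap \<Rightarrow> ('c set, 'b set) spmap" where
  "sp_coeq_map A f g h m = pquot_map (coeq_rel (level A m) (f m) (g m)) (h m)"

definition sp_coeq_desc :: "('b, 'd) spmap \<Rightarrow> ('b set, 'd) spmap" where
  "sp_coeq_desc h m k = qlift (h m k)"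

definition sp_pushout ::
  "'a symspec \<Rightarrow> 'b symspec \<Rightarrow> 'c symspec \<Rightarrow> ('a, 'b) spmap \<Rightarrow> ('a, 'c) spmap \<Rightarrow>
     ('b + 'c) set symspec" where
  "sp_pushout A B C f g = (let r = \<lambda>m. pushout_rel (level A m) (f m) (g m) in \<lparr>
     level = \<lambda>m. ppushout (level A m) (level B m) (level C m) (f m) (g m),
     symact = \<lambda>m \<gamma>. pquot_map (r m) (\<lambda>k. map_sum (symact B m \<gamma> k) (symact C m \<gamma> k)),
     strmap = \<lambda>m k s. pquot_map (r (Suc m)) (\<lambda>k. map_sum (strmap B m k s) (strmap C m k s)) k\<rparr>)"

definition sp_pushout_desc ::
  "('b, 'd) spmap \<Rightarrow> ('c, 'd) spmap \<Rightarrow> (('b + 'c) set, 'd) spmap" where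
  "sp_pushout_desc u v m = ppushout_desc (u m) (v m)"

definition sp_tensor :: "'a symspec \<Rightarrow> 'b psset \<Rightarrow> ('a \<times> 'b) option symspec" where
  "sp_tensor X K = \<lparr>
     level = \<lambda>m. psmash (level X m) K,
     symact = \<lambda>m \<gamma>. psmash_map (level X m) K (symact X m \<gamma>) (\<lambda>_ y. y),
     strmap = \<lambda>m k s. psmash_map (level X (Suc m)) K (\<lambda>k. strmap X m k s) (\<lambda>_ y. y) k\<rparr>"

definition sp_tensor_map ::
  "'c symspec \<Rightarrow> 'd psset \<Rightarrow> ('a, 'c) spmap \<Rightarrow> (nat \<Rightarrow> 'b \<Rightarrow> 'd) \<Rightarrow>
     (('a \<times> 'b) option, ('c \<times> 'd) option) spmap" where
  "sp_tensor_map X K f g m = psmash_map (level X m) K (f m) g"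


subsection \<open>The sphere spectrum and the smash product of symmetric spectra\<close>

definition sphere :: "sph symspec" where
  "sphere = \<lparr>
     level = sph,
     symact = \<lambda>m \<gamma> k. sph_act \<gamma>,
     strmap = \<lambda>m k s. case_option None (\<lambda>ss. smash_pow_elt circle k (s # ss))\<rparr>"

definition sphere_bar :: "sph symspec" where
  "sphere_bar = sphere\<lparr>level := \<lambda>m.
     if m = 0 then \<lparr>simplices = \<lambda>_. {None}, operator = \<lambda>_ _ _ z. z, basepoint = \<lambda>_. None\<rparr>
     else sph m\<rparr>"

definition shuffle :: "nat \<Rightarrow> nat \<Rightarrow> nat \<Rightarrow> nat" where
  "shuffle r p i = (if i < r then i + p else if i < r + p then i - r else i)"

text \<open>\<open>A \<and> X\<close> is the coequalizer of the two maps \<open>A \<otimes> S \<otimes> X \<rightrightarrows> A \<otimes> X\<close> of symmetric sequences, where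
  \<open>(A \<otimes> X)(n)\<close> is the coproduct over \<open>p + q = n\<close> of the
  \<open>\<Sigma>\<^sub>n\<^sub>+ \<and>\<^bsub>\<Sigma>\<^sub>p \<times> \<Sigma>\<^sub>q\<^esub> (A(p) \<and> X(q))\<close>. A tuple \<open>(p, q, \<gamma>, a, x)\<close> represents the simplex
  \<open>\<gamma> \<and> a \<and> x\<close> of this summand. In rule \<open>balanced\<close>, \<open>S\<close> acts on \<open>A\<close> from the right through the twist
  \<open>A \<otimes> S \<cong> S \<otimes> A\<close>, which sends \<open>\<gamma> \<and> a \<and> z\<close> to \<open>\<gamma> \<circ> shuffle r p \<and> z \<and> a\<close>.\<close>

type_synonym ('a, 'b) smash_gen = "nat \<times> nat \<times> (nat \<Rightarrow> nat) \<times> 'a \<times> 'b"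

definition smash_gens :: "'a symspec \<Rightarrow> 'b symspec \<Rightarrow> nat \<Rightarrow> nat \<Rightarrow> ('a, 'b) smash_gen set" where
  "smash_gens A X n k =
     {(p, q, \<gamma>, a, x). p + q = n \<and> \<gamma> permutes {..<n} \<and> a \<in> spx A p k \<and> x \<in> spx X q k}"

inductive smash_rel ::
  "'a symspec \<Rightarrow> 'b symspec \<Rightarrow> nat \<Rightarrow> nat \<Rightarrow> ('a, 'b) smash_gen \<Rightarrow> ('a, 'b) smash_gen \<Rightarrow> bool"
  for A X n k where
  base: "(p, q, \<gamma>, a, x) \<in> smash_gens A X n k \<Longrightarrow> a = spb A p k \<or> x = spb X q k \<Longrightarrow>
    (p', q', \<gamma>', a', x') \<in> smash_gens A X n k \<Longrightarrow> a' = spb A p' k \<or> x' = spb X q' k \<Longrightarrow>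
    smash_rel A X n k (p, q, \<gamma>, a, x) (p', q', \<gamma>', a', x')"
| equivariant: "(p, q, \<gamma>, a, x) \<in> smash_gens A X n k \<Longrightarrow>
    \<alpha> permutes {..<p} \<Longrightarrow> \<beta> permutes {..<q} \<Longrightarrow>
    smash_rel A X n k (p, q, \<gamma> \<circ> block_sum p \<alpha> \<beta>, a, x)
      (p, q, \<gamma>, symact A p \<alpha> k a, symact X q \<beta> k x)"
| balanced: "p + r + q = n \<Longrightarrow> \<gamma> permutes {..<n} \<Longrightarrow>
    a \<in> spx A p k \<Longrightarrow> z \<in> simplices (sph r) k \<Longrightarrow> x \<in> spx X q k \<Longrightarrow>
    smash_rel A X n k (p, r + q, \<gamma>, a, strmap_iter X r q k z x)
      (r + p, q, \<gamma> \<circ> block_sum (r + p) (shuffle r p) id, strmap_iter A r p k z a, x)"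

definition sp_smash_op ::
  "'a symspec \<Rightarrow> 'b symspec \<Rightarrow> nat \<Rightarrow> nat \<Rightarrow> (nat \<Rightarrow> nat) \<Rightarrow>
     ('a, 'b) smash_gen \<Rightarrow> ('a, 'b) smash_gen" where
  "sp_smash_op A X l k \<phi> = (\<lambda>(p, q, \<gamma>, a, x).
     (p, q, \<gamma>, operator (level A p) l k \<phi> a, operator (level X q) l k \<phi> x))"

definition sp_smash :: "'a symspec \<Rightarrow> 'b symspec \<Rightarrow> ('a, 'b) smash_gen set symspec" where
  "sp_smash A X = \<lparr>
     level = \<lambda>n. pquot
       \<lparr>simplices = smash_gens A X n,
        operator = sp_smash_op A X,
        basepoint = \<lambda>k. (0, n, id, spb A 0 k, spb X n k)\<rparr>
       (smash_rel A X n),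
     symact = \<lambda>n \<delta>. pquot_map (smash_rel A X n) (\<lambda>k (p, q, \<gamma>, a, x). (p, q, \<delta> \<circ> \<gamma>, a, x)),
     strmap = \<lambda>n k s. pquot_map (smash_rel A X (Suc n))
       (\<lambda>k (p, q, \<gamma>, a, x). (Suc p, q, block_sum 1 id \<gamma>, strmap A p k s a, x)) k\<rparr>"

definition sp_smash_map ::
  "'c symspec \<Rightarrow> 'd symspec \<Rightarrow> ('a, 'c) spmap \<Rightarrow> ('b, 'd) spmap \<Rightarrow>
     (('a, 'b) smash_gen set, ('c, 'd) smash_gen set) spmap" where
  "sp_smash_map B Y f g n = pquot_map (smash_rel B Y n)
     (\<lambda>k (p, q, \<gamma>, a, x). (p, q, \<gamma>, f p k a, g q k x))"

text \<open>The unit isomorphism \<open>S \<and> X \<cong> X\<close>.\<close>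

definition sp_unit :: "'a symspec \<Rightarrow> ((sph, 'a) smash_gen set, 'a) spmap" where
  "sp_unit X n k = qlift (\<lambda>(p, q, \<gamma>, z, x). symact X n \<gamma> k (strmap_iter X p q k z x))"


section \<open>Cofibrations of symmetric spectra\<close>

text \<open>Spectral latching objects \<open>L\<^sub>m X\<close>. In the map \<open>\<nu>\<^sub>m\<close>, the map from \<^const>\<open>sphere_bar\<close> to
  \<^const>\<open>sphere\<close> is an inclusion.\<close>

definition spectral_latch :: "'a symspec \<Rightarrow> nat \<Rightarrow> (sph, 'a) smash_gen set psset" where
  "spectral_latch X m = level (sp_smash sphere_bar X) m"

definition spectral_latch_map ::
  "'b symspec \<Rightarrow> ('a, 'b) spmap \<Rightarrow> ((sph, 'a) smash_gen set, (sph, 'b) smash_gen set) spmap" where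
  "spectral_latch_map Y f = sp_smash_map sphere_bar Y (\<lambda>_ _ z. z) f"

definition nu :: "'a symspec \<Rightarrow> ((sph, 'a) smash_gen set, 'a) spmap" where
  "nu X m k c = sp_unit X m k (sp_smash_map sphere X (\<lambda>_ _ z. z) (\<lambda>_ _ x. x) m k c)"

definition levelwise_cofibration :: "'a symspec \<Rightarrow> 'b symspec \<Rightarrow> ('a, 'b) spmap \<Rightarrow> bool" where
  "levelwise_cofibration X Y f \<longleftrightarrow>
     is_spmap X Y f \<and> (\<forall>m. is_cofibration (level X m) (level Y m) (f m))"

definition flat_cofibration :: "'a symspec \<Rightarrow> 'b symspec \<Rightarrow> ('a, 'b) spmap \<Rightarrow> bool" where
  "flat_cofibration X Y f \<longleftrightarrow>
     is_spmap X Y f \<and>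
     (\<forall>m. is_cofibration
        (ppushout (spectral_latch X m) (level X m) (spectral_latch Y m)
           (nu X m) (spectral_latch_map Y f m))
        (level Y m)
        (ppushout_desc (f m) (nu Y m)))"

definition positive_flat_cofibration :: "'a symspec \<Rightarrow> 'b symspec \<Rightarrow> ('a, 'b) spmap \<Rightarrow> bool" where
  "positive_flat_cofibration X Y f \<longleftrightarrow>
     flat_cofibration X Y f \<and> is_psset_iso (level X 0) (level Y 0) (f 0)"

definition flat_cofibrant :: "'a symspec \<Rightarrow> bool" where
  "flat_cofibrant X \<longleftrightarrow> flat_cofibration zero_spectrum X (\<lambda>m k _. spb X m k)"

definition positive_flat_cofibrant :: "'a symspec \<Rightarrow> bool" where
  "positive_flat_cofibrant X \<longleftrightarrow> positive_flat_cofibration zero_spectrum X (\<lambda>m k _. spb X m k)"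


section \<open>Simplicial symmetric spectra\<close>

record 'a simpspec =
  obj :: "nat \<Rightarrow> 'a symspec"
  sop :: "nat \<Rightarrow> nat \<Rightarrow> (nat \<Rightarrow> nat) \<Rightarrow> ('a, 'a) spmap"

definition is_simpspec :: "'a simpspec \<Rightarrow> bool" where
  "is_simpspec X \<longleftrightarrow>
     (\<forall>a b. \<forall>\<theta> \<in> simp_op a b. is_spmap (obj X b) (obj X a) (sop X a b \<theta>)) \<and>
     (\<forall>a m k. \<forall>x \<in> spx (obj X a) m k. sop X a a (\<lambda>i\<in>{..a}. i) m k x = x) \<and>
     (\<forall>a b c m k. \<forall>\<phi> \<in> simp_op a b. \<forall>\<theta> \<in> simp_op b c. \<forall>x \<in> spx (obj X c) m k.
        sop X a c (compose {..a} \<theta> \<phi>) m k x = sop X a b \<phi> m k (sop X b c \<theta> m k x))"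

definition is_simpspec_map ::
  "'a simpspec \<Rightarrow> 'b simpspec \<Rightarrow> (nat \<Rightarrow> ('a, 'b) spmap) \<Rightarrow> bool" where
  "is_simpspec_map X Y f \<longleftrightarrow>
     is_simpspec X \<and> is_simpspec Y \<and>
     (\<forall>n. is_spmap (obj X n) (obj Y n) (f n)) \<and>
     (\<forall>a b m k. \<forall>\<theta> \<in> simp_op a b. \<forall>x \<in> spx (obj X b) m k.
        f a m k (sop X a b \<theta> m k x) = sop Y a b \<theta> m k (f b m k x))"

text \<open>The degeneracy map \<open>s\<^sub>i : X\<^sub>n \<rightarrow> X\<^sub>n\<^sub>+\<^sub>1\<close>.\<close>

definition degen :: "'a simpspec \<Rightarrow> nat \<Rightarrow> nat \<Rightarrow> ('a, 'a) spmap" where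
  "degen X n i = sop X (Suc n) n (\<lambda>j\<in>{..Suc n}. if j \<le> i then j else j - 1)"


subsection \<open>Simplicial latching objects\<close>

text \<open>For \<open>n \<le> 1\<close> the coproduct over \<open>i < j < n\<close> is the zero object, and the coproduct over \<open>k < n\<close> is
  the zero object for \<open>n = 0\<close> and \<open>X\<^sub>0\<close> for \<open>n = 1\<close>, so the coequalizer formula also gives these cases
  of the simplicial latching object.\<close>

definition latch_rels :: "'a simpspec \<Rightarrow> nat \<Rightarrow> ((nat \<times> nat) \<times> 'a) option symspec" where
  "latch_rels X n = sp_coprod {(i, j). i < j \<and> j < n} (\<lambda>_. obj X (n - 2))"

definition latch_gens :: "'a simpspec \<Rightarrow> nat \<Rightarrow> (nat \<times> 'a) option symspec" where
  "latch_gens X n = sp_coprod {..<n} (\<lambda>_. obj X (n - 1))"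

definition latch_S1 ::
  "'a simpspec \<Rightarrow> nat \<Rightarrow> (((nat \<times> nat) \<times> 'a) option, (nat \<times> 'a) option) spmap" where
  "latch_S1 X n = sp_coprod_map (\<lambda>_. obj X (n - 1)) (\<lambda>(i, j). j) (\<lambda>(i, j). degen X (n - 2) i)"

definition latch_S2 ::
  "'a simpspec \<Rightarrow> nat \<Rightarrow> (((nat \<times> nat) \<times> 'a) option, (nat \<times> 'a) option) spmap" where
  "latch_S2 X n = sp_coprod_map (\<lambda>_. obj X (n - 1)) (\<lambda>(i, j). i) (\<lambda>(i, j). degen X (n - 2) (j - 1))"

definition simp_latch :: "'a simpspec \<Rightarrow> nat \<Rightarrow> (nat \<times> 'a) option set symspec" where
  "simp_latch X n = sp_coeq (latch_rels X n) (latch_gens X n) (latch_S1 X n) (latch_S2 X n)"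

definition latching_map :: "'a simpspec \<Rightarrow> nat \<Rightarrow> ((nat \<times> 'a) option set, 'a) spmap" where
  "latching_map X n = sp_coeq_desc (sp_coprod_desc (obj X n) (\<lambda>k. degen X (n - 1) k))"

definition simp_latch_map ::
  "'b simpspec \<Rightarrow> (nat \<Rightarrow> ('a, 'b) spmap) \<Rightarrow> nat \<Rightarrow>
     ((nat \<times> 'a) option set, (nat \<times> 'b) option set) spmap" where
  "simp_latch_map Y f n = sp_coeq_map (latch_rels Y n) (latch_S1 Y n) (latch_S2 Y n)
     (sp_coprod_map (\<lambda>_. obj Y (n - 1)) (\<lambda>k. k) (\<lambda>_. f (n - 1)))"

definition latching_corner ::
  "'a simpspec \<Rightarrow> 'b simpspec \<Rightarrow> (nat \<Rightarrow> ('a, 'b) spmap) \<Rightarrow> nat \<Rightarrow>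
     ('a + (nat \<times> 'b) option set) set symspec" where
  "latching_corner X Y f n =
     sp_pushout (simp_latch X n) (obj X n) (simp_latch Y n) (latching_map X n) (simp_latch_map Y f n)"

definition latching_corner_map ::
  "'b simpspec \<Rightarrow> (nat \<Rightarrow> ('a, 'b) spmap) \<Rightarrow> nat \<Rightarrow>
     (('a + (nat \<times> 'b) option set) set, 'b) spmap" where
  "latching_corner_map Y f n = sp_pushout_desc (f n) (latching_map Y n)"

definition reedy_flat_cofibration ::
  "'a simpspec \<Rightarrow> 'b simpspec \<Rightarrow> (nat \<Rightarrow> ('a, 'b) spmap) \<Rightarrow> bool" where
  "reedy_flat_cofibration X Y f \<longleftrightarrow>
     is_simpspec_map X Y f \<and>
     (\<forall>n. flat_cofibration (latching_corner X Y f n) (obj Y n) (latching_corner_map Y f n))"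

definition reedy_positive_flat_cofibration ::
  "'a simpspec \<Rightarrow> 'b simpspec \<Rightarrow> (nat \<Rightarrow> ('a, 'b) spmap) \<Rightarrow> bool" where
  "reedy_positive_flat_cofibration X Y f \<longleftrightarrow>
     is_simpspec_map X Y f \<and>
     (\<forall>n. positive_flat_cofibration (latching_corner X Y f n) (obj Y n) (latching_corner_map Y f n))"


subsection \<open>Geometric realization\<close>

text \<open>The coend of \<open>X\<^sub>n \<and> \<Delta>[n]\<^sub>+\<close>, as the coequalizer of two maps from the coproduct of
  \<open>X\<^sub>b \<and> \<Delta>[a]\<^sub>+\<close> over all \<open>\<theta> : [a] \<rightarrow> [b]\<close>.\<close>

definition real_gens :: "'a simpspec \<Rightarrow> (nat \<times> ('a \<times> (nat \<Rightarrow> nat) option) option) option symspec" where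
  "real_gens X = sp_coprod UNIV (\<lambda>n. sp_tensor (obj X n) (std_simplex_plus n))"

definition real_rels ::
  "'a simpspec \<Rightarrow>
     ((nat \<times> nat \<times> (nat \<Rightarrow> nat)) \<times> ('a \<times> (nat \<Rightarrow> nat) option) option) option symspec" where
  "real_rels X = sp_coprod {(a, b, \<theta>). \<theta> \<in> simp_op a b}
     (\<lambda>(a, b, \<theta>). sp_tensor (obj X b) (std_simplex_plus a))"

definition real_left ::
  "'a simpspec \<Rightarrow>
     (((nat \<times> nat \<times> (nat \<Rightarrow> nat)) \<times> ('a \<times> (nat \<Rightarrow> nat) option) option) option,
      (nat \<times> ('a \<times> (nat \<Rightarrow> nat) option) option) option) spmap" where
  "real_left X = sp_coprod_map (\<lambda>n. sp_tensor (obj X n) (std_simplex_plus n)) (\<lambda>(a, b, \<theta>). a)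
     (\<lambda>(a, b, \<theta>). sp_tensor_map (obj X a) (std_simplex_plus a) (sop X a b \<theta>) (\<lambda>_ t. t))"

definition real_right ::
  "'a simpspec \<Rightarrow>
     (((nat \<times> nat \<times> (nat \<Rightarrow> nat)) \<times> ('a \<times> (nat \<Rightarrow> nat) option) option) option,
      (nat \<times> ('a \<times> (nat \<Rightarrow> nat) option) option) option) spmap" where
  "real_right X = sp_coprod_map (\<lambda>n. sp_tensor (obj X n) (std_simplex_plus n)) (\<lambda>(a, b, \<theta>). b)
     (\<lambda>(a, b, \<theta>). sp_tensor_map (obj X b) (std_simplex_plus b) (\<lambda>_ _ x. x) (std_simplex_map \<theta>))"

definition realization ::
  "'a simpspec \<Rightarrow> (nat \<times> ('a \<times> (nat \<Rightarrow> nat) option) option) option set symspec" where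
  "realization X = sp_coeq (real_rels X) (real_gens X) (real_left X) (real_right X)"

definition realization_map ::
  "'b simpspec \<Rightarrow> (nat \<Rightarrow> ('a, 'b) spmap) \<Rightarrow>
     ((nat \<times> ('a \<times> (nat \<Rightarrow> nat) option) option) option set,
      (nat \<times> ('b \<times> (nat \<Rightarrow> nat) option) option) option set) spmap" where
  "realization_map Y f = sp_coeq_map (real_rels Y) (real_left Y) (real_right Y)
     (sp_coprod_map (\<lambda>n. sp_tensor (obj Y n) (std_simplex_plus n)) (\<lambda>n. n)
       (\<lambda>n. sp_tensor_map (obj Y n) (std_simplex_plus n) (f n) (\<lambda>_ t. t)))"

end

theory Submission
  imports Defs
begin

text \<open>Everything takes place in a fixed simplicial degree \<open>k\<close>. Call a simplex of \<open>X(m)\<close> decomposable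
  if it lies in the image of \<open>\<nu>\<^sub>m\<close>. If \<open>Y\<close> is flat-cofibrant, a map \<open>f : X \<rightarrow> Y\<close> is a flat cofibration
  if and only if it is levelwise injective and reflects decomposable simplices. For the injectivity
  of a flat cofibration one shows by induction on \<open>m\<close> that \<open>L\<^sub>m f\<close> is injective: a chain of elementary
  relations in \<open>L\<^sub>m Y\<close> that starts at an element coming from \<open>X\<close> lifts to \<open>X\<close> step by step.

  The criterion needs no flatness of the source, so it applies to the latching corner map at once:
  \<open>s\<^sub>i y = s\<^sub>j y'\<close> with \<open>i < j\<close> forces \<open>y' = s\<^sub>i z\<close> and \<open>y = s\<^sub>j\<^sub>-\<^sub>1 z\<close>, which is a defining relation
  of the latching object; \<open>f x = s\<^sub>i y\<close> forces \<open>x = s\<^sub>i d\<^sub>i x\<close>; and if \<open>s\<^sub>i y\<close> is decomposable, so is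
  \<open>y = d\<^sub>i s\<^sub>i y\<close>. In degree \<open>k\<close> the realization of \<open>X\<close> is the set of \<open>k\<close>-simplices of \<open>X\<^sub>k\<close>, so
  that the criterion passes from \<open>f\<^sub>k\<close> to the realization of \<open>f\<close>.\<close>

section \<open>Quotients of pointed simplicial sets\<close>

lemma psset_base_in: "is_psset A \<Longrightarrow> basepoint A n \<in> simplices A n"
  by (simp add: is_psset_def)

lemma psset_op_in:
  "is_psset A \<Longrightarrow> \<theta> \<in> simp_op m n \<Longrightarrow> x \<in> simplices A n \<Longrightarrow> operator A m n \<theta> x \<in> simplices A m"
  unfolding is_psset_def by blast

lemma psset_op_base:
  "is_psset A \<Longrightarrow> \<theta> \<in> simp_op m n \<Longrightarrow> operator A m n \<theta> (basepoint A n) = basepoint A m"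
  unfolding is_psset_def by blast

lemma psset_op_id: "is_psset A \<Longrightarrow> x \<in> simplices A n \<Longrightarrow> operator A n n (\<lambda>i\<in>{..n}. i) x = x"
  unfolding is_psset_def by blast

lemma psset_op_comp:
  "is_psset A \<Longrightarrow> \<phi> \<in> simp_op l m \<Longrightarrow> \<theta> \<in> simp_op m n \<Longrightarrow> x \<in> simplices A n \<Longrightarrow>
    operator A l n (compose {..l} \<theta> \<phi>) x = operator A l m \<phi> (operator A m n \<theta> x)"
  unfolding is_psset_def by blast

lemma is_pssetI:
  assumes "\<And>n. basepoint A n \<in> simplices A n"
    and "\<And>m n \<theta> x. \<theta> \<in> simp_op m n \<Longrightarrow> x \<in> simplices A n \<Longrightarrow> operator A m n \<theta> x \<in> simplices A m"
    and "\<And>m n \<theta>. \<theta> \<in> simp_op m n \<Longrightarrow> operator A m n \<theta> (basepoint A n) = basepoint A m"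
    and "\<And>n x. x \<in> simplices A n \<Longrightarrow> operator A n n (\<lambda>i\<in>{..n}. i) x = x"
    and "\<And>l m n \<phi> \<theta> x. \<phi> \<in> simp_op l m \<Longrightarrow> \<theta> \<in> simp_op m n \<Longrightarrow> x \<in> simplices A n \<Longrightarrow>
      operator A l n (compose {..l} \<theta> \<phi>) x = operator A l m \<phi> (operator A m n \<theta> x)"
  shows "is_psset A"
  unfolding is_psset_def using assms by blast

lemma psset_map_in: "is_psset_map A B f \<Longrightarrow> x \<in> simplices A n \<Longrightarrow> f n x \<in> simplices B n"
  unfolding is_psset_map_def by blast

lemma psset_map_base: "is_psset_map A B f \<Longrightarrow> f n (basepoint A n) = basepoint B n"
  unfolding is_psset_map_def by blast

lemma psset_map_op:
  "is_psset_map A B f \<Longrightarrow> \<theta> \<in> simp_op m n \<Longrightarrow> x \<in> simplices A n \<Longrightarrow>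
    f m (operator A m n \<theta> x) = operator B m n \<theta> (f n x)"
  unfolding is_psset_map_def by blast

lemma is_psset_mapI:
  assumes "is_psset A" "is_psset B" "\<And>n x. x \<in> simplices A n \<Longrightarrow> f n x \<in> simplices B n"
    and "\<And>n. f n (basepoint A n) = basepoint B n"
    and "\<And>m n \<theta> x. \<theta> \<in> simp_op m n \<Longrightarrow> x \<in> simplices A n \<Longrightarrow>
      f m (operator A m n \<theta> x) = operator B m n \<theta> (f n x)"
  shows "is_psset_map A B f"
  unfolding is_psset_map_def using assms by blast

lemma simp_op_id: "(\<lambda>i\<in>{..n}. i) \<in> simp_op n n"
  by (auto simp: simp_op_def mono_on_def)

lemma simp_op_in: "\<theta> \<in> simp_op m n \<Longrightarrow> i \<le> m \<Longrightarrow> \<theta> i \<le> n"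
  by (auto simp: simp_op_def)

lemma simp_op_compose:
  assumes "\<phi> \<in> simp_op l m" "\<theta> \<in> simp_op m n"
  shows "compose {..l} \<theta> \<phi> \<in> simp_op l n"
  using assms unfolding simp_op_def mono_on_def compose_def by (auto simp: PiE_def Pi_def)

lemma simp_op_id_right: "\<theta> \<in> simp_op m n \<Longrightarrow> compose {..m} \<theta> (\<lambda>i\<in>{..m}. i) = \<theta>"
  by (rule ext) (auto simp: compose_def simp_op_def PiE_def extensional_def)

lemma simp_op_assoc:
  assumes "\<phi> \<in> simp_op l m" "\<theta> \<in> simp_op m n"
  shows "compose {..l} (compose {..m} \<psi> \<theta>) \<phi> = compose {..l} \<psi> (compose {..l} \<theta> \<phi>)"
  using simp_op_in[OF assms(1)] by (intro ext) (auto simp: compose_def)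

lemma qclass_eq_iff: "qclass r x = qclass r y \<longleftrightarrow> equivclp r x y"
  unfolding qclass_def
  by (auto intro: equivclp_trans equivclp_sym dest: equivclp_sym set_eq_iff[THEN iffD1])

lemma mem_qclass: "x \<in> qclass r x"
  by (simp add: qclass_def)

lemma equivclp_invariant:
  assumes "equivclp r x y" and "\<And>a b. r a b \<Longrightarrow> h a = h b"
  shows "h x = h y"
  using assms(1) by (induction rule: equivclp_induct) (auto dest: assms(2))

lemma equivclp_map:
  assumes "equivclp r x y" and "\<And>a b. r a b \<Longrightarrow> equivclp r' (h a) (h b)"
  shows "equivclp r' (h x) (h y)"
  using assms(1)
  by (induction rule: equivclp_induct) (auto dest: assms(2) intro: equivclp_trans equivclp_sym)

lemma qlift_qclass:
  assumes "\<And>a b. r a b \<Longrightarrow> h a = h b"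
  shows "qlift h (qclass r x) = h x"
proof -
  have "h ` qclass r x = {h x}"
    using equivclp_invariant[of r x _ h, OF _ assms] mem_qclass[of x r]
    by (auto simp: qclass_def)
  then show ?thesis by (simp add: qlift_def)
qed

lemma pquot_map_qclass:
  assumes "\<And>a b. r a b \<Longrightarrow> equivclp (r' k) (h k a) (h k b)"
  shows "pquot_map r' h k (qclass r x) = qclass (r' k) (h k x)"
  unfolding pquot_map_def using assms by (intro qlift_qclass) (simp add: qclass_eq_iff)

lemma simplices_pquot [simp]: "simplices (pquot A r) k = qclass (r k) ` simplices A k"
  by (simp add: pquot_def)

lemma basepoint_pquot [simp]: "basepoint (pquot A r) k = qclass (r k) (basepoint A k)"
  by (simp add: pquot_def)

lemma operator_pquot:
  assumes "\<And>a b. r n a b \<Longrightarrow> equivclp (r m) (operator A m n \<theta> a) (operator A m n \<theta> b)"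
  shows "operator (pquot A r) m n \<theta> (qclass (r n) x) = qclass (r m) (operator A m n \<theta> x)"
  unfolding pquot_def using assms by (simp add: qlift_qclass qclass_eq_iff)

definition op_compat :: "'a psset \<Rightarrow> (nat \<Rightarrow> 'a \<Rightarrow> 'a \<Rightarrow> bool) \<Rightarrow> bool" where
  "op_compat A r \<longleftrightarrow> (\<forall>m n a b. \<forall>\<theta> \<in> simp_op m n.
     r n a b \<longrightarrow> equivclp (r m) (operator A m n \<theta> a) (operator A m n \<theta> b))"

lemma operator_pquot':
  "op_compat A r \<Longrightarrow> \<theta> \<in> simp_op m n \<Longrightarrow>
    operator (pquot A r) m n \<theta> (qclass (r n) x) = qclass (r m) (operator A m n \<theta> x)"
  by (rule operator_pquot) (simp add: op_compat_def)

lemma is_psset_pquot: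
  assumes "is_psset A" "op_compat A r"
  shows "is_psset (pquot A r)"
proof (rule is_pssetI)
  fix l m n \<phi> \<theta> x
  assume *: "\<phi> \<in> simp_op l m" "\<theta> \<in> simp_op m n" "x \<in> simplices (pquot A r) n"
  then show "operator (pquot A r) l n (compose {..l} \<theta> \<phi>) x =
    operator (pquot A r) l m \<phi> (operator (pquot A r) m n \<theta> x)"
    using assms by (auto simp: operator_pquot' simp_op_compose psset_op_comp)
qed (use assms in \<open>auto simp: operator_pquot' simp_op_id psset_base_in psset_op_in psset_op_base psset_op_id\<close>)

lemma coeq_rel_map:
  assumes "coeq_rel A f g k y y'"
    and "\<And>a. a \<in> simplices A k \<Longrightarrow> h a \<in> simplices A' k'"
    and "\<And>a. a \<in> simplices A k \<Longrightarrow> u (f k a) = f' k' (h a)"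
    and "\<And>a. a \<in> simplices A k \<Longrightarrow> u (g k a) = g' k' (h a)"
  shows "coeq_rel A' f' g' k' (u y) (u y')"
  using assms unfolding coeq_rel_def by metis

section \<open>Symmetric spectra\<close>

definition symspec_at :: "'a symspec \<Rightarrow> nat \<Rightarrow> nat \<Rightarrow> 'a \<Rightarrow> bool" where
  "symspec_at X m k x \<longleftrightarrow>
     (\<forall>\<gamma>. \<gamma> permutes {..<m} \<longrightarrow> symact X m \<gamma> k x \<in> spx X m k) \<and>
     (\<forall>\<gamma> l. \<forall>\<phi> \<in> simp_op l k. \<gamma> permutes {..<m} \<longrightarrow>
        symact X m \<gamma> l (operator (level X m) l k \<phi> x) =
          operator (level X m) l k \<phi> (symact X m \<gamma> k x)) \<and>
     symact X m id k x = x \<and>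
     (\<forall>\<gamma> \<delta>. \<gamma> permutes {..<m} \<longrightarrow> \<delta> permutes {..<m} \<longrightarrow>
        symact X m (\<gamma> \<circ> \<delta>) k x = symact X m \<gamma> k (symact X m \<delta> k x)) \<and>
     (\<forall>s \<in> simplices circle k. strmap X m k s x \<in> spx X (Suc m) k) \<and>
     strmap X m k (basepoint circle k) x = spb X (Suc m) k \<and>
     (\<forall>l. \<forall>\<phi> \<in> simp_op l k. \<forall>s \<in> simplices circle k.
        operator (level X (Suc m)) l k \<phi> (strmap X m k s x) =
          strmap X m l (operator circle l k \<phi> s) (operator (level X m) l k \<phi> x)) \<and>
     (\<forall>p \<alpha> \<beta>. \<forall>z \<in> simplices (sph p) k. \<alpha> permutes {..<p} \<longrightarrow> \<beta> permutes {..<m} \<longrightarrow>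
        strmap_iter X p m k (sph_act \<alpha> z) (symact X m \<beta> k x) =
          symact X (p + m) (block_sum p \<alpha> \<beta>) k (strmap_iter X p m k z x))"

lemma is_symspec_iff:
  "is_symspec X \<longleftrightarrow>
     (\<forall>m. is_psset (level X m)) \<and>
     (\<forall>m k \<gamma>. \<gamma> permutes {..<m} \<longrightarrow> symact X m \<gamma> k (spb X m k) = spb X m k) \<and>
     (\<forall>m k. \<forall>s \<in> simplices circle k. strmap X m k s (spb X m k) = spb X (Suc m) k) \<and>
     (\<forall>m k. \<forall>x \<in> spx X m k. symspec_at X m k x)"
  (is "?L \<longleftrightarrow> ?R")
proof
  assume ?L then show ?R
    unfolding is_symspec_def is_psset_map_def symspec_at_def Pi_iff by (safe; metis)
next
  assume R: ?R
  show ?L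
    unfolding is_symspec_def is_psset_map_def Pi_iff
    using R unfolding symspec_at_def by (safe; metis)
qed

lemma
  assumes X: "is_symspec X"
  shows symspec_psset: "is_psset (level X m)"
    and symact_base: "\<gamma> permutes {..<m} \<Longrightarrow> symact X m \<gamma> k (spb X m k) = spb X m k"
    and strmap_base: "s \<in> simplices circle k \<Longrightarrow> strmap X m k s (spb X m k) = spb X (Suc m) k"
    and symact_in: "\<gamma> permutes {..<m} \<Longrightarrow> x \<in> spx X m k \<Longrightarrow> symact X m \<gamma> k x \<in> spx X m k"
    and symact_op: "\<gamma> permutes {..<m} \<Longrightarrow> x \<in> spx X m k \<Longrightarrow> \<phi> \<in> simp_op l k \<Longrightarrow>
      symact X m \<gamma> l (operator (level X m) l k \<phi> x) = operator (level X m) l k \<phi> (symact X m \<gamma> k x)"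
    and symact_id: "x \<in> spx X m k \<Longrightarrow> symact X m id k x = x"
    and symact_comp: "\<gamma> permutes {..<m} \<Longrightarrow> \<delta> permutes {..<m} \<Longrightarrow> x \<in> spx X m k \<Longrightarrow>
      symact X m (\<gamma> \<circ> \<delta>) k x = symact X m \<gamma> k (symact X m \<delta> k x)"
    and strmap_in: "s \<in> simplices circle k \<Longrightarrow> x \<in> spx X m k \<Longrightarrow> strmap X m k s x \<in> spx X (Suc m) k"
    and strmap_circle_base: "x \<in> spx X m k \<Longrightarrow> strmap X m k (basepoint circle k) x = spb X (Suc m) k"
    and strmap_op: "s \<in> simplices circle k \<Longrightarrow> x \<in> spx X m k \<Longrightarrow> \<phi> \<in> simp_op l k \<Longrightarrow>
      operator (level X (Suc m)) l k \<phi> (strmap X m k s x) =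
          strmap X m l (operator circle l k \<phi> s) (operator (level X m) l k \<phi> x)"
    and strmap_iter_equivariant: "z \<in> simplices (sph p) k \<Longrightarrow> \<alpha> permutes {..<p} \<Longrightarrow>
      \<beta> permutes {..<m} \<Longrightarrow> x \<in> spx X m k \<Longrightarrow>
        strmap_iter X p m k (sph_act \<alpha> z) (symact X m \<beta> k x) =
          symact X (p + m) (block_sum p \<alpha> \<beta>) k (strmap_iter X p m k z x)"
proof -
  have R: "is_psset (level X m)"
    "\<gamma> permutes {..<m} \<longrightarrow> symact X m \<gamma> k (spb X m k) = spb X m k"
    "s \<in> simplices circle k \<longrightarrow> strmap X m k s (spb X m k) = spb X (Suc m) k"
    using X unfolding is_symspec_iff by blast+
  show "is_psset (level X m)" using R(1) .
  show "\<gamma> permutes {..<m} \<Longrightarrow> symact X m \<gamma> k (spb X m k) = spb X m k" using R(2) by blast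
  show "s \<in> simplices circle k \<Longrightarrow> strmap X m k s (spb X m k) = spb X (Suc m) k" using R(3) by blast
qed (use X in \<open>(simp add: is_symspec_iff symspec_at_def; fail)+\<close>)

lemma
  assumes X: "is_symspec X"
  shows symspec_base_in: "spb X m k \<in> spx X m k"
    and symspec_op_in: "\<phi> \<in> simp_op l k \<Longrightarrow> x \<in> spx X m k \<Longrightarrow> operator (level X m) l k \<phi> x \<in> spx X m l"
    and symspec_op_base: "\<phi> \<in> simp_op l k \<Longrightarrow> operator (level X m) l k \<phi> (spb X m k) = spb X m l"
  using symspec_psset[OF X] by (auto intro: psset_base_in psset_op_in psset_op_base)

definition spmap_at :: "'a symspec \<Rightarrow> 'b symspec \<Rightarrow> ('a, 'b) spmap \<Rightarrow> nat \<Rightarrow> nat \<Rightarrow> 'a \<Rightarrow> bool" where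
  "spmap_at X Y f m k x \<longleftrightarrow>
     f m k x \<in> spx Y m k \<and>
     (\<forall>l. \<forall>\<phi> \<in> simp_op l k. f m l (operator (level X m) l k \<phi> x) = operator (level Y m) l k \<phi> (f m k x)) \<and>
     (\<forall>\<gamma>. \<gamma> permutes {..<m} \<longrightarrow> f m k (symact X m \<gamma> k x) = symact Y m \<gamma> k (f m k x)) \<and>
     (\<forall>s \<in> simplices circle k. f (Suc m) k (strmap X m k s x) = strmap Y m k s (f m k x))"

definition pre_spmap :: "'a symspec \<Rightarrow> 'b symspec \<Rightarrow> ('a, 'b) spmap \<Rightarrow> bool" where
  "pre_spmap X Y f \<longleftrightarrow>
     (\<forall>m k. f m k (spb X m k) = spb Y m k) \<and> (\<forall>m k. \<forall>x \<in> spx X m k. spmap_at X Y f m k x)"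

lemma is_spmap_iff: "is_spmap X Y f \<longleftrightarrow> is_symspec X \<and> is_symspec Y \<and> pre_spmap X Y f"
  (is "?L \<longleftrightarrow> ?R")
proof
  assume ?L then show ?R
    unfolding is_spmap_def is_psset_map_def pre_spmap_def spmap_at_def Pi_iff by (safe; metis)
next
  assume R: ?R
  then have "is_psset (level X m)" "is_psset (level Y m)" for m by (auto intro: symspec_psset)
  then show ?L
    using R unfolding is_spmap_def is_psset_map_def pre_spmap_def spmap_at_def Pi_iff
    by (safe; metis)
qed

lemma
  assumes f: "pre_spmap X Y f"
  shows pre_spmap_base: "f m k (spb X m k) = spb Y m k"
    and pre_spmap_in: "x \<in> spx X m k \<Longrightarrow> f m k x \<in> spx Y m k"
    and pre_spmap_op: "x \<in> spx X m k \<Longrightarrow> \<phi> \<in> simp_op l k \<Longrightarrow>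
      f m l (operator (level X m) l k \<phi> x) = operator (level Y m) l k \<phi> (f m k x)"
    and pre_spmap_symact: "x \<in> spx X m k \<Longrightarrow> \<gamma> permutes {..<m} \<Longrightarrow>
      f m k (symact X m \<gamma> k x) = symact Y m \<gamma> k (f m k x)"
    and pre_spmap_strmap: "x \<in> spx X m k \<Longrightarrow> s \<in> simplices circle k \<Longrightarrow>
      f (Suc m) k (strmap X m k s x) = strmap Y m k s (f m k x)"
  using f unfolding pre_spmap_def spmap_at_def by blast+

lemma
  assumes "is_spmap X Y f"
  shows spmap_dom: "is_symspec X"
    and spmap_cod: "is_symspec Y"
    and spmap_pre: "pre_spmap X Y f"
  using assms by (simp_all add: is_spmap_iff)

lemmas spmap_base = pre_spmap_base[OF spmap_pre]
  and spmap_in = pre_spmap_in[OF spmap_pre]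
  and spmap_op = pre_spmap_op[OF spmap_pre]
  and spmap_symact = pre_spmap_symact[OF spmap_pre]
  and spmap_strmap = pre_spmap_strmap[OF spmap_pre]

lemma spmap_level: "is_spmap X Y f \<Longrightarrow> is_psset_map (level X m) (level Y m) (f m)"
  by (simp add: is_spmap_def)

lemma pre_spmapI:
  assumes "\<And>m k. f m k (spb X m k) = spb Y m k"
    and "\<And>m k x. x \<in> spx X m k \<Longrightarrow> f m k x \<in> spx Y m k"
    and "\<And>m k l \<phi> x. x \<in> spx X m k \<Longrightarrow> \<phi> \<in> simp_op l k \<Longrightarrow>
      f m l (operator (level X m) l k \<phi> x) = operator (level Y m) l k \<phi> (f m k x)"
    and "\<And>m k \<gamma> x. x \<in> spx X m k \<Longrightarrow> \<gamma> permutes {..<m} \<Longrightarrow>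
      f m k (symact X m \<gamma> k x) = symact Y m \<gamma> k (f m k x)"
    and "\<And>m k s x. x \<in> spx X m k \<Longrightarrow> s \<in> simplices circle k \<Longrightarrow>
      f (Suc m) k (strmap X m k s x) = strmap Y m k s (f m k x)"
  shows "pre_spmap X Y f"
  using assms unfolding pre_spmap_def spmap_at_def by blast

lemma basepoint_circle [simp]: "basepoint circle k = None"
  by (simp add: circle_def)

lemma circle_base_in [simp]: "None \<in> simplices circle k"
proof -
  have "(\<lambda>i\<in>{..k}. 0) \<in> simp_op k 1" by (auto simp: simp_op_def mono_on_def)
  moreover have "circle_elt k (\<lambda>i\<in>{..k}. 0) = None"
  proof -
    have "1 \<notin> (\<lambda>i\<in>{..k}. 0::nat) ` {..k}" "(1::nat) \<in> {..1}" by auto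
    then show ?thesis unfolding circle_elt_def by (intro if_not_P) blast
  qed
  ultimately show ?thesis unfolding circle_def by (simp add: image_iff) metis
qed

lemma operator_circle_elt:
  assumes "\<phi> \<in> simp_op l k" "t \<in> simp_op k 1"
  shows "operator circle l k \<phi> (circle_elt k t) = circle_elt l (compose {..l} t \<phi>)"
proof (cases "t ` {..k} = {..1}")
  case False
  have "compose {..l} t \<phi> ` {..l} \<subseteq> t ` {..k}"
    using simp_op_in[OF assms(1)] by (auto simp: compose_def)
  moreover have "t ` {..k} \<subseteq> {..1}"
    using simp_op_in[OF assms(2)] by auto
  ultimately have "compose {..l} t \<phi> ` {..l} \<noteq> {..1}"
    using False by blast
  then have "circle_elt k t = None" "circle_elt l (compose {..l} t \<phi>) = None"
    using False by (simp_all only: circle_elt_def if_False)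
  then show ?thesis by (simp add: circle_def)
next
  case True
  then have "circle_elt k t = Some t" unfolding circle_elt_def by (rule if_P)
  then show ?thesis by (simp add: circle_def)
qed

lemma is_psset_circle: "is_psset circle"
proof (rule is_pssetI)
  fix m n \<theta> x assume *: "\<theta> \<in> simp_op m n" "x \<in> simplices circle n"
  then obtain t where t: "t \<in> simp_op n 1" "x = circle_elt n t" by (auto simp: circle_def)
  then have "operator circle m n \<theta> x = circle_elt m (compose {..m} t \<theta>)"
    using operator_circle_elt[OF *(1) t(1)] by simp
  then show "operator circle m n \<theta> x \<in> simplices circle m"
    using simp_op_compose[OF *(1) t(1)] by (simp add: circle_def)
next
  fix n x assume "x \<in> simplices circle n"
  then obtain t where t: "t \<in> simp_op n 1" "x = circle_elt n t" by (auto simp: circle_def)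
  then show "operator circle n n (\<lambda>i\<in>{..n}. i) x = x"
    by (simp add: operator_circle_elt simp_op_id simp_op_id_right)
next
  fix l m n \<phi> \<theta> x assume *: "\<phi> \<in> simp_op l m" "\<theta> \<in> simp_op m n" "x \<in> simplices circle n"
  then obtain t where t: "t \<in> simp_op n 1" "x = circle_elt n t" by (auto simp: circle_def)
  then show "operator circle l n (compose {..l} \<theta> \<phi>) x = operator circle l m \<phi> (operator circle m n \<theta> x)"
    using * by (simp add: operator_circle_elt simp_op_compose simp_op_assoc[OF *(1,2)])
next
  show "operator circle m n \<theta> (basepoint circle n) = basepoint circle m" for m n \<theta>
    by (simp add: circle_def)
qed simp

lemma sph_iff:
  "z \<in> simplices (sph p) k \<longleftrightarrow> z = None \<or>
    (\<exists>ss. z = Some ss \<and> length ss = p \<and> set ss \<subseteq> simplices circle k \<and> None \<notin> set ss)"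
proof (cases z)
  case (Some ss)
  have "Some ss = (if None \<in> set xs then None else Some xs) \<longleftrightarrow> None \<notin> set xs \<and> xs = ss" for xs
    by auto
  then show ?thesis
    unfolding sph_def psmash_pow_def smash_pow_elt_def Some by (simp add: conj_commute) blast
qed (simp add: sph_def psmash_pow_def)

lemma sph_cases:
  assumes "z \<in> simplices (sph p) k"
  obtains "z = None"
    | ss where "z = Some ss" "length ss = p" "set ss \<subseteq> simplices circle k" "None \<notin> set ss"
  using assms unfolding sph_iff by blast

lemma block_sum_permutes:
  assumes "\<alpha> permutes {..<p}" "\<beta> permutes {..<m}"
  shows "block_sum p \<alpha> \<beta> permutes {..<p + m}"
proof -
  have a: "\<alpha> i < p \<longleftrightarrow> i < p" "inv \<alpha> i < p \<longleftrightarrow> i < p" for i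
    using permutes_in_image[OF assms(1)] permutes_in_image[OF permutes_inv[OF assms(1)]] by auto
  have "block_sum p \<alpha> \<beta> \<circ> block_sum p (inv \<alpha>) (inv \<beta>) = id"
    "block_sum p (inv \<alpha>) (inv \<beta>) \<circ> block_sum p \<alpha> \<beta> = id"
    using permutes_inverses[OF assms(1)] permutes_inverses[OF assms(2)]
    by (auto simp: block_sum_def fun_eq_iff a)
  then have "bij (block_sum p \<alpha> \<beta>)" by (rule o_bij[rotated])
  moreover have "block_sum p \<alpha> \<beta> i = i" if "i \<notin> {..<p + m}" for i
    using permutes_not_in[OF assms(2), of "i - p"] that by (auto simp: block_sum_def)
  ultimately show ?thesis by (simp add: permutes_def bij_iff)
qed

lemma strmap_list_in:
  assumes "is_symspec X" "set ss \<subseteq> simplices circle k" "x \<in> spx X m k"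
  shows "strmap_list X m k ss x \<in> spx X (length ss + m) k"
  using assms(2) by (induction ss) (use assms in \<open>auto simp: strmap_in\<close>)

lemma strmap_iter_in:
  assumes "is_symspec X" "z \<in> simplices (sph p) k" "x \<in> spx X m k"
  shows "strmap_iter X p m k z x \<in> spx X (p + m) k"
  using assms(2)
  by (cases rule: sph_cases)
    (use strmap_list_in[OF assms(1) _ assms(3)] in \<open>auto simp: strmap_iter_def symspec_base_in[OF assms(1)]\<close>)

lemma strmap_list_base:
  assumes "\<And>m s. s \<in> simplices circle k \<Longrightarrow> strmap X m k s (spb X m k) = spb X (Suc m) k"
    and "set ss \<subseteq> simplices circle k"
  shows "strmap_list X m k ss (spb X m k) = spb X (length ss + m) k"
  using assms(2) by (induction ss) (use assms(1) in auto)

lemma strmap_iter_base: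
  assumes "\<And>m s. s \<in> simplices circle k \<Longrightarrow> strmap X m k s (spb X m k) = spb X (Suc m) k"
    and "z \<in> simplices (sph p) k"
  shows "strmap_iter X p m k z (spb X m k) = spb X (p + m) k"
  using assms(2) by (cases rule: sph_cases) (auto simp: strmap_iter_def strmap_list_base[OF assms(1)])

lemma strmap_list_natural:
  assumes "is_symspec X"
    and "\<And>m s x. s \<in> simplices circle k \<Longrightarrow> x \<in> spx X m k \<Longrightarrow>
      u (Suc m) (strmap X m k s x) = strmap Y m l (c s) (u m x)"
    and "set ss \<subseteq> simplices circle k" "x \<in> spx X m k"
  shows "u (length ss + m) (strmap_list X m k ss x) = strmap_list Y m l (map c ss) (u m x)"
  using assms(3) by (induction ss) (use assms(1,2,4) in \<open>auto simp: strmap_list_in\<close>)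

text \<open>Maps of the pointed sets of \<open>k\<close>-simplices of symmetric spectra. A spectrum and the
  realization of a simplicial spectrum can only be compared in this sense.\<close>

definition slice_map :: "nat \<Rightarrow> 'a symspec \<Rightarrow> 'b symspec \<Rightarrow> (nat \<Rightarrow> 'a \<Rightarrow> 'b) \<Rightarrow> bool" where
  "slice_map k X Y u \<longleftrightarrow>
     (\<forall>m. u m (spb X m k) = spb Y m k) \<and>
     (\<forall>m. \<forall>x \<in> spx X m k. u m x \<in> spx Y m k) \<and>
     (\<forall>m \<gamma>. \<forall>x \<in> spx X m k. \<gamma> permutes {..<m} \<longrightarrow> u m (symact X m \<gamma> k x) = symact Y m \<gamma> k (u m x)) \<and>
     (\<forall>m. \<forall>x \<in> spx X m k. \<forall>s \<in> simplices circle k. u (Suc m) (strmap X m k s x) = strmap Y m k s (u m x))"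

lemma slice_map_iter:
  assumes X: "is_symspec X" and u: "slice_map k X Y u"
    and z: "z \<in> simplices (sph p) k" and x: "x \<in> spx X m k"
  shows "u (p + m) (strmap_iter X p m k z x) = strmap_iter Y p m k z (u m x)"
  using z
proof (cases rule: sph_cases)
  case 1 then show ?thesis using u by (simp add: strmap_iter_def slice_map_def)
next
  case (2 ss)
  then show ?thesis
    using strmap_list_natural[OF X, where u = u and c = "\<lambda>s. s" and Y = Y and l = k, OF _ 2(3) x] u
    by (auto simp: strmap_iter_def slice_map_def)
qed

lemma pre_spmap_iter:
  assumes "is_symspec X" and h: "pre_spmap X Y h" and "x \<in> spx X m k" and "z \<in> simplices (sph p) k"
  shows "h (p + m) k (strmap_iter X p m k z x) = strmap_iter Y p m k z (h m k x)"
proof (rule slice_map_iter[OF assms(1) _ assms(4,3)])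
  show "slice_map k X Y (\<lambda>m. h m k)"
    by (simp add: slice_map_def pre_spmap_base[OF h] pre_spmap_in[OF h] pre_spmap_symact[OF h] pre_spmap_strmap[OF h])
qed

lemma sph_act_in:
  assumes "\<alpha> permutes {..<p}" "z \<in> simplices (sph p) k"
  shows "sph_act \<alpha> z \<in> simplices (sph p) k"
  using assms(2)
proof (cases rule: sph_cases)
  case (2 ss)
  then have "set (permute_list (inv \<alpha>) ss) = set ss"
    using permutes_inv[OF assms(1)] by (intro set_permute_list) auto
  then show ?thesis using 2 by (auto simp: sph_iff sph_act_def)
qed (simp add: sph_act_def sph_iff)

lemma symspec_at_image:
  assumes X: "is_symspec X" and h: "pre_spmap X Q h" and x: "x \<in> spx X m k"
  shows "symspec_at Q m k (h m k x)"
  unfolding symspec_at_def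
proof (intro conjI allI ballI impI)
  note h' = pre_spmap_op[OF h, symmetric] pre_spmap_symact[OF h, symmetric]
    pre_spmap_strmap[OF h, symmetric]
  note X' = symact_in[OF X] strmap_in[OF X] symspec_op_in[OF X] x
  show "symact Q m id k (h m k x) = h m k x"
    by (simp only: h' X' permutes_id symact_id[OF X])
  show "strmap Q m k (basepoint circle k) (h m k x) = spb Q (Suc m) k"
    using strmap_circle_base[OF X x]
    by (simp only: h' X' basepoint_circle circle_base_in pre_spmap_base[OF h])
  fix \<gamma> \<delta> assume \<gamma>: "\<gamma> permutes {..<m}"
  show "symact Q m \<gamma> k (h m k x) \<in> spx Q m k"
    by (simp only: h' X' \<gamma> pre_spmap_in[OF h])
  show "symact Q m \<gamma> l (operator (level Q m) l k \<phi> (h m k x)) =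
      operator (level Q m) l k \<phi> (symact Q m \<gamma> k (h m k x))" if "\<phi> \<in> simp_op l k" for l \<phi>
    by (simp only: h' X' \<gamma> symact_op[OF X] that)
  assume \<delta>: "\<delta> permutes {..<m}"
  show "symact Q m (\<gamma> \<circ> \<delta>) k (h m k x) = symact Q m \<gamma> k (symact Q m \<delta> k (h m k x))"
    by (simp only: h' X' \<gamma> \<delta> permutes_compose symact_comp[OF X])
next
  note h' = pre_spmap_op[OF h, symmetric] pre_spmap_symact[OF h, symmetric]
    pre_spmap_strmap[OF h, symmetric]
  note X' = symact_in[OF X] strmap_in[OF X] symspec_op_in[OF X] x
  fix s assume s: "s \<in> simplices circle k"
  show "strmap Q m k s (h m k x) \<in> spx Q (Suc m) k"
    by (simp only: h' X' s pre_spmap_in[OF h])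
  show "operator (level Q (Suc m)) l k \<phi> (strmap Q m k s (h m k x)) =
    strmap Q m l (operator circle l k \<phi> s) (operator (level Q m) l k \<phi> (h m k x))"
    if "\<phi> \<in> simp_op l k" for l \<phi>
    by (simp only: h' X' s that strmap_op[OF X] psset_op_in[OF is_psset_circle])
next
  note h' = pre_spmap_symact[OF h, symmetric] pre_spmap_iter[OF X h, symmetric]
  fix p \<alpha> \<beta> z assume "z \<in> simplices (sph p) k" "\<alpha> permutes {..<p}" "\<beta> permutes {..<m}"
  then show "strmap_iter Q p m k (sph_act \<alpha> z) (symact Q m \<beta> k (h m k x)) =
      symact Q (p + m) (block_sum p \<alpha> \<beta>) k (strmap_iter Q p m k z (h m k x))"
    by (simp only: h' x symact_in[OF X] sph_act_in strmap_iter_in[OF X] block_sum_permutes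
      strmap_iter_equivariant[OF X])
qed

lemma is_symspec_codomain:
  assumes "\<And>m. is_psset (level Q m)" and X: "is_symspec X" and h: "pre_spmap X Q h"
    and "\<And>m k z. z \<in> spx Q m k \<Longrightarrow> symspec_at Q m k z"
  shows "is_symspec Q"
  unfolding is_symspec_iff
  using assms(1,4) pre_spmap_symact[OF h symspec_base_in[OF X]] pre_spmap_strmap[OF h symspec_base_in[OF X]]
  by (auto simp: pre_spmap_base[OF h] symact_base[OF X] strmap_base[OF X])

lemma spmap_at_image:
  assumes h: "pre_spmap X Q h" and v: "pre_spmap X Z v" and X: "is_symspec X" and x: "x \<in> spx X m k"
    and u: "\<And>m k x. x \<in> spx X m k \<Longrightarrow> u m k (h m k x) = v m k x"
  shows "spmap_at Q Z u m k (h m k x)"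
  unfolding spmap_at_def
proof (intro conjI allI ballI impI)
  note h' = pre_spmap_op[OF h, symmetric] pre_spmap_symact[OF h, symmetric]
    pre_spmap_strmap[OF h, symmetric] symact_in[OF X] strmap_in[OF X] symspec_op_in[OF X] u x
  show "u m k (h m k x) \<in> spx Z m k"
    by (simp only: h' pre_spmap_in[OF v])
  show "u m l (operator (level Q m) l k \<phi> (h m k x)) = operator (level Z m) l k \<phi> (u m k (h m k x))"
    if "\<phi> \<in> simp_op l k" for l \<phi>
    using that by (simp only: h' pre_spmap_op[OF v])
  show "u m k (symact Q m \<gamma> k (h m k x)) = symact Z m \<gamma> k (u m k (h m k x))"
    if "\<gamma> permutes {..<m}" for \<gamma>
    using that by (simp only: h' pre_spmap_symact[OF v])
  show "u (Suc m) k (strmap Q m k s (h m k x)) = strmap Z m k s (u m k (h m k x))"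
    if "s \<in> simplices circle k" for s
    using that by (simp only: h' pre_spmap_strmap[OF v])
qed

lemma symspec_at_base:
  assumes "\<And>m. is_psset (level X m)"
    and sym: "\<And>m k \<gamma>. \<gamma> permutes {..<m} \<Longrightarrow> symact X m \<gamma> k (spb X m k) = spb X m k"
    and str: "\<And>m k s. s \<in> simplices circle k \<Longrightarrow> strmap X m k s (spb X m k) = spb X (Suc m) k"
  shows "symspec_at X m k (spb X m k)"
  unfolding symspec_at_def
proof (intro conjI allI ballI impI)
  note base = sym str psset_base_in[OF assms(1)] psset_op_base[OF assms(1)]
  show "symact X m id k (spb X m k) = spb X m k"
    by (simp only: base permutes_id)
  show "strmap X m k (basepoint circle k) (spb X m k) = spb X (Suc m) k"
    by (simp only: base basepoint_circle circle_base_in)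
  fix \<gamma> \<delta> assume \<gamma>: "\<gamma> permutes {..<m}"
  show "symact X m \<gamma> k (spb X m k) \<in> spx X m k"
    by (simp only: base \<gamma>)
  show "symact X m \<gamma> l (operator (level X m) l k \<phi> (spb X m k)) =
      operator (level X m) l k \<phi> (symact X m \<gamma> k (spb X m k))" if "\<phi> \<in> simp_op l k" for l \<phi>
    by (simp only: base \<gamma> that)
  assume \<delta>: "\<delta> permutes {..<m}"
  show "symact X m (\<gamma> \<circ> \<delta>) k (spb X m k) = symact X m \<gamma> k (symact X m \<delta> k (spb X m k))"
    by (simp only: base \<gamma> \<delta> permutes_compose)
next
  note base = sym str psset_base_in[OF assms(1)] psset_op_base[OF assms(1)]
  fix s assume s: "s \<in> simplices circle k"
  show "strmap X m k s (spb X m k) \<in> spx X (Suc m) k"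
    by (simp only: base s)
  show "operator (level X (Suc m)) l k \<phi> (strmap X m k s (spb X m k)) =
    strmap X m l (operator circle l k \<phi> s) (operator (level X m) l k \<phi> (spb X m k))"
    if "\<phi> \<in> simp_op l k" for l \<phi>
    by (simp only: base s that psset_op_in[OF is_psset_circle])
next
  fix p \<alpha> \<beta> z assume "z \<in> simplices (sph p) k" "\<alpha> permutes {..<p}" "\<beta> permutes {..<m}"
  then show "strmap_iter X p m k (sph_act \<alpha> z) (symact X m \<beta> k (spb X m k)) =
      symact X (p + m) (block_sum p \<alpha> \<beta>) k (strmap_iter X p m k z (spb X m k))"
    by (simp only: sym strmap_iter_base[OF str] sph_act_in block_sum_permutes)
qed

lemma spmap_at_base:
  assumes X: "is_symspec X" and Y: "is_symspec Y" and f: "\<And>m k. f m k (spb X m k) = spb Y m k"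
  shows "spmap_at X Y f m k (spb X m k)"
  unfolding spmap_at_def
  by (auto simp: f symact_base[OF X] strmap_base[OF X] symspec_op_base[OF X] symspec_base_in[OF Y]
    symact_base[OF Y] strmap_base[OF Y] symspec_op_base[OF Y])

section \<open>Colimits and tensors of symmetric spectra\<close>

lemma pcoprod_map_None [simp]: "pcoprod_map B u h k None = None"
  by (simp add: pcoprod_map_def)

lemma pcoprod_map_cin:
  assumes "h i k (basepoint (A i) l) = basepoint (B (u i)) k"
  shows "pcoprod_map B u h k (cin A l i x) = cin B k (u i) (h i k x)"
  using assms by (simp add: pcoprod_map_def cin_def)

lemma simplices_pcoprod:
  "simplices (pcoprod I A) k = insert None {cin A k i x | i x. i \<in> I \<and> x \<in> simplices (A i) k}"
  by (simp add: pcoprod_def)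

lemma pcoprod_cases:
  assumes "z \<in> simplices (pcoprod I A) k"
  obtains "z = None" | i x where "i \<in> I" "x \<in> simplices (A i) k" "z = cin A k i x"
  using assms unfolding simplices_pcoprod by blast

lemma cin_in: "i \<in> I \<Longrightarrow> x \<in> simplices (A i) k \<Longrightarrow> cin A k i x \<in> simplices (pcoprod I A) k"
  unfolding simplices_pcoprod by blast

lemma cin_base [simp]: "cin A k i (basepoint (A i) k) = None"
  by (simp add: cin_def)

lemma basepoint_pcoprod [simp]: "basepoint (pcoprod I A) k = None"
  by (simp add: pcoprod_def)

lemma operator_pcoprod_None [simp]: "operator (pcoprod I A) m n \<theta> None = None"
  by (simp add: pcoprod_def)

lemma operator_pcoprod_cin:
  assumes "is_psset (A i)" "\<theta> \<in> simp_op m n"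
  shows "operator (pcoprod I A) m n \<theta> (cin A n i x) = cin A m i (operator (A i) m n \<theta> x)"
  using psset_op_base[OF assms]
  by (simp add: pcoprod_def pcoprod_map_cin[where h = "\<lambda>i k. operator (A i) m n \<theta>" and u = "\<lambda>i. i"])

lemma is_psset_pcoprod:
  assumes A: "\<And>i. i \<in> I \<Longrightarrow> is_psset (A i)"
  shows "is_psset (pcoprod I A)"
proof (rule is_pssetI)
  fix m n \<theta> z assume "\<theta> \<in> simp_op m n" "z \<in> simplices (pcoprod I A) n"
  then show "operator (pcoprod I A) m n \<theta> z \<in> simplices (pcoprod I A) m"
    by (elim pcoprod_cases)
      (simp add: simplices_pcoprod, simp add: operator_pcoprod_cin A cin_in psset_op_in)
next
  fix n z assume "z \<in> simplices (pcoprod I A) n"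
  then show "operator (pcoprod I A) n n (\<lambda>i\<in>{..n}. i) z = z"
    by (elim pcoprod_cases) (auto simp: operator_pcoprod_cin A simp_op_id psset_op_id)
next
  fix l m n \<phi> \<theta> z
  assume *: "\<phi> \<in> simp_op l m" "\<theta> \<in> simp_op m n" "z \<in> simplices (pcoprod I A) n"
  show "operator (pcoprod I A) l n (compose {..l} \<theta> \<phi>) z =
    operator (pcoprod I A) l m \<phi> (operator (pcoprod I A) m n \<theta> z)"
    using *(3) by (cases rule: pcoprod_cases)
     (auto simp: operator_pcoprod_cin A simp_op_compose[OF *(1,2)] psset_op_comp[OF _ *(1,2)] *(1,2))
qed (auto simp: simplices_pcoprod)

definition sp_in :: "('i \<Rightarrow> 'a symspec) \<Rightarrow> 'i \<Rightarrow> ('a, ('i \<times> 'a) option) spmap" where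
  "sp_in X i m k = cin (\<lambda>i. level (X i) m) k i"

lemma level_sp_coprod: "level (sp_coprod I X) m = pcoprod I (\<lambda>i. level (X i) m)"
  by (simp add: sp_coprod_def)

lemma sp_coprod_cases:
  assumes "z \<in> spx (sp_coprod I X) m k"
  obtains "z = None" | i x where "i \<in> I" "x \<in> spx (X i) m k" "z = sp_in X i m k x"
  using assms pcoprod_cases unfolding level_sp_coprod sp_in_def by metis

lemma basepoint_sp_coprod [simp]: "spb (sp_coprod I X) m k = None"
  by (simp add: level_sp_coprod)

lemma sp_coprod_None [simp]:
  "symact (sp_coprod I X) m \<gamma> k None = None" "strmap (sp_coprod I X) m k s None = None"
  by (simp_all add: sp_coprod_def)

lemma pre_spmap_sp_in:
  assumes X: "is_symspec (X i)" and i: "i \<in> I"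
  shows "pre_spmap (X i) (sp_coprod I X) (sp_in X i)"
proof (rule pre_spmapI)
  fix m k x assume x: "x \<in> spx (X i) m k"
  show "sp_in X i m k x \<in> spx (sp_coprod I X) m k"
    using i x by (simp add: level_sp_coprod sp_in_def cin_in)
  show "sp_in X i m l (operator (level (X i) m) l k \<phi> x) =
      operator (level (sp_coprod I X) m) l k \<phi> (sp_in X i m k x)" if "\<phi> \<in> simp_op l k" for l \<phi>
    using that by (simp add: level_sp_coprod sp_in_def operator_pcoprod_cin symspec_psset[OF X])
  show "sp_in X i m k (symact (X i) m \<gamma> k x) = symact (sp_coprod I X) m \<gamma> k (sp_in X i m k x)"
    if "\<gamma> permutes {..<m}" for \<gamma>
    using symact_base[OF X that]
    by (simp add: sp_coprod_def sp_in_def pcoprod_map_cin[where u = "\<lambda>i. i" and A = "\<lambda>i. level (X i) m"])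
  show "sp_in X i (Suc m) k (strmap (X i) m k s x) = strmap (sp_coprod I X) m k s (sp_in X i m k x)"
    if "s \<in> simplices circle k" for s
    using strmap_base[OF X that]
    by (simp add: sp_coprod_def sp_in_def pcoprod_map_cin[where u = "\<lambda>i. i" and A = "\<lambda>i. level (X i) m"])
qed (simp add: sp_in_def cin_def)

lemma is_symspec_sp_coprod:
  assumes X: "\<And>i. i \<in> I \<Longrightarrow> is_symspec (X i)"
  shows "is_symspec (sp_coprod I X)"
  unfolding is_symspec_iff
proof (intro conjI allI ballI impI)
  show pss: "is_psset (level (sp_coprod I X) m)" for m
    by (simp add: level_sp_coprod is_psset_pcoprod symspec_psset X)
  fix m k z assume "z \<in> spx (sp_coprod I X) m k"
  then show "symspec_at (sp_coprod I X) m k z"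
  proof (cases rule: sp_coprod_cases)
    case 1
    then show ?thesis
      using symspec_at_base[of "sp_coprod I X", OF pss] by simp
  next
    case (2 i x)
    then show ?thesis
      using symspec_at_image[OF X[OF \<open>i \<in> I\<close>] pre_spmap_sp_in[of X i I], of x m k] X[of i] by simp
  qed
qed auto

lemma is_spmap_sp_coprod:
  assumes X: "\<And>i. i \<in> I \<Longrightarrow> is_symspec (X i)" and Z: "is_symspec Z"
    and None: "\<And>m k. f m k None = spb Z m k"
    and f: "\<And>i m k x. i \<in> I \<Longrightarrow> x \<in> spx (X i) m k \<Longrightarrow> f m k (sp_in X i m k x) = g i m k x"
    and g: "\<And>i. i \<in> I \<Longrightarrow> is_spmap (X i) Z (g i)"
  shows "is_spmap (sp_coprod I X) Z f"
  unfolding is_spmap_iff pre_spmap_def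
proof (intro conjI allI ballI)
  show C: "is_symspec (sp_coprod I X)" by (rule is_symspec_sp_coprod[OF X])
  fix m k z assume "z \<in> spx (sp_coprod I X) m k"
  then show "spmap_at (sp_coprod I X) Z f m k z"
  proof (cases rule: sp_coprod_cases)
    case 1
    then show ?thesis
      using spmap_at_base[OF C Z, of f] None by simp
  next
    case (2 i x)
    then show ?thesis
      using spmap_at_image[OF pre_spmap_sp_in[of X i I] spmap_pre[OF g[of i]], of x m k f] X[of i] f[of i] by simp
  qed
qed (simp_all add: Z None)

lemma sp_coprod_map_None [simp]: "sp_coprod_map Y u h m k None = None"
  by (simp add: sp_coprod_map_def)

lemma sp_coprod_map_sp_in:
  assumes "is_spmap (X i) (Y (u i)) (h i)"
  shows "sp_coprod_map Y u h m k (sp_in X i m k x) = sp_in Y (u i) m k (h i m k x)"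
  using spmap_base[OF assms]
  by (simp add: sp_coprod_map_def sp_in_def pcoprod_map_cin[where A = "\<lambda>i. level (X i) m" and h = "\<lambda>i. h i m"])

lemma is_spmap_sp_in:
  assumes X: "\<And>i. i \<in> I \<Longrightarrow> is_symspec (X i)" and "i \<in> I"
  shows "is_spmap (X i) (sp_coprod I X) (sp_in X i)"
  using assms by (simp add: is_spmap_iff is_symspec_sp_coprod pre_spmap_sp_in)

lemma is_spmap_id: "is_symspec X \<Longrightarrow> is_spmap X X (\<lambda>_ _ x. x)"
  by (simp add: is_spmap_iff pre_spmap_def spmap_at_def)

lemma is_spmap_comp:
  assumes f: "is_spmap X Y f" and g: "is_spmap Y Z g"
  shows "is_spmap X Z (\<lambda>m k x. g m k (f m k x))"
  unfolding is_spmap_iff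
  by (intro conjI spmap_dom[OF f] spmap_cod[OF g] pre_spmapI)
    (simp_all add: spmap_base[OF f] spmap_base[OF g] spmap_in[OF f] spmap_in[OF g] spmap_op[OF f]
      spmap_op[OF g] spmap_symact[OF f] spmap_symact[OF g] spmap_strmap[OF f] spmap_strmap[OF g])

lemma is_spmap_sp_coprod_map:
  assumes h: "\<And>i. i \<in> I \<Longrightarrow> is_spmap (X i) (Y (u i)) (h i)" and u: "\<And>i. i \<in> I \<Longrightarrow> u i \<in> J"
    and Y: "\<And>j. j \<in> J \<Longrightarrow> is_symspec (Y j)"
  shows "is_spmap (sp_coprod I X) (sp_coprod J Y) (sp_coprod_map Y u h)"
proof (rule is_spmap_sp_coprod)
  fix i assume i: "i \<in> I"
  show "is_spmap (X i) (sp_coprod J Y) (\<lambda>m k x. sp_in Y (u i) m k (h i m k x))"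
    using is_spmap_comp[OF h[OF i] is_spmap_sp_in[of J Y "u i"]] Y u[OF i] by simp
  show "sp_coprod_map Y u h m k (sp_in X i m k x) = sp_in Y (u i) m k (h i m k x)" for m k x
    by (rule sp_coprod_map_sp_in[of X i Y u h, OF h[OF i]])
qed (simp_all add: is_symspec_sp_coprod Y spmap_dom[OF h])

lemma sp_coprod_desc_None [simp]: "sp_coprod_desc Z h m k None = spb Z m k"
  by (simp add: sp_coprod_desc_def)

lemma sp_coprod_desc_sp_in:
  assumes "is_spmap (X i) Z (h i)"
  shows "sp_coprod_desc Z h m k (sp_in X i m k x) = h i m k x"
  using spmap_base[OF assms] by (simp add: sp_coprod_desc_def sp_in_def cin_def)

lemma is_spmap_sp_coprod_desc:
  assumes h: "\<And>i. i \<in> I \<Longrightarrow> is_spmap (X i) Z (h i)" and Z: "is_symspec Z"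
  shows "is_spmap (sp_coprod I X) Z (sp_coprod_desc Z h)"
  by (rule is_spmap_sp_coprod[where g = h])
    (auto simp: Z h spmap_dom[OF h] intro: sp_coprod_desc_sp_in h)

lemma psmash_map_None [simp]: "psmash_map C D f g k None = None"
  by (simp add: psmash_map_def)

lemma psmash_map_smash_elt:
  assumes "f k (basepoint A l) = basepoint C k" "g k (basepoint B l) = basepoint D k"
  shows "psmash_map C D f g k (smash_elt A B l x y) = smash_elt C D k (f k x) (g k y)"
  using assms by (auto simp: psmash_map_def smash_elt_def)

lemma basepoint_psmash [simp]: "basepoint (psmash A B) k = None"
  by (simp add: psmash_def)

lemma smash_elt_base [simp]:
  "smash_elt A B k (basepoint A k) y = None" "smash_elt A B k x (basepoint B k) = None"
  by (simp_all add: smash_elt_def)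

lemma simplices_psmash:
  assumes "is_psset A" "is_psset B"
  shows "simplices (psmash A B) k = {smash_elt A B k x y | x y. x \<in> simplices A k \<and> y \<in> simplices B k}"
proof -
  have "None = smash_elt A B k (basepoint A k) (basepoint B k)" by simp
  then have "None \<in> {smash_elt A B k x y | x y. x \<in> simplices A k \<and> y \<in> simplices B k}"
    using psset_base_in[OF assms(1)] psset_base_in[OF assms(2)] by blast
  then show ?thesis by (simp add: psmash_def insert_absorb)
qed

lemma operator_psmash:
  assumes "is_psset A" "is_psset B" "\<theta> \<in> simp_op m n"
  shows "operator (psmash A B) m n \<theta> (smash_elt A B n x y) =
    smash_elt A B m (operator A m n \<theta> x) (operator B m n \<theta> y)"
  using psset_op_base[OF assms(1,3)] psset_op_base[OF assms(2,3)]
  by (simp add: psmash_def psmash_map_smash_elt[where A = A and B = B])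

lemma is_psset_psmash:
  assumes A: "is_psset A" and B: "is_psset B"
  shows "is_psset (psmash A B)"
proof (rule is_pssetI)
  fix m n \<theta> z assume "\<theta> \<in> simp_op m n" "z \<in> simplices (psmash A B) n"
  then show "operator (psmash A B) m n \<theta> z \<in> simplices (psmash A B) m"
    using psset_op_in[OF A] psset_op_in[OF B]
    by (auto simp: simplices_psmash[OF A B] operator_psmash[OF A B]) blast
next
  fix n z assume "z \<in> simplices (psmash A B) n"
  then show "operator (psmash A B) n n (\<lambda>i\<in>{..n}. i) z = z"
    by (auto simp: simplices_psmash[OF A B] operator_psmash[OF A B] simp_op_id psset_op_id[OF A]
        psset_op_id[OF B])
next
  fix l m n \<phi> \<theta> z
  assume *: "\<phi> \<in> simp_op l m" "\<theta> \<in> simp_op m n" "z \<in> simplices (psmash A B) n"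
  then show "operator (psmash A B) l n (compose {..l} \<theta> \<phi>) z =
    operator (psmash A B) l m \<phi> (operator (psmash A B) m n \<theta> z)"
    by (auto simp: simplices_psmash[OF A B] operator_psmash[OF A B] simp_op_compose[OF *(1,2)]
        psset_op_comp[OF A *(1,2)] psset_op_comp[OF B *(1,2)])
qed (simp_all add: psmash_def)

definition tens :: "'a symspec \<Rightarrow> 'b psset \<Rightarrow> nat \<Rightarrow> nat \<Rightarrow> 'a \<Rightarrow> 'b \<Rightarrow> ('a \<times> 'b) option" where
  "tens X K m k = smash_elt (level X m) K k"

lemma tens_base [simp]:
  "tens X K m k (spb X m k) y = None" "tens X K m k x (basepoint K k) = None"
  by (simp_all add: tens_def)

lemma basepoint_sp_tensor [simp]: "spb (sp_tensor X K) m k = None"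
  by (simp add: sp_tensor_def)

lemma sp_tensor_None [simp]:
  "symact (sp_tensor X K) m \<gamma> k None = None" "strmap (sp_tensor X K) m k s None = None"
  by (simp_all add: sp_tensor_def)

context
  fixes X :: "'a symspec" and K :: "'b psset"
  assumes X: "is_symspec X" and K: "is_psset K"
begin

lemma simplices_sp_tensor:
  "spx (sp_tensor X K) m k = {tens X K m k x y | x y. x \<in> spx X m k \<and> y \<in> simplices K k}"
  by (simp add: sp_tensor_def simplices_psmash[OF symspec_psset[OF X] K] tens_def)

lemma tens_in: "x \<in> spx X m k \<Longrightarrow> y \<in> simplices K k \<Longrightarrow> tens X K m k x y \<in> spx (sp_tensor X K) m k"
  unfolding simplices_sp_tensor by blast

lemma operator_sp_tensor:
  "\<phi> \<in> simp_op l k \<Longrightarrow> operator (level (sp_tensor X K) m) l k \<phi> (tens X K m k x y) =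
    tens X K m l (operator (level X m) l k \<phi> x) (operator K l k \<phi> y)"
  by (simp add: sp_tensor_def operator_psmash[OF symspec_psset[OF X] K] tens_def)

lemma symact_sp_tensor:
  "\<gamma> permutes {..<m} \<Longrightarrow>
    symact (sp_tensor X K) m \<gamma> k (tens X K m k x y) = tens X K m k (symact X m \<gamma> k x) y"
  using symact_base[OF X, of \<gamma> m k]
  by (simp add: sp_tensor_def tens_def psmash_map_smash_elt[where A = "level X m" and B = K])

lemma strmap_sp_tensor:
  "s \<in> simplices circle k \<Longrightarrow>
    strmap (sp_tensor X K) m k s (tens X K m k x y) = tens X K (Suc m) k (strmap X m k s x) y"
  using strmap_base[OF X, of s k m]
  by (simp add: sp_tensor_def tens_def psmash_map_smash_elt[where A = "level X m" and B = K])

lemma strmap_list_sp_tensor: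
  "set ss \<subseteq> simplices circle k \<Longrightarrow>
    strmap_list (sp_tensor X K) m k ss (tens X K m k x y) = tens X K (length ss + m) k (strmap_list X m k ss x) y"
  by (induction ss) (simp_all add: strmap_sp_tensor)

lemma strmap_iter_sp_tensor:
  "z \<in> simplices (sph p) k \<Longrightarrow>
    strmap_iter (sp_tensor X K) p m k z (tens X K m k x y) = tens X K (p + m) k (strmap_iter X p m k z x) y"
  by (elim sph_cases) (auto simp: strmap_iter_def strmap_list_sp_tensor)

lemma is_symspec_sp_tensor: "is_symspec (sp_tensor X K)"
  unfolding is_symspec_iff
proof (intro conjI allI ballI impI)
  show "is_psset (level (sp_tensor X K) m)" for m
    by (simp add: sp_tensor_def is_psset_psmash symspec_psset[OF X] K)
  fix m k z assume "z \<in> spx (sp_tensor X K) m k"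
  then obtain x y where xy: "x \<in> spx X m k" "y \<in> simplices K k" and z: "z = tens X K m k x y"
    unfolding simplices_sp_tensor by blast
  note s = operator_sp_tensor symact_sp_tensor strmap_sp_tensor strmap_iter_sp_tensor
    symact_in[OF X] strmap_in[OF X] tens_in xy
  show "symspec_at (sp_tensor X K) m k z"
    unfolding symspec_at_def z
  proof (intro conjI allI ballI impI)
    show "symact (sp_tensor X K) m id k (tens X K m k x y) = tens X K m k x y"
      by (simp only: s permutes_id symact_id[OF X])
    show "strmap (sp_tensor X K) m k (basepoint circle k) (tens X K m k x y) = spb (sp_tensor X K) (Suc m) k"
      using strmap_circle_base[OF X xy(1)] by (simp add: s)
    fix \<gamma> \<delta> assume \<gamma>: "\<gamma> permutes {..<m}"
    show "symact (sp_tensor X K) m \<gamma> k (tens X K m k x y) \<in> spx (sp_tensor X K) m k"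
      by (simp only: s \<gamma>)
    show "symact (sp_tensor X K) m \<gamma> l (operator (level (sp_tensor X K) m) l k \<phi> (tens X K m k x y)) =
        operator (level (sp_tensor X K) m) l k \<phi> (symact (sp_tensor X K) m \<gamma> k (tens X K m k x y))"
      if "\<phi> \<in> simp_op l k" for l \<phi>
      using \<gamma> that by (simp only: s symact_op[OF X])
    assume \<delta>: "\<delta> permutes {..<m}"
    show "symact (sp_tensor X K) m (\<gamma> \<circ> \<delta>) k (tens X K m k x y) =
        symact (sp_tensor X K) m \<gamma> k (symact (sp_tensor X K) m \<delta> k (tens X K m k x y))"
      by (simp only: s \<gamma> \<delta> permutes_compose symact_comp[OF X])
  next
    fix c assume c: "c \<in> simplices circle k"
    show "strmap (sp_tensor X K) m k c (tens X K m k x y) \<in> spx (sp_tensor X K) (Suc m) k"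
      by (simp only: s c)
    show "operator (level (sp_tensor X K) (Suc m)) l k \<phi> (strmap (sp_tensor X K) m k c (tens X K m k x y)) =
      strmap (sp_tensor X K) m l (operator circle l k \<phi> c)
        (operator (level (sp_tensor X K) m) l k \<phi> (tens X K m k x y))"
      if "\<phi> \<in> simp_op l k" for l \<phi>
      using c that by (simp only: s psset_op_in[OF is_psset_circle] strmap_op[OF X])
  next
    fix p \<alpha> \<beta> c assume "c \<in> simplices (sph p) k" "\<alpha> permutes {..<p}" "\<beta> permutes {..<m}"
    then show "strmap_iter (sp_tensor X K) p m k (sph_act \<alpha> c) (symact (sp_tensor X K) m \<beta> k (tens X K m k x y)) =
        symact (sp_tensor X K) (p + m) (block_sum p \<alpha> \<beta>) k
          (strmap_iter (sp_tensor X K) p m k c (tens X K m k x y))"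
      by (simp only: s sph_act_in block_sum_permutes strmap_iter_equivariant[OF X])
  qed
qed simp_all

end

lemma sp_tensor_map_tens:
  assumes "is_spmap X Y f" "is_psset_map K L g"
  shows "sp_tensor_map Y L f g m k (tens X K m k x y) = tens Y L m k (f m k x) (g k y)"
  using spmap_base[OF assms(1)] psset_map_base[OF assms(2)]
  by (simp add: sp_tensor_map_def tens_def psmash_map_smash_elt[where A = "level X m" and B = K])

lemma is_spmap_sp_tensor_map:
  assumes f: "is_spmap X Y f" and g: "is_psset_map K L g"
  shows "is_spmap (sp_tensor X K) (sp_tensor Y L) (sp_tensor_map Y L f g)"
proof -
  have X: "is_symspec X" and Y: "is_symspec Y" by (simp_all add: spmap_dom[OF f] spmap_cod[OF f])
  have K: "is_psset K" and L: "is_psset L" using g by (simp_all add: is_psset_map_def)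
  show ?thesis
    unfolding is_spmap_iff
  proof (intro conjI is_symspec_sp_tensor X Y K L pre_spmapI)
    show "sp_tensor_map Y L f g m k (spb (sp_tensor X K) m k) = spb (sp_tensor Y L) m k" for m k
      by (simp add: sp_tensor_map_def)
    fix m k z assume "z \<in> spx (sp_tensor X K) m k"
    then obtain x y where xy: "x \<in> spx X m k" "y \<in> simplices K k" and z: "z = tens X K m k x y"
      unfolding simplices_sp_tensor[OF X K] by blast
    note s = sp_tensor_map_tens[OF f g] spmap_in[OF f] psset_map_in[OF g] xy tens_in[OF Y L]
      operator_sp_tensor[OF X K] operator_sp_tensor[OF Y L] symact_sp_tensor[OF X K] symact_sp_tensor[OF Y L]
      strmap_sp_tensor[OF X K] strmap_sp_tensor[OF Y L]
    show "sp_tensor_map Y L f g m k z \<in> spx (sp_tensor Y L) m k"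
      by (simp only: z s)
    show "sp_tensor_map Y L f g m l (operator (level (sp_tensor X K) m) l k \<phi> z) =
      operator (level (sp_tensor Y L) m) l k \<phi> (sp_tensor_map Y L f g m k z)" if "\<phi> \<in> simp_op l k" for l \<phi>
      using that by (simp only: z s spmap_op[OF f] psset_map_op[OF g])
    show "sp_tensor_map Y L f g m k (symact (sp_tensor X K) m \<gamma> k z) =
      symact (sp_tensor Y L) m \<gamma> k (sp_tensor_map Y L f g m k z)" if "\<gamma> permutes {..<m}" for \<gamma>
      using that by (simp only: z s spmap_symact[OF f])
    show "sp_tensor_map Y L f g (Suc m) k (strmap (sp_tensor X K) m k c z) =
      strmap (sp_tensor Y L) m k c (sp_tensor_map Y L f g m k z)" if "c \<in> simplices circle k" for c
      using that by (simp only: z s spmap_strmap[OF f])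
  qed
qed

definition sp_proj :: "'a symspec \<Rightarrow> ('a, 'b) spmap \<Rightarrow> ('a, 'b) spmap \<Rightarrow> ('b, 'b set) spmap" where
  "sp_proj A f g m k = qclass (coeq_rel (level A m) (f m) (g m) k)"

lemma level_sp_coeq: "level (sp_coeq A B f g) m = pquot (level B m) (coeq_rel (level A m) (f m) (g m))"
  by (simp add: sp_coeq_def)

lemma simplices_sp_coeq: "spx (sp_coeq A B f g) m k = sp_proj A f g m k ` spx B m k"
  by (simp add: level_sp_coeq sp_proj_def)

lemma sp_proj_eq: "a \<in> spx A m k \<Longrightarrow> sp_proj A f g m k (f m k a) = sp_proj A f g m k (g m k a)"
  unfolding sp_proj_def qclass_eq_iff coeq_rel_def by (blast intro: r_into_equivclp)

context
  fixes A :: "'a symspec" and B :: "'b symspec" and f g :: "('a, 'b) spmap"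
  assumes f: "is_spmap A B f" and g: "is_spmap A B g"
begin

lemma coeq_op_compat: "op_compat (level B m) (coeq_rel (level A m) (f m) (g m))"
  unfolding op_compat_def
proof (intro allI ballI impI)
  fix l k a b \<theta> assume \<theta>: "\<theta> \<in> simp_op l k" and "coeq_rel (level A m) (f m) (g m) k a b"
  then show "equivclp (coeq_rel (level A m) (f m) (g m) l) (operator (level B m) l k \<theta> a) (operator (level B m) l k \<theta> b)"
    by (intro r_into_equivclp, elim coeq_rel_map[where h = "operator (level A m) l k \<theta>"])
      (simp_all add: symspec_op_in[OF spmap_dom[OF f]] spmap_op[OF f] spmap_op[OF g])
qed

lemma pre_spmap_sp_proj: "pre_spmap B (sp_coeq A B f g) (sp_proj A f g)"
proof (rule pre_spmapI)
  fix m k x assume x: "x \<in> spx B m k"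
  show "sp_proj A f g m k x \<in> spx (sp_coeq A B f g) m k"
    using x by (simp add: simplices_sp_coeq)
  show "sp_proj A f g m l (operator (level B m) l k \<phi> x) =
      operator (level (sp_coeq A B f g) m) l k \<phi> (sp_proj A f g m k x)" if "\<phi> \<in> simp_op l k" for l \<phi>
    using that by (simp add: level_sp_coeq sp_proj_def operator_pquot'[OF coeq_op_compat])
  show "sp_proj A f g m k (symact B m \<gamma> k x) = symact (sp_coeq A B f g) m \<gamma> k (sp_proj A f g m k x)"
    if \<gamma>: "\<gamma> permutes {..<m}" for \<gamma>
    unfolding sp_coeq_def sp_proj_def Let_def symspec.simps
    by (rule pquot_map_qclass[symmetric], rule r_into_equivclp,
        erule coeq_rel_map[where h = "symact A m \<gamma> k"])
      (simp_all add: \<gamma> symact_in[OF spmap_dom[OF f]] spmap_symact[OF f] spmap_symact[OF g])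
  show "sp_proj A f g (Suc m) k (strmap B m k s x) = strmap (sp_coeq A B f g) m k s (sp_proj A f g m k x)"
    if s: "s \<in> simplices circle k" for s
    unfolding sp_coeq_def sp_proj_def Let_def symspec.simps
    by (rule pquot_map_qclass[symmetric], rule r_into_equivclp,
        erule coeq_rel_map[where h = "strmap A m k s"])
      (simp_all add: s strmap_in[OF spmap_dom[OF f]] spmap_strmap[OF f] spmap_strmap[OF g])
qed (simp add: level_sp_coeq sp_proj_def)

lemma is_symspec_sp_coeq: "is_symspec (sp_coeq A B f g)"
proof (rule is_symspec_codomain[OF _ spmap_cod[OF f] pre_spmap_sp_proj])
  show "is_psset (level (sp_coeq A B f g) m)" for m
    unfolding level_sp_coeq by (rule is_psset_pquot[OF symspec_psset[OF spmap_cod[OF f]] coeq_op_compat])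
  show "symspec_at (sp_coeq A B f g) m k z" if "z \<in> spx (sp_coeq A B f g) m k" for m k z
    using that symspec_at_image[OF spmap_cod[OF f] pre_spmap_sp_proj] by (auto simp: simplices_sp_coeq)
qed

lemma is_spmap_sp_proj: "is_spmap B (sp_coeq A B f g) (sp_proj A f g)"
  by (simp add: is_spmap_iff is_symspec_sp_coeq pre_spmap_sp_proj spmap_cod[OF f])

lemma is_spmap_sp_coeq:
  assumes u: "\<And>m k x. x \<in> spx B m k \<Longrightarrow> u m k (sp_proj A f g m k x) = v m k x" and v: "is_spmap B Z v"
  shows "is_spmap (sp_coeq A B f g) Z u"
  unfolding is_spmap_iff pre_spmap_def
proof (intro conjI allI ballI is_symspec_sp_coeq spmap_cod[OF v])
  show "u m k (spb (sp_coeq A B f g) m k) = spb Z m k" for m k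
    using u[OF symspec_base_in[OF spmap_cod[OF f]], of m k]
    by (simp add: spmap_base[OF v] spmap_base[OF is_spmap_sp_proj])
  show "spmap_at (sp_coeq A B f g) Z u m k z" if "z \<in> spx (sp_coeq A B f g) m k" for m k z
    using that spmap_at_image[OF pre_spmap_sp_proj spmap_pre[OF v] spmap_dom[OF v] _ u]
    by (auto simp: simplices_sp_coeq)
qed

end

lemma sp_coeq_desc_proj:
  assumes "\<And>a. a \<in> spx A m k \<Longrightarrow> h m k (f m k a) = h m k (g m k a)"
  shows "sp_coeq_desc h m k (sp_proj A f g m k x) = h m k x"
  unfolding sp_coeq_desc_def sp_proj_def
  by (rule qlift_qclass) (use assms in \<open>auto simp: coeq_rel_def\<close>)

lemma sp_coeq_map_proj:
  assumes "\<And>a. a \<in> spx A m k \<Longrightarrow> sp_proj A' f' g' m k (h m k (f m k a)) = sp_proj A' f' g' m k (h m k (g m k a))"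
  shows "sp_coeq_map A' f' g' h m k (sp_proj A f g m k x) = sp_proj A' f' g' m k (h m k x)"
  unfolding sp_coeq_map_def sp_proj_def
  by (rule pquot_map_qclass) (use assms in \<open>auto simp: coeq_rel_def sp_proj_def qclass_eq_iff\<close>)

definition po_l :: "'a psset \<Rightarrow> (nat \<Rightarrow> 'a \<Rightarrow> 'b) \<Rightarrow> (nat \<Rightarrow> 'a \<Rightarrow> 'c) \<Rightarrow> nat \<Rightarrow> 'b \<Rightarrow> ('b + 'c) set" where
  "po_l A f g k b = qclass (pushout_rel A f g k) (Inl b)"

definition po_r :: "'a psset \<Rightarrow> (nat \<Rightarrow> 'a \<Rightarrow> 'b) \<Rightarrow> (nat \<Rightarrow> 'a \<Rightarrow> 'c) \<Rightarrow> nat \<Rightarrow> 'c \<Rightarrow> ('b + 'c) set" where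
  "po_r A f g k c = qclass (pushout_rel A f g k) (Inr c)"

lemma pushout_rel_iff: "pushout_rel A f g k y y' \<longleftrightarrow> (\<exists>a\<in>simplices A k. y = Inl (f k a) \<and> y' = Inr (g k a))"
  by (simp add: pushout_rel_def coeq_rel_def)

lemma po_eq: "a \<in> simplices A k \<Longrightarrow> po_l A f g k (f k a) = po_r A f g k (g k a)"
  unfolding po_l_def po_r_def qclass_eq_iff pushout_rel_iff by (blast intro: r_into_equivclp)

lemma simplices_ppushout:
  "simplices (ppushout A B C f g) k = po_l A f g k ` simplices B k \<union> po_r A f g k ` simplices C k"
  by (auto simp: ppushout_def psum_def po_l_def po_r_def image_iff Plus_def)

lemma ppushout_cases:
  assumes "z \<in> simplices (ppushout A B C f g) k"
  obtains b where "b \<in> simplices B k" "z = po_l A f g k b"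
    | c where "c \<in> simplices C k" "z = po_r A f g k c"
  using assms unfolding simplices_ppushout by blast

lemma po_l_inj:
  assumes "inj_on (g k) (simplices A k)" "po_l A f g k b = po_l A f g k b'"
  shows "b = b'"
proof -
  have "equivclp (pushout_rel A f g k) (Inl b) (Inl b')"
    using assms(2) by (simp add: po_l_def qclass_eq_iff)
  then have "case_sum (\<lambda>y. y = b) (\<lambda>c. \<exists>a\<in>simplices A k. c = g k a \<and> f k a = b) (Inl b')"
    by (induction rule: equivclp_induct)
      (use assms(1) in \<open>auto simp: pushout_rel_iff dest: inj_onD\<close>)
  then show ?thesis by simp
qed

lemma po_r_inj:
  assumes "inj_on (f k) (simplices A k)" "po_r A f g k c = po_r A f g k c'"
  shows "c = c'"
proof -
  have "equivclp (pushout_rel A f g k) (Inr c) (Inr c')"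
    using assms(2) by (simp add: po_r_def qclass_eq_iff)
  then have "case_sum (\<lambda>b. \<exists>a\<in>simplices A k. b = f k a \<and> g k a = c) (\<lambda>y. y = c) (Inr c')"
    by (induction rule: equivclp_induct)
      (use assms(1) in \<open>auto simp: pushout_rel_iff dest: inj_onD\<close>)
  then show ?thesis by simp
qed

lemma po_l_eq_po_r:
  assumes "po_l A f g k b = po_r A f g k c"
  shows "b \<in> f k ` simplices A k"
proof -
  have "equivclp (pushout_rel A f g k) (Inl b) (Inr c)"
    using assms by (simp add: po_l_def po_r_def qclass_eq_iff)
  then have "case_sum (\<lambda>y. y = b \<or> b \<in> f k ` simplices A k) (\<lambda>_. b \<in> f k ` simplices A k) (Inr c)"
    by (induction rule: equivclp_induct) (auto simp: pushout_rel_iff)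
  then show ?thesis by simp
qed

lemma is_psset_psum:
  assumes "is_psset B" "is_psset C"
  shows "is_psset (psum B C)"
proof (rule is_pssetI)
  fix l m n \<phi> \<theta> x
  assume "\<phi> \<in> simp_op l m" "\<theta> \<in> simp_op m n" "x \<in> simplices (psum B C) n"
  then show "operator (psum B C) l n (compose {..l} \<theta> \<phi>) x = operator (psum B C) l m \<phi> (operator (psum B C) m n \<theta> x)"
    using psset_op_comp[OF assms(1)] psset_op_comp[OF assms(2)] by (auto simp: psum_def)
qed (auto simp: psum_def psset_base_in assms psset_op_in psset_op_base psset_op_id)

lemma ppushout_desc_l:
  assumes "\<And>a. a \<in> simplices A k \<Longrightarrow> u k (f k a) = v k (g k a)"
  shows "ppushout_desc u v k (po_l A f g k b) = u k b"
  unfolding ppushout_desc_def po_l_def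
  by (subst qlift_qclass) (use assms in \<open>auto simp: pushout_rel_iff\<close>)

lemma ppushout_desc_r:
  assumes "\<And>a. a \<in> simplices A k \<Longrightarrow> u k (f k a) = v k (g k a)"
  shows "ppushout_desc u v k (po_r A f g k c) = v k c"
  unfolding ppushout_desc_def po_r_def
  by (subst qlift_qclass) (use assms in \<open>auto simp: pushout_rel_iff\<close>)

context
  fixes A :: "'a psset" and B :: "'b psset" and C :: "'c psset" and f g
  assumes f: "is_psset_map A B f" and g: "is_psset_map A C g"
begin

lemma ppushout_op_compat: "op_compat (psum B C) (pushout_rel A f g)"
  unfolding op_compat_def
proof (intro allI ballI impI)
  fix l k a b \<theta> assume \<theta>: "\<theta> \<in> simp_op l k" and "pushout_rel A f g k a b"
  then show "equivclp (pushout_rel A f g l) (operator (psum B C) l k \<theta> a) (operator (psum B C) l k \<theta> b)"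
    unfolding pushout_rel_def
    by (intro r_into_equivclp, elim coeq_rel_map[where h = "operator A l k \<theta>"])
      (use f in \<open>simp_all add: psum_def psset_map_op[OF f] psset_map_op[OF g] psset_op_in is_psset_map_def\<close>)
qed

lemma is_psset_ppushout: "is_psset (ppushout A B C f g)"
  unfolding ppushout_def
  by (intro is_psset_pquot is_psset_psum ppushout_op_compat) (use f g in \<open>auto simp: is_psset_map_def\<close>)

lemma operator_ppushout:
  assumes "\<theta> \<in> simp_op l k"
  shows "operator (ppushout A B C f g) l k \<theta> (po_l A f g k b) = po_l A f g l (operator B l k \<theta> b)"
    and "operator (ppushout A B C f g) l k \<theta> (po_r A f g k c) = po_r A f g l (operator C l k \<theta> c)"
  unfolding ppushout_def po_l_def po_r_def operator_pquot'[OF ppushout_op_compat assms]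
  by (simp_all add: psum_def)

lemma basepoint_ppushout:
  shows "basepoint (ppushout A B C f g) k = po_l A f g k (basepoint B k)"
    and "basepoint (ppushout A B C f g) k = po_r A f g k (basepoint C k)"
proof -
  show "basepoint (ppushout A B C f g) k = po_l A f g k (basepoint B k)"
    by (simp add: ppushout_def po_l_def psum_def)
  moreover have "basepoint A k \<in> simplices A k"
    using f by (simp add: is_psset_map_def psset_base_in)
  ultimately show "basepoint (ppushout A B C f g) k = po_r A f g k (basepoint C k)"
    using po_eq[of "basepoint A k" A k f g] by (simp add: psset_map_base[OF f] psset_map_base[OF g])
qed

lemma is_psset_map_ppushout_desc:
  assumes u: "is_psset_map B D u" and v: "is_psset_map C D v"
    and uv: "\<And>k a. a \<in> simplices A k \<Longrightarrow> u k (f k a) = v k (g k a)"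
  shows "is_psset_map (ppushout A B C f g) D (ppushout_desc u v)"
proof (rule is_psset_mapI[OF is_psset_ppushout])
  note d = ppushout_desc_l[of A _ u f v g, OF uv] ppushout_desc_r[of A _ u f v g, OF uv]
  show "is_psset D" using u by (simp add: is_psset_map_def)
  show "ppushout_desc u v k (basepoint (ppushout A B C f g) k) = basepoint D k" for k
    by (simp add: basepoint_ppushout(1) d psset_map_base[OF u])
  fix k z assume z: "z \<in> simplices (ppushout A B C f g) k"
  then show "ppushout_desc u v k z \<in> simplices D k"
    by (cases rule: ppushout_cases) (simp_all add: d psset_map_in[OF u] psset_map_in[OF v])
  show "ppushout_desc u v l (operator (ppushout A B C f g) l k \<theta> z) = operator D l k \<theta> (ppushout_desc u v k z)"
    if "\<theta> \<in> simp_op l k" for l \<theta>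
    using z that by (cases rule: ppushout_cases)
      (simp_all add: d operator_ppushout psset_map_op[OF u] psset_map_op[OF v])
qed

end

context
  fixes A :: "'a symspec" and B :: "'b symspec" and C :: "'c symspec"
    and f :: "('a, 'b) spmap" and g :: "('a, 'c) spmap"
  assumes f: "is_spmap A B f" and g: "is_spmap A C g"
begin

definition sp_inl :: "('b, ('b + 'c) set) spmap" where
  "sp_inl m = po_l (level A m) (f m) (g m)"

definition sp_inr :: "('c, ('b + 'c) set) spmap" where
  "sp_inr m = po_r (level A m) (f m) (g m)"

lemma level_sp_pushout:
  "level (sp_pushout A B C f g) m = ppushout (level A m) (level B m) (level C m) (f m) (g m)"
  by (simp add: sp_pushout_def)

lemma sp_pushout_cases:
  assumes "z \<in> spx (sp_pushout A B C f g) m k"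
  obtains b where "b \<in> spx B m k" "z = sp_inl m k b" | c where "c \<in> spx C m k" "z = sp_inr m k c"
  using assms unfolding level_sp_pushout sp_inl_def sp_inr_def by (rule ppushout_cases)

lemma sp_pushout_eq: "a \<in> spx A m k \<Longrightarrow> sp_inl m k (f m k a) = sp_inr m k (g m k a)"
  unfolding sp_inl_def sp_inr_def by (rule po_eq)

lemma symact_sp_pushout:
  assumes \<gamma>: "\<gamma> permutes {..<m}"
  shows "symact (sp_pushout A B C f g) m \<gamma> k (sp_inl m k b) = sp_inl m k (symact B m \<gamma> k b)"
    and "symact (sp_pushout A B C f g) m \<gamma> k (sp_inr m k c) = sp_inr m k (symact C m \<gamma> k c)"
proof -
  have "symact (sp_pushout A B C f g) m \<gamma> k (qclass (pushout_rel (level A m) (f m) (g m) k) z) =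
      qclass (pushout_rel (level A m) (f m) (g m) k) (map_sum (symact B m \<gamma> k) (symact C m \<gamma> k) z)" for z
    unfolding sp_pushout_def Let_def symspec.simps pushout_rel_def
    by (rule pquot_map_qclass, rule r_into_equivclp, erule coeq_rel_map[where h = "symact A m \<gamma> k"])
      (simp_all add: \<gamma> symact_in[OF spmap_dom[OF f]] spmap_symact[OF f] spmap_symact[OF g])
  then show "symact (sp_pushout A B C f g) m \<gamma> k (sp_inl m k b) = sp_inl m k (symact B m \<gamma> k b)"
    "symact (sp_pushout A B C f g) m \<gamma> k (sp_inr m k c) = sp_inr m k (symact C m \<gamma> k c)"
    by (simp_all add: sp_inl_def sp_inr_def po_l_def po_r_def)
qed

lemma strmap_sp_pushout:
  assumes s: "s \<in> simplices circle k"
  shows "strmap (sp_pushout A B C f g) m k s (sp_inl m k b) = sp_inl (Suc m) k (strmap B m k s b)"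
    and "strmap (sp_pushout A B C f g) m k s (sp_inr m k c) = sp_inr (Suc m) k (strmap C m k s c)"
proof -
  have "strmap (sp_pushout A B C f g) m k s (qclass (pushout_rel (level A m) (f m) (g m) k) z) =
      qclass (pushout_rel (level A (Suc m)) (f (Suc m)) (g (Suc m)) k) (map_sum (strmap B m k s) (strmap C m k s) z)" for z
    unfolding sp_pushout_def Let_def symspec.simps pushout_rel_def
    by (rule pquot_map_qclass, rule r_into_equivclp, erule coeq_rel_map[where h = "strmap A m k s"])
      (simp_all add: s strmap_in[OF spmap_dom[OF f]] spmap_strmap[OF f] spmap_strmap[OF g])
  then show "strmap (sp_pushout A B C f g) m k s (sp_inl m k b) = sp_inl (Suc m) k (strmap B m k s b)"
    "strmap (sp_pushout A B C f g) m k s (sp_inr m k c) = sp_inr (Suc m) k (strmap C m k s c)"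
    by (simp_all add: sp_inl_def sp_inr_def po_l_def po_r_def)
qed

lemma pre_spmap_sp_inl: "pre_spmap B (sp_pushout A B C f g) sp_inl"
proof (rule pre_spmapI)
  fix m k show "sp_inl m k (spb B m k) = spb (sp_pushout A B C f g) m k"
    using basepoint_ppushout(1)[OF spmap_level[OF f] spmap_level[OF g]]
    by (simp add: level_sp_pushout sp_inl_def)
next
  fix m k l \<phi> x assume "\<phi> \<in> simp_op l k"
  then show "sp_inl m l (operator (level B m) l k \<phi> x) = operator (level (sp_pushout A B C f g) m) l k \<phi> (sp_inl m k x)"
    using operator_ppushout(1)[OF spmap_level[OF f] spmap_level[OF g]]
    by (simp add: level_sp_pushout sp_inl_def)
qed (simp_all add: symact_sp_pushout strmap_sp_pushout, simp add: level_sp_pushout simplices_ppushout sp_inl_def)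

lemma pre_spmap_sp_inr: "pre_spmap C (sp_pushout A B C f g) sp_inr"
proof (rule pre_spmapI)
  fix m k show "sp_inr m k (spb C m k) = spb (sp_pushout A B C f g) m k"
    using basepoint_ppushout(2)[OF spmap_level[OF f] spmap_level[OF g]]
    by (simp add: level_sp_pushout sp_inr_def)
next
  fix m k l \<phi> x assume "\<phi> \<in> simp_op l k"
  then show "sp_inr m l (operator (level C m) l k \<phi> x) = operator (level (sp_pushout A B C f g) m) l k \<phi> (sp_inr m k x)"
    using operator_ppushout(2)[OF spmap_level[OF f] spmap_level[OF g]]
    by (simp add: level_sp_pushout sp_inr_def)
qed (simp_all add: symact_sp_pushout strmap_sp_pushout, simp add: level_sp_pushout simplices_ppushout sp_inr_def)

lemma is_symspec_sp_pushout: "is_symspec (sp_pushout A B C f g)"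
proof (rule is_symspec_codomain[OF _ spmap_cod[OF f] pre_spmap_sp_inl])
  show "is_psset (level (sp_pushout A B C f g) m)" for m
    unfolding level_sp_pushout by (rule is_psset_ppushout[OF spmap_level[OF f] spmap_level[OF g]])
  show "symspec_at (sp_pushout A B C f g) m k z" if "z \<in> spx (sp_pushout A B C f g) m k" for m k z
    using that by (cases rule: sp_pushout_cases)
      (simp_all add: symspec_at_image[OF spmap_cod[OF f] pre_spmap_sp_inl] symspec_at_image[OF spmap_cod[OF g] pre_spmap_sp_inr])
qed

lemma sp_pushout_desc_in:
  assumes "\<And>a. a \<in> spx A m k \<Longrightarrow> u m k (f m k a) = v m k (g m k a)"
  shows "sp_pushout_desc u v m k (sp_inl m k b) = u m k b"
    and "sp_pushout_desc u v m k (sp_inr m k c) = v m k c"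
  unfolding sp_pushout_desc_def sp_inl_def sp_inr_def
  by (rule ppushout_desc_l[of "level A m" k "u m" "f m" "v m" "g m", OF assms], assumption,
      rule ppushout_desc_r[of "level A m" k "u m" "f m" "v m" "g m", OF assms], assumption)

lemma is_spmap_sp_pushout_desc:
  assumes u: "is_spmap B Z u" and v: "is_spmap C Z v"
    and uv: "\<And>m k a. a \<in> spx A m k \<Longrightarrow> u m k (f m k a) = v m k (g m k a)"
  shows "is_spmap (sp_pushout A B C f g) Z (sp_pushout_desc u v)"
  unfolding is_spmap_iff pre_spmap_def
proof (intro conjI allI ballI is_symspec_sp_pushout spmap_cod[OF u])
  note d = sp_pushout_desc_in[of _ _ u v, OF uv]
  show "sp_pushout_desc u v m k (spb (sp_pushout A B C f g) m k) = spb Z m k" for m k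
    using d(1)[of m k "spb B m k"] by (simp add: spmap_base[OF u] pre_spmap_base[OF pre_spmap_sp_inl])
  show "spmap_at (sp_pushout A B C f g) Z (sp_pushout_desc u v) m k z" if "z \<in> spx (sp_pushout A B C f g) m k" for m k z
    using that
  proof (cases rule: sp_pushout_cases)
    case (1 b)
    then show ?thesis
      using spmap_at_image[OF pre_spmap_sp_inl spmap_pre[OF u] spmap_dom[OF u], of b m k "sp_pushout_desc u v"] d by simp
  next
    case (2 c)
    then show ?thesis
      using spmap_at_image[OF pre_spmap_sp_inr spmap_pre[OF v] spmap_dom[OF v], of c m k "sp_pushout_desc u v"] d by simp
  qed
qed

end

section \<open>Spectral latching objects\<close>

lemma operator_sph_None [simp]: "operator (sph p) l k \<phi> None = None"
  by (simp add: sph_def psmash_pow_def)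

lemma operator_sph_Some:
  "operator (sph p) l k \<phi> (Some ss) = smash_pow_elt circle l (map (operator circle l k \<phi>) ss)"
  by (simp add: sph_def psmash_pow_def)

lemma basepoint_sph [simp]: "basepoint (sph p) k = None"
  by (simp add: sph_def psmash_pow_def)

lemma None_in_sph [simp]: "None \<in> simplices (sph p) k"
  by (simp add: sph_iff)

lemma is_psset_sph: "is_psset (sph p)"
proof -
  note C = is_psset_circle and op = operator_sph_Some
  show ?thesis
  proof (rule is_pssetI)
    fix m n \<theta> z assume \<theta>: "\<theta> \<in> simp_op m n" and z: "z \<in> simplices (sph p) n"
    from z show "operator (sph p) m n \<theta> z \<in> simplices (sph p) m"
    proof (cases rule: sph_cases)
      case (2 ss)
      then have "set (map (operator circle m n \<theta>) ss) \<subseteq> simplices circle m"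
        using psset_op_in[OF C \<theta>] by auto
      then show ?thesis unfolding sph_iff using 2 by (auto simp: op smash_pow_elt_def)
    qed simp
  next
    fix n z assume "z \<in> simplices (sph p) n"
    then show "operator (sph p) n n (\<lambda>i\<in>{..n}. i) z = z"
    proof (cases rule: sph_cases)
      case (2 ss)
      then have "map (operator circle n n (\<lambda>i\<in>{..n}. i)) ss = ss"
        using psset_op_id[OF C] by (auto intro!: map_idI)
      then show ?thesis using 2 by (simp add: op smash_pow_elt_def)
    qed simp
  next
    fix l m n \<phi> \<theta> z
    assume *: "\<phi> \<in> simp_op l m" "\<theta> \<in> simp_op m n" and "z \<in> simplices (sph p) n"
    from this(3) show "operator (sph p) l n (compose {..l} \<theta> \<phi>) z = operator (sph p) l m \<phi> (operator (sph p) m n \<theta> z)"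
    proof (cases rule: sph_cases)
      case (2 ss)
      have e: "map (operator circle l n (compose {..l} \<theta> \<phi>)) ss =
        map (operator circle l m \<phi>) (map (operator circle m n \<theta>) ss)"
        using psset_op_comp[OF C *] 2(3) by auto
      show ?thesis
      proof (cases "None \<in> set (map (operator circle m n \<theta>) ss)")
        case True
        then have "operator circle l m \<phi> None \<in> set (map (operator circle l n (compose {..l} \<theta> \<phi>)) ss)"
          using imageI[OF True, of "operator circle l m \<phi>"] by (simp only: e list.set_map)
        then have "None \<in> set (map (operator circle l n (compose {..l} \<theta> \<phi>)) ss)"
          using psset_op_base[OF C *(1)] by simp
        with True show ?thesis by (simp add: 2 op smash_pow_elt_def del: set_map)
      next
        case False
        then have "smash_pow_elt circle m (map (operator circle m n \<theta>) ss) = Some (map (operator circle m n \<theta>) ss)"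
          unfolding smash_pow_elt_def basepoint_circle by (rule if_not_P)
        then show ?thesis by (simp only: 2 op e)
      qed
    qed simp
  qed simp_all
qed

definition sph_cat :: "sph \<Rightarrow> sph \<Rightarrow> sph" where
  "sph_cat z a = (case z of None \<Rightarrow> None | Some zs \<Rightarrow> map_option ((@) zs) a)"

lemma sph_cat_simps [simp]:
  "sph_cat None a = None" "sph_cat z None = None" "sph_cat (Some zs) (Some as) = Some (zs @ as)"
  by (simp_all add: sph_cat_def split: option.splits)

lemma sph_cat_in: "z \<in> simplices (sph r) k \<Longrightarrow> a \<in> simplices (sph p) k \<Longrightarrow> sph_cat z a \<in> simplices (sph (r + p)) k"
  by (elim sph_cases) (auto simp: sph_iff)

lemma sphere_simps [simp]:
  "spx sphere p k = simplices (sph p) k" "spb sphere p k = None" "symact sphere p \<alpha> k z = sph_act \<alpha> z"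
  by (simp_all add: sphere_def)

lemma sphere_bar_simps [simp]:
  "spb sphere_bar p k = None" "symact sphere_bar p \<alpha> k z = sph_act \<alpha> z"
  by (simp_all add: sphere_bar_def sphere_def)

lemma spx_sphere_bar: "spx sphere_bar p k = (if p = 0 then {None} else simplices (sph p) k)"
  by (simp add: sphere_bar_def)

lemma sphere_bar_subset: "a \<in> spx sphere_bar p k \<Longrightarrow> a \<in> simplices (sph p) k"
  by (simp add: spx_sphere_bar split: if_splits)

lemma operator_sphere_bar:
  "a \<in> spx sphere_bar p k \<Longrightarrow> operator (level sphere_bar p) l k \<phi> a = operator (sph p) l k \<phi> a"
  by (auto simp: sphere_bar_def)

lemma strmap_iter_sphere:
  assumes z: "z \<in> simplices (sph r) k" and a: "a \<in> simplices (sph p) k"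
  shows "strmap_iter sphere r p k z a = sph_cat z a"
  using z
proof (cases rule: sph_cases)
  case (2 zs)
  have N: "strmap_list sphere p k zs None = None" for zs
    by (induction zs) (simp_all add: sphere_def)
  have "strmap_list sphere p k zs (Some as) = Some (zs @ as)" if "None \<notin> set as" for as
    using 2(4) that by (induction zs) (auto simp: sphere_def smash_pow_elt_def)
  with a 2 N show ?thesis by (elim sph_cases) (auto simp: strmap_iter_def)
qed (simp add: strmap_iter_def)

lemma strmap_list_sphere_bar: "strmap_list sphere_bar = strmap_list sphere"
proof (intro ext)
  fix p k zs a show "strmap_list sphere_bar p k zs a = strmap_list sphere p k zs a"
    by (induction zs) (simp_all add: sphere_bar_def)
qed

lemma strmap_iter_sphere_bar:
  assumes "z \<in> simplices (sph r) k" and "a \<in> spx sphere_bar p k"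
  shows "strmap_iter sphere_bar r p k z a = sph_cat z a"
  using strmap_iter_sphere[OF assms(1) sphere_bar_subset[OF assms(2)]]
  by (simp add: strmap_iter_def strmap_list_sphere_bar split: option.splits)

lemma sph_cat_bar_in:
  assumes "z \<in> simplices (sph r) k" "a \<in> spx sphere_bar p k"
  shows "sph_cat z a \<in> spx sphere_bar (r + p) k"
  using assms sph_cat_in[OF assms(1) sphere_bar_subset[OF assms(2)]]
  by (auto simp: spx_sphere_bar split: if_splits)

lemma sph_act_bar_in:
  assumes "\<alpha> permutes {..<p}" "a \<in> spx sphere_bar p k"
  shows "sph_act \<alpha> a \<in> spx sphere_bar p k"
  using sph_act_in[OF assms(1) sphere_bar_subset[OF assms(2)]] assms(2)
  by (auto simp: spx_sphere_bar sph_act_def split: if_splits)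

lemma sph_act_None [simp]: "sph_act \<alpha> None = None"
  by (simp add: sph_act_def)

lemma is_psset_sphere_bar: "is_psset (level sphere_bar p)"
proof (cases "p = 0")
  case True
  then show ?thesis by (simp add: sphere_bar_def is_psset_def)
next
  case False
  then show ?thesis by (simp add: sphere_bar_def is_psset_sph)
qed

lemma operator_sph_act:
  assumes "\<alpha> permutes {..<p}" "z \<in> simplices (sph p) k"
  shows "operator (sph p) l k \<phi> (sph_act \<alpha> z) = sph_act \<alpha> (operator (sph p) l k \<phi> z)"
  using assms(2)
proof (cases rule: sph_cases)
  case (2 ss)
  let ?c = "operator circle l k \<phi>"
  have p: "inv \<alpha> permutes {..<length ss}"
    using permutes_inv[OF assms(1)] 2(2) by simp
  have "map ?c (permute_list (inv \<alpha>) ss) = permute_list (inv \<alpha>) (map ?c ss)"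
    using permute_list_map[OF p, of ?c] by simp
  moreover have "set (permute_list (inv \<alpha>) (map ?c ss)) = set (map ?c ss)"
    using p by (intro set_permute_list) simp
  ultimately show ?thesis
    by (simp add: 2 operator_sph_Some sph_act_def smash_pow_elt_def)
qed simp

lemma operator_sph_cat:
  assumes "z \<in> simplices (sph r) k" "a \<in> simplices (sph p) k"
  shows "operator (sph (r + p)) l k \<phi> (sph_cat z a) =
    sph_cat (operator (sph r) l k \<phi> z) (operator (sph p) l k \<phi> a)"
  using assms by (elim sph_cases) (auto simp: operator_sph_Some smash_pow_elt_def sph_cat_def)

lemma strmap_list_circle_base:
  assumes X: "is_symspec X" and "set ss \<subseteq> simplices circle k" "x \<in> spx X m k" "None \<in> set ss"
  shows "strmap_list X m k ss x = spb X (length ss + m) k"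
  using assms(2,4)
proof (induction ss)
  case (Cons s ss)
  have "strmap_list X m k ss x \<in> spx X (length ss + m) k"
    using strmap_list_in[OF X _ assms(3)] Cons.prems by simp
  then show ?case
    using Cons strmap_base[OF X] strmap_circle_base[OF X] by auto
qed simp

lemma operator_strmap_iter:
  assumes X: "is_symspec X" and z: "z \<in> simplices (sph p) k" and x: "x \<in> spx X m k"
    and \<phi>: "\<phi> \<in> simp_op l k"
  shows "operator (level X (p + m)) l k \<phi> (strmap_iter X p m k z x) =
    strmap_iter X p m l (operator (sph p) l k \<phi> z) (operator (level X m) l k \<phi> x)"
  using z
proof (cases rule: sph_cases)
  case (2 ss)
  let ?c = "operator circle l k \<phi>"
  have e: "operator (level X (length ss + m)) l k \<phi> (strmap_list X m k ss x) =
    strmap_list X m l (map ?c ss) (operator (level X m) l k \<phi> x)"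
    using strmap_list_natural[OF X, where u = "\<lambda>m. operator (level X m) l k \<phi>" and c = ?c and l = l, OF _ 2(3) x]
    by (simp add: strmap_op[OF X _ _ \<phi>])
  show ?thesis
  proof (cases "None \<in> set (map ?c ss)")
    case True
    have "set (map ?c ss) \<subseteq> simplices circle l"
      using 2(3) psset_op_in[OF is_psset_circle \<phi>] by auto
    then have "strmap_list X m l (map ?c ss) (operator (level X m) l k \<phi> x) = spb X (length ss + m) l"
      using strmap_list_circle_base[OF X _ symspec_op_in[OF X \<phi> x] True] by simp
    with e True 2 show ?thesis
      by (simp add: operator_sph_Some smash_pow_elt_def strmap_iter_def del: set_map)
  next
    case False
    with e 2 show ?thesis
      by (simp add: operator_sph_Some smash_pow_elt_def strmap_iter_def del: set_map)
  qed
qed (simp add: strmap_iter_def symspec_op_base[OF X \<phi>])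

definition ev :: "'a symspec \<Rightarrow> nat \<Rightarrow> nat \<Rightarrow> (sph, 'a) smash_gen \<Rightarrow> 'a" where
  "ev X n k = (\<lambda>(p, q, \<gamma>, z, x). symact X n \<gamma> k (strmap_iter X p q k z x))"

lemma ev_simp [simp]: "ev X n k (p, q, \<gamma>, z, x) = symact X n \<gamma> k (strmap_iter X p q k z x)"
  by (simp add: ev_def)

lemma shuffle_inverse: "shuffle p r \<circ> shuffle r p = id"
  by (auto simp: shuffle_def fun_eq_iff)

lemma shuffle_permutes: "shuffle r p permutes {..<r + p}"
proof -
  have "bij (shuffle r p)" by (rule o_bij[of "shuffle p r"]) (simp_all add: shuffle_inverse)
  then show ?thesis by (auto simp: permutes_def bij_iff shuffle_def)
qed

lemma inv_shuffle: "inv (shuffle r p) = shuffle p r"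
  by (rule inv_unique_comp) (simp_all add: shuffle_inverse)

lemma sph_act_shuffle:
  assumes "z \<in> simplices (sph r) k" "a \<in> simplices (sph p) k"
  shows "sph_act (shuffle r p) (sph_cat z a) = sph_cat a z"
proof -
  have "permute_list (shuffle p r) (zs @ as) = as @ zs" if "length zs = r" "length as = p" for zs as :: "circ list"
    using that by (intro nth_equalityI) (auto simp: permute_list_def shuffle_def nth_append)
  with assms show ?thesis
    by (elim sph_cases) (auto simp: sph_act_def inv_shuffle)
qed

lemma strmap_list_append:
  "strmap_list X m k (as @ zs) x = strmap_list X (length zs + m) k as (strmap_list X m k zs x)"
  by (induction as) (simp_all add: add.assoc)

lemma strmap_iter_cat:
  assumes X: "is_symspec X" and a: "a \<in> simplices (sph p) k" and z: "z \<in> simplices (sph r) k" and x: "x \<in> spx X q k"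
  shows "strmap_iter X (p + r) q k (sph_cat a z) x = strmap_iter X p (r + q) k a (strmap_iter X r q k z x)"
  using a
proof (cases rule: sph_cases)
  case (2 as)
  note a = this
  from z show ?thesis
  proof (cases rule: sph_cases)
    case 1
    then show ?thesis
      using strmap_iter_base[of k X a p "r + q"] strmap_base[OF X] assms(2)
      by (simp add: strmap_iter_def add.assoc)
  next
    case (2 zs)
    with a show ?thesis by (simp add: strmap_iter_def strmap_list_append)
  qed
qed (simp add: strmap_iter_def add.assoc)

lemma ev_balanced:
  assumes X: "is_symspec X" and \<gamma>: "\<gamma> permutes {..<n}" and n: "p + r + q = n"
    and a: "a \<in> simplices (sph p) k" and z: "z \<in> simplices (sph r) k" and x: "x \<in> spx X q k"
  shows "ev X n k (p, r + q, \<gamma>, a, strmap_iter X r q k z x) =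
    ev X n k (r + p, q, \<gamma> \<circ> block_sum (r + p) (shuffle r p) id, sph_cat z a, x)"
proof -
  let ?b = "block_sum (r + p) (shuffle r p) id"
  have n': "n = r + p + q" using n by simp
  have b: "?b permutes {..<n}"
    unfolding n' by (rule block_sum_permutes[OF shuffle_permutes permutes_id])
  have za: "sph_cat z a \<in> simplices (sph (r + p)) k" by (rule sph_cat_in[OF z a])
  have "symact X n ?b k (strmap_iter X (r + p) q k (sph_cat z a) x) = strmap_iter X (r + p) q k (sph_cat a z) x"
    using strmap_iter_equivariant[OF X za shuffle_permutes permutes_id x] symact_id[OF X x]
    by (simp add: n' sph_act_shuffle[OF z a] del: id_apply)
  also have "\<dots> = strmap_iter X p (r + q) k a (strmap_iter X r q k z x)"
    using strmap_iter_cat[OF X a z x] by (simp add: add.commute)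
  finally show ?thesis
    using symact_comp[OF X \<gamma> b, of "strmap_iter X (r + p) q k (sph_cat z a) x" k] strmap_iter_in[OF X za x]
    by (simp add: n')
qed

lemma ev_base:
  assumes X: "is_symspec X" and "p + q = n" "\<gamma> permutes {..<n}" "z \<in> simplices (sph p) k" "z = None \<or> x = spb X q k"
  shows "ev X n k (p, q, \<gamma>, z, x) = spb X n k"
proof -
  have "strmap_iter X p q k z x = spb X n k"
    using assms strmap_iter_base[of k X z p q] strmap_base[OF X] by (auto simp: strmap_iter_def)
  then show ?thesis using symact_base[OF X assms(3)] by simp
qed

lemma ev_equivariant:
  assumes X: "is_symspec X" and "\<gamma> permutes {..<p + q}" "\<alpha> permutes {..<p}" "\<beta> permutes {..<q}"
    "z \<in> simplices (sph p) k" "x \<in> spx X q k"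
  shows "ev X (p + q) k (p, q, \<gamma> \<circ> block_sum p \<alpha> \<beta>, z, x) = ev X (p + q) k (p, q, \<gamma>, sph_act \<alpha> z, symact X q \<beta> k x)"
  using assms
  by (simp add: strmap_iter_equivariant[OF X] symact_comp[OF X] block_sum_permutes strmap_iter_in[OF X])

lemma ev_smash_rel:
  assumes X: "is_symspec X" and "smash_rel sphere X n k g h"
  shows "ev X n k g = ev X n k h"
  using assms(2)
proof cases
  case (base p q \<gamma> a x p' q' \<gamma>' a' x')
  then have "ev X n k g = spb X n k" "ev X n k h = spb X n k"
    using ev_base[OF X, of p q n \<gamma> a k x] ev_base[OF X, of p' q' n \<gamma>' a' k x']
    by (auto simp: smash_gens_def simp del: ev_simp)
  then show ?thesis by simp
next
  case (equivariant p q \<gamma> a x \<alpha> \<beta>)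
  then show ?thesis using ev_equivariant[OF X] by (auto simp: smash_gens_def simp del: ev_simp)
next
  case (balanced p r q \<gamma> a z x)
  then show ?thesis using ev_balanced[OF X] by (simp add: strmap_iter_sphere del: ev_simp)
qed

lemma smash_gens_bar_subset: "g \<in> smash_gens sphere_bar X n k \<Longrightarrow> g \<in> smash_gens sphere X n k"
  using sphere_bar_subset by (auto simp: smash_gens_def)

lemma smash_rel_bar_sphere:
  assumes "smash_rel sphere_bar X n k g h"
  shows "smash_rel sphere X n k g h"
  using assms
proof cases
  case (base p q \<gamma> a x p' q' \<gamma>' a' x')
  show ?thesis unfolding base(1,2)
    by (rule smash_rel.base) (use base in \<open>auto dest: smash_gens_bar_subset\<close>)
next
  case (equivariant p q \<gamma> a x \<alpha> \<beta>)
  then show ?thesis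
    using smash_rel.equivariant[OF smash_gens_bar_subset[OF equivariant(3)] equivariant(4,5)] by simp
next
  case (balanced p r q \<gamma> a z x)
  then show ?thesis
    using smash_rel.balanced[of p r q n \<gamma> a sphere k z x X] sphere_bar_subset[OF balanced(5)]
    by (simp add: strmap_iter_sphere strmap_iter_sphere_bar)
qed

abbreviation latch_class :: "'a symspec \<Rightarrow> nat \<Rightarrow> nat \<Rightarrow> (sph, 'a) smash_gen \<Rightarrow> (sph, 'a) smash_gen set" where
  "latch_class X m k \<equiv> qclass (smash_rel sphere_bar X m k)"

lemma nu_class:
  assumes X: "is_symspec X"
  shows "nu X m k (latch_class X m k g) = ev X m k g"
proof -
  have "sp_smash_map sphere X (\<lambda>_ _ z. z) (\<lambda>_ _ x. x) m k (latch_class X m k g) = qclass (smash_rel sphere X m k) g"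
    unfolding sp_smash_map_def
    by (subst pquot_map_qclass) (auto intro: r_into_equivclp smash_rel_bar_sphere)
  then show ?thesis
    unfolding nu_def sp_unit_def
    using qlift_qclass[of "smash_rel sphere X m k" "ev X m k" g] ev_smash_rel[OF X]
    by (simp add: ev_def)
qed

definition gen_map :: "(nat \<Rightarrow> sph \<Rightarrow> sph) \<Rightarrow> (nat \<Rightarrow> 'a \<Rightarrow> 'b) \<Rightarrow> (sph, 'a) smash_gen \<Rightarrow> (sph, 'b) smash_gen" where
  "gen_map c u = (\<lambda>(p, q, \<gamma>, a, x). (p, q, \<gamma>, c p a, u q x))"

lemma gen_map_simp [simp]: "gen_map c u (p, q, \<gamma>, a, x) = (p, q, \<gamma>, c p a, u q x)"
  by (simp add: gen_map_def)

lemma smash_rel_gen_map: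
  assumes c_bar: "\<And>p a. a \<in> spx sphere_bar p k \<Longrightarrow> c p a \<in> spx sphere_bar p l"
    and c: "\<And>p a. a \<in> simplices (sph p) k \<Longrightarrow> c p a \<in> simplices (sph p) l"
    and c_base: "\<And>p. c p None = None"
    and c_act: "\<And>p \<alpha> a. \<alpha> permutes {..<p} \<Longrightarrow> a \<in> simplices (sph p) k \<Longrightarrow> c p (sph_act \<alpha> a) = sph_act \<alpha> (c p a)"
    and c_cat: "\<And>r p z a. z \<in> simplices (sph r) k \<Longrightarrow> a \<in> simplices (sph p) k \<Longrightarrow>
      c (r + p) (sph_cat z a) = sph_cat (c r z) (c p a)"
    and u: "\<And>m x. x \<in> spx X m k \<Longrightarrow> u m x \<in> spx Y m l"
    and u_base: "\<And>m. u m (spb X m k) = spb Y m l"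
    and u_act: "\<And>m \<alpha> x. \<alpha> permutes {..<m} \<Longrightarrow> x \<in> spx X m k \<Longrightarrow> u m (symact X m \<alpha> k x) = symact Y m \<alpha> l (u m x)"
    and u_iter: "\<And>r m z x. z \<in> simplices (sph r) k \<Longrightarrow> x \<in> spx X m k \<Longrightarrow>
      u (r + m) (strmap_iter X r m k z x) = strmap_iter Y r m l (c r z) (u m x)"
    and gh: "smash_rel sphere_bar X n k g h"
  shows "smash_rel sphere_bar Y n l (gen_map c u g) (gen_map c u h)"
proof -
  have gens: "gen_map c u g' \<in> smash_gens sphere_bar Y n l" if "g' \<in> smash_gens sphere_bar X n k" for g'
    using that c_bar u by (auto simp: smash_gens_def)
  show ?thesis
    using gh
  proof cases
    case (base p q \<gamma> a x p' q' \<gamma>' a' x')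
    show ?thesis unfolding base(1,2) gen_map_simp
      by (rule smash_rel.base) (use base gens[OF base(3)] gens[OF base(5)] in \<open>auto simp: c_base u_base\<close>)
  next
    case (equivariant p q \<gamma> a x \<alpha> \<beta>)
    moreover have "a \<in> simplices (sph p) k" "x \<in> spx X q k"
      using equivariant(3) sphere_bar_subset by (auto simp: smash_gens_def)
    ultimately show ?thesis
      using smash_rel.equivariant[OF gens[OF equivariant(3), unfolded gen_map_simp] equivariant(4,5)]
      by (simp add: c_act u_act)
  next
    case (balanced p r q \<gamma> a z x)
    then show ?thesis
      using smash_rel.balanced[of p r q n \<gamma> "c p a" sphere_bar l "c r z" "u q x" Y]
      by (simp add: strmap_iter_sphere_bar c_cat c_bar c u u_iter sphere_bar_subset)
  qed
qed

lemma slice_map_spmap: "is_spmap X Y f \<Longrightarrow> slice_map k X Y (\<lambda>m. f m k)"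
  by (simp add: slice_map_def spmap_base spmap_in spmap_symact spmap_strmap)

abbreviation gmap :: "(nat \<Rightarrow> 'a \<Rightarrow> 'b) \<Rightarrow> (sph, 'a) smash_gen \<Rightarrow> (sph, 'b) smash_gen" where
  "gmap \<equiv> gen_map (\<lambda>_ z. z)"

lemma gmap_gens:
  "slice_map k X Y u \<Longrightarrow> g \<in> smash_gens sphere_bar X n k \<Longrightarrow> gmap u g \<in> smash_gens sphere_bar Y n k"
  by (auto simp: smash_gens_def slice_map_def)

lemma smash_rel_gmap:
  assumes X: "is_symspec X" and u: "slice_map k X Y u" and "smash_rel sphere_bar X n k g h"
  shows "smash_rel sphere_bar Y n k (gmap u g) (gmap u h)"
  by (rule smash_rel_gen_map[OF _ _ _ _ _ _ _ _ _ assms(3)])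
    (use u slice_map_iter[OF X u] in \<open>auto simp: slice_map_def\<close>)

lemma equivclp_gmap:
  assumes X: "is_symspec X" and u: "slice_map k X Y u" and "equivclp (smash_rel sphere_bar X n k) g h"
  shows "equivclp (smash_rel sphere_bar Y n k) (gmap u g) (gmap u h)"
  using assms(3) by (rule equivclp_map) (auto intro: r_into_equivclp smash_rel_gmap[OF X u])

lemma ev_gmap:
  assumes X: "is_symspec X" and u: "slice_map k X Y u" and "g \<in> smash_gens sphere_bar X n k"
  shows "ev Y n k (gmap u g) = u n (ev X n k g)"
proof -
  obtain p q \<gamma> a x where g: "g = (p, q, \<gamma>, a, x)" "n = p + q" "\<gamma> permutes {..<n}"
    "a \<in> simplices (sph p) k" "x \<in> spx X q k"
    using assms(3) sphere_bar_subset by (auto simp: smash_gens_def)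
  then show ?thesis
    using u strmap_iter_in[OF X g(4,5)] by (simp add: slice_map_iter[OF X u, symmetric] slice_map_def)
qed

lemma ev_in:
  assumes X: "is_symspec X" and "g \<in> smash_gens sphere_bar X n k"
  shows "ev X n k g \<in> spx X n k"
proof -
  obtain p q \<gamma> a x where g: "g = (p, q, \<gamma>, a, x)" "n = p + q" "\<gamma> permutes {..<n}"
    "a \<in> simplices (sph p) k" "x \<in> spx X q k"
    using assms(2) sphere_bar_subset by (auto simp: smash_gens_def)
  then show ?thesis
    using strmap_iter_in[OF X g(4,5)] by (simp add: symact_in[OF X])
qed

definition latch_psset :: "'a symspec \<Rightarrow> nat \<Rightarrow> (sph, 'a) smash_gen psset" where
  "latch_psset X n = \<lparr>simplices = smash_gens sphere_bar X n, operator = sp_smash_op sphere_bar X,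
     basepoint = \<lambda>k. (0, n, id, spb sphere_bar 0 k, spb X n k)\<rparr>"

lemma spectral_latch_eq: "spectral_latch X n = pquot (latch_psset X n) (smash_rel sphere_bar X n)"
  by (simp add: spectral_latch_def sp_smash_def latch_psset_def)

lemma sp_smash_op_gen_map:
  assumes "g \<in> smash_gens sphere_bar X n k"
  shows "sp_smash_op sphere_bar X l k \<phi> g =
    gen_map (\<lambda>p. operator (sph p) l k \<phi>) (\<lambda>m. operator (level X m) l k \<phi>) g"
  using assms by (auto simp: sp_smash_op_def smash_gens_def operator_sphere_bar)

lemma is_psset_latch_psset:
  assumes X: "is_symspec X"
  shows "is_psset (latch_psset X n)"
proof (rule is_pssetI)
  fix l m k \<phi> \<theta> g
  assume *: "\<phi> \<in> simp_op l m" "\<theta> \<in> simp_op m k" "g \<in> simplices (latch_psset X n) k"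
  show "operator (latch_psset X n) l k (compose {..l} \<theta> \<phi>) g =
    operator (latch_psset X n) l m \<phi> (operator (latch_psset X n) m k \<theta> g)"
    using *(3) psset_op_comp[OF is_psset_sphere_bar *(1,2)] psset_op_comp[OF symspec_psset[OF X] *(1,2)]
    by (auto simp: latch_psset_def sp_smash_op_def smash_gens_def)
next
  fix m k \<theta> g assume "\<theta> \<in> simp_op m k" "g \<in> simplices (latch_psset X n) k"
  then show "operator (latch_psset X n) m k \<theta> g \<in> simplices (latch_psset X n) m"
    using psset_op_in[OF is_psset_sphere_bar] symspec_op_in[OF X]
    by (auto simp: latch_psset_def sp_smash_op_def smash_gens_def)
next
  fix m k \<theta> assume "\<theta> \<in> simp_op m k"
  then show "operator (latch_psset X n) m k \<theta> (basepoint (latch_psset X n) k) = basepoint (latch_psset X n) m"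
    using psset_op_base[OF is_psset_sphere_bar, of \<theta> m k 0] symspec_op_base[OF X]
    by (simp add: latch_psset_def sp_smash_op_def)
qed (auto simp: latch_psset_def sp_smash_op_def smash_gens_def is_psset_sphere_bar symspec_psset[OF X]
      psset_op_id symspec_base_in[OF X] permutes_id spx_sphere_bar[of 0])

lemma smash_rel_op:
  assumes X: "is_symspec X" and \<phi>: "\<phi> \<in> simp_op l k" and "smash_rel sphere_bar X n k g h"
  shows "smash_rel sphere_bar X n l
    (gen_map (\<lambda>p. operator (sph p) l k \<phi>) (\<lambda>m. operator (level X m) l k \<phi>) g)
    (gen_map (\<lambda>p. operator (sph p) l k \<phi>) (\<lambda>m. operator (level X m) l k \<phi>) h)"
proof (rule smash_rel_gen_map[OF _ _ _ _ _ _ _ _ _ assms(3)])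
  show "operator (sph p) l k \<phi> a \<in> spx sphere_bar p l" if "a \<in> spx sphere_bar p k" for p a
    using psset_op_in[OF is_psset_sphere_bar \<phi> that] operator_sphere_bar[OF that] by simp
qed (auto simp: psset_op_in[OF is_psset_sph \<phi>] operator_sph_act operator_sph_cat symspec_op_in[OF X \<phi>]
    symspec_op_base[OF X \<phi>] symact_op[OF X _ _ \<phi>] operator_strmap_iter[OF X _ _ \<phi>])

lemma smash_rel_gens:
  assumes X: "is_symspec X" and "smash_rel sphere_bar X n k g h"
  shows "g \<in> smash_gens sphere_bar X n k" "h \<in> smash_gens sphere_bar X n k"
proof -
  have "g \<in> smash_gens sphere_bar X n k \<and> h \<in> smash_gens sphere_bar X n k"
    using assms(2)
  proof cases
    case (equivariant p q \<gamma> a x \<alpha> \<beta>)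
    then show ?thesis
      by (auto simp: smash_gens_def permutes_compose block_sum_permutes sph_act_bar_in symact_in[OF X])
  next
    case (balanced p r q \<gamma> a z x)
    have "block_sum (r + p) (shuffle r p) id permutes {..<n}"
      using block_sum_permutes[OF shuffle_permutes permutes_id, of r p q] balanced(3) by (simp add: ac_simps)
    with balanced show ?thesis
      by (auto simp: smash_gens_def permutes_compose strmap_iter_in[OF X] strmap_iter_sphere_bar sph_cat_bar_in)
  qed auto
  then show "g \<in> smash_gens sphere_bar X n k" "h \<in> smash_gens sphere_bar X n k" by auto
qed

lemma latch_op_compat:
  assumes X: "is_symspec X"
  shows "op_compat (latch_psset X n) (smash_rel sphere_bar X n)"
  unfolding op_compat_def
proof (intro allI ballI impI)
  fix l k g h \<phi> assume \<phi>: "\<phi> \<in> simp_op l k" and gh: "smash_rel sphere_bar X n k g h"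
  show "equivclp (smash_rel sphere_bar X n l) (operator (latch_psset X n) l k \<phi> g) (operator (latch_psset X n) l k \<phi> h)"
    using smash_rel_op[OF X \<phi> gh]
    by (simp only: latch_psset_def psset.simps sp_smash_op_gen_map[OF smash_rel_gens(1)[OF X gh]]
      sp_smash_op_gen_map[OF smash_rel_gens(2)[OF X gh]] r_into_equivclp)
qed

lemma is_psset_spectral_latch:
  "is_symspec X \<Longrightarrow> is_psset (spectral_latch X n)"
  unfolding spectral_latch_eq by (intro is_psset_pquot is_psset_latch_psset latch_op_compat)

lemma simplices_spectral_latch:
  "simplices (spectral_latch X n) k = latch_class X n k ` smash_gens sphere_bar X n k"
  by (simp add: spectral_latch_eq latch_psset_def)

lemma operator_spectral_latch:
  assumes "is_symspec X" "\<phi> \<in> simp_op l k" "g \<in> smash_gens sphere_bar X n k"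
  shows "operator (spectral_latch X n) l k \<phi> (latch_class X n k g) =
    latch_class X n l (gen_map (\<lambda>p. operator (sph p) l k \<phi>) (\<lambda>m. operator (level X m) l k \<phi>) g)"
  unfolding spectral_latch_eq operator_pquot'[OF latch_op_compat[OF assms(1)] assms(2)]
  by (simp add: latch_psset_def sp_smash_op_gen_map[OF assms(3)])

lemma basepoint_spectral_latch:
  "basepoint (spectral_latch X n) k = latch_class X n k (0, n, id, None, spb X n k)"
  by (simp add: spectral_latch_eq latch_psset_def)

lemma spectral_latch_map_class:
  assumes f: "is_spmap X Y f"
  shows "spectral_latch_map Y f m k (latch_class X m k g) = latch_class Y m k (gmap (\<lambda>m. f m k) g)"
  unfolding spectral_latch_map_def sp_smash_map_def gen_map_def
  by (rule pquot_map_qclass, rule r_into_equivclp)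
    (use smash_rel_gmap[OF spmap_dom[OF f] slice_map_spmap[OF f]] in \<open>simp add: gen_map_def\<close>)

lemma is_psset_map_spectral_latch_map:
  assumes f: "is_spmap X Y f"
  shows "is_psset_map (spectral_latch X m) (spectral_latch Y m) (spectral_latch_map Y f m)"
proof (rule is_psset_mapI)
  note X = spmap_dom[OF f] and Y = spmap_cod[OF f]
  show "is_psset (spectral_latch X m)" "is_psset (spectral_latch Y m)"
    by (simp_all add: is_psset_spectral_latch X Y)
  show "spectral_latch_map Y f m k (basepoint (spectral_latch X m) k) = basepoint (spectral_latch Y m) k" for k
    by (simp add: basepoint_spectral_latch spectral_latch_map_class[OF f] spmap_base[OF f])
  fix k c assume "c \<in> simplices (spectral_latch X m) k"
  then obtain g where g: "g \<in> smash_gens sphere_bar X m k" "c = latch_class X m k g"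
    by (auto simp: simplices_spectral_latch)
  show "spectral_latch_map Y f m k c \<in> simplices (spectral_latch Y m) k"
    using g gmap_gens[OF slice_map_spmap[OF f]]
    by (auto simp: simplices_spectral_latch spectral_latch_map_class[OF f])
  show "spectral_latch_map Y f m l (operator (spectral_latch X m) l k \<phi> c) =
    operator (spectral_latch Y m) l k \<phi> (spectral_latch_map Y f m k c)" if \<phi>: "\<phi> \<in> simp_op l k" for l \<phi>
  proof -
    have "gmap (\<lambda>m. f m l) (gen_map (\<lambda>p. operator (sph p) l k \<phi>) (\<lambda>m. operator (level X m) l k \<phi>) g) =
      gen_map (\<lambda>p. operator (sph p) l k \<phi>) (\<lambda>m. operator (level Y m) l k \<phi>) (gmap (\<lambda>m. f m k) g)"
      using g(1) by (auto simp: smash_gens_def spmap_op[OF f] \<phi>)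
    then show ?thesis
      using gmap_gens[OF slice_map_spmap[OF f] g(1)]
      by (simp add: g spectral_latch_map_class[OF f] operator_spectral_latch[OF X \<phi>] operator_spectral_latch[OF Y \<phi>])
  qed
qed

lemma is_psset_map_nu:
  assumes X: "is_symspec X"
  shows "is_psset_map (spectral_latch X m) (level X m) (nu X m)"
proof (rule is_psset_mapI)
  show "is_psset (spectral_latch X m)" "is_psset (level X m)"
    by (simp_all add: is_psset_spectral_latch X symspec_psset)
  show "nu X m k (basepoint (spectral_latch X m) k) = spb X m k" for k
    unfolding basepoint_spectral_latch nu_class[OF X]
    by (rule ev_base[OF X]) (simp_all add: permutes_id)
  fix k c assume "c \<in> simplices (spectral_latch X m) k"
  then obtain g where g: "g \<in> smash_gens sphere_bar X m k" "c = latch_class X m k g"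
    by (auto simp: simplices_spectral_latch)
  then show "nu X m k c \<in> spx X m k" by (simp add: nu_class[OF X] ev_in[OF X])
  show "nu X m l (operator (spectral_latch X m) l k \<phi> c) = operator (level X m) l k \<phi> (nu X m k c)"
    if \<phi>: "\<phi> \<in> simp_op l k" for l \<phi>
    using g sphere_bar_subset strmap_iter_in[OF X]
    by (auto simp: operator_spectral_latch[OF X \<phi>] nu_class[OF X] smash_gens_def
        operator_strmap_iter[OF X _ _ \<phi>, symmetric] symact_op[OF X _ _ \<phi>])
qed

lemma nu_natural:
  assumes f: "is_spmap X Y f" and "c \<in> simplices (spectral_latch X m) k"
  shows "f m k (nu X m k c) = nu Y m k (spectral_latch_map Y f m k c)"
  using assms(2) ev_gmap[OF spmap_dom[OF f] slice_map_spmap[OF f]]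
  by (auto simp: simplices_spectral_latch spectral_latch_map_class[OF f] nu_class spmap_dom[OF f] spmap_cod[OF f])

lemma flat_cofibration_iff:
  assumes f: "is_spmap X Y f"
  shows "flat_cofibration X Y f \<longleftrightarrow> (\<forall>m k. inj_on (ppushout_desc (f m) (nu Y m) k)
    (simplices (ppushout (spectral_latch X m) (level X m) (spectral_latch Y m)
      (nu X m) (spectral_latch_map Y f m)) k))"
proof -
  have "is_psset_map (ppushout (spectral_latch X m) (level X m) (spectral_latch Y m)
      (nu X m) (spectral_latch_map Y f m)) (level Y m) (ppushout_desc (f m) (nu Y m))" for m
    by (intro is_psset_map_ppushout_desc is_psset_map_nu is_psset_map_spectral_latch_map f
        spmap_level[OF f] spmap_dom[OF f] spmap_cod[OF f] nu_natural[OF f])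
  with f show ?thesis by (simp add: flat_cofibration_def is_cofibration_def)
qed

section \<open>Flat cofibrations between flat-cofibrant spectra\<close>

definition flat_slice :: "nat \<Rightarrow> 'a symspec \<Rightarrow> bool" where
  "flat_slice k Y \<longleftrightarrow> (\<forall>m. \<forall>g \<in> smash_gens sphere_bar Y m k. \<forall>h \<in> smash_gens sphere_bar Y m k.
     ev Y m k g = ev Y m k h \<longrightarrow> equivclp (smash_rel sphere_bar Y m k) g h)"

definition decomposable :: "nat \<Rightarrow> 'a symspec \<Rightarrow> nat \<Rightarrow> 'a \<Rightarrow> bool" where
  "decomposable k Y m y \<longleftrightarrow> y \<in> ev Y m k ` smash_gens sphere_bar Y m k"

definition reflects_decomposable :: "nat \<Rightarrow> 'a symspec \<Rightarrow> 'b symspec \<Rightarrow> (nat \<Rightarrow> 'a \<Rightarrow> 'b) \<Rightarrow> nat \<Rightarrow> bool" where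
  "reflects_decomposable k X Y u m \<longleftrightarrow>
     (\<forall>x \<in> spx X m k. decomposable k Y m (u m x) \<longrightarrow> decomposable k X m x)"

definition base_gen :: "nat \<Rightarrow> 'a symspec \<Rightarrow> (sph, 'a) smash_gen \<Rightarrow> bool" where
  "base_gen k X = (\<lambda>(p, q, \<gamma>, a, x). a = None \<or> x = spb X q k)"

lemma base_gen_simp [simp]: "base_gen k X (p, q, \<gamma>, a, x) \<longleftrightarrow> a = None \<or> x = spb X q k"
  by (simp add: base_gen_def)

lemma decomposable_image:
  assumes "is_symspec X" "slice_map k X Y u" "decomposable k X m x"
  shows "decomposable k Y m (u m x)"
proof -
  obtain g where g: "g \<in> smash_gens sphere_bar X m k" "x = ev X m k g"
    using assms(3) unfolding decomposable_def by blast
  show ?thesis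
    unfolding decomposable_def
    by (rule image_eqI[OF _ gmap_gens[OF assms(2) g(1)]]) (simp add: ev_gmap[OF assms(1,2) g(1)] g(2))
qed

lemma symact_inverse:
  assumes X: "is_symspec X" and \<beta>: "\<beta> permutes {..<m}" and x: "x \<in> spx X m k"
  shows "symact X m (inv \<beta>) k (symact X m \<beta> k x) = x" "symact X m \<beta> k (symact X m (inv \<beta>) k x) = x"
  using symact_comp[OF X permutes_inv[OF \<beta>] \<beta> x] symact_comp[OF X \<beta> permutes_inv[OF \<beta>] x] symact_id[OF X x]
  by (simp_all add: permutes_inv_o[OF \<beta>])

lemma symact_eq_base_iff:
  assumes X: "is_symspec X" and \<beta>: "\<beta> permutes {..<m}" and x: "x \<in> spx X m k"
  shows "symact X m \<beta> k x = spb X m k \<longleftrightarrow> x = spb X m k"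
  using symact_inverse(1)[OF X \<beta> x] symact_base[OF X \<beta>] symact_base[OF X permutes_inv[OF \<beta>]] by metis

lemma strmap_iter_0: "z \<in> simplices (sph 0) k \<Longrightarrow> z \<noteq> None \<Longrightarrow> strmap_iter X 0 q k z x = x"
  by (elim sph_cases) (auto simp: strmap_iter_def)

lemma sphere_bar_pos: "a \<in> spx sphere_bar p k \<Longrightarrow> a \<noteq> None \<Longrightarrow> p \<noteq> 0"
  by (metis singletonD spx_sphere_bar)

lemma strmap_iter_trivial:
  assumes "is_symspec X" "z \<in> simplices (sph r) k" "z = None \<or> x = spb X q k"
  shows "strmap_iter X r q k z x = spb X (r + q) k"
  using assms(3) strmap_iter_base[OF _ assms(2), of X q] strmap_base[OF assms(1)]
  by (auto simp: strmap_iter_def)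

lemma base_gen_ev:
  assumes X: "is_symspec X" and g: "g \<in> smash_gens sphere_bar X m k" "base_gen k X g"
  shows "ev X m k g = spb X m k"
proof -
  obtain p q \<gamma> a x where "g = (p, q, \<gamma>, a, x)" "p + q = m" "\<gamma> permutes {..<m}"
    "a \<in> simplices (sph p) k" "x \<in> spx X q k"
    using g(1) sphere_bar_subset by (auto simp: smash_gens_def)
  then show ?thesis using g(2) ev_base[OF X, of p q m \<gamma> a k x] by auto
qed

lemma base_gens_related:
  assumes "g \<in> smash_gens sphere_bar X m k" "base_gen k X g" "h \<in> smash_gens sphere_bar X m k" "base_gen k X h"
  shows "smash_rel sphere_bar X m k g h"
proof -
  obtain p q \<gamma> a x p' q' \<gamma>' a' x' where "g = (p, q, \<gamma>, a, x)" "h = (p', q', \<gamma>', a', x')"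
    by (metis prod_cases5)
  then show ?thesis using assms by (auto intro: smash_rel.base)
qed

lemma trivial_gen:
  assumes "is_symspec X"
  shows "(0, m, id, None, spb X m k) \<in> smash_gens sphere_bar X m k"
  by (simp add: smash_gens_def permutes_id spx_sphere_bar symspec_base_in[OF assms])

text \<open>For \<open>a \<noteq> *\<close> and \<open>p > 0\<close>, freeness in the smaller level \<open>r + q\<close> shows that
  \<open>\<sigma>\<^sup>r(z \<and> x)\<close> is the basepoint only if \<open>z\<close> or \<open>x\<close> is.\<close>

lemma base_gen_smash_rel:
  assumes Y: "is_symspec Y" and flat: "flat_slice k Y"
  shows "smash_rel sphere_bar Y m k g h \<Longrightarrow> base_gen k Y g \<longleftrightarrow> base_gen k Y h"
proof (induction m arbitrary: g h rule: less_induct)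
  case (less m)
  from less.prems show ?case
  proof cases
    case (base p q \<gamma> a x p' q' \<gamma>' a' x')
    then show ?thesis by simp
  next
    case (equivariant p q \<gamma> a x \<alpha> \<beta>)
    moreover have "x \<in> spx Y q k" using equivariant(3) by (simp add: smash_gens_def)
    ultimately show ?thesis by (auto simp: symact_eq_base_iff[OF Y] sph_act_def)
  next
    case (balanced p r q \<gamma> a z x)
    note zin = \<open>z \<in> simplices (sph r) k\<close> and xin = \<open>x \<in> spx Y q k\<close> and ain = \<open>a \<in> spx sphere_bar p k\<close>
    have 1: "strmap_iter Y r q k z x = spb Y (r + q) k" if "z = None \<or> x = spb Y q k"
      using strmap_iter_trivial[OF Y zin that] .
    have 2: "z = None \<or> x = spb Y q k" if b: "strmap_iter Y r q k z x = spb Y (r + q) k" and a: "a \<noteq> None"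
    proof (cases "r = 0")
      case True
      with b zin strmap_iter_0[of z k Y q x] show ?thesis by (cases "z = None") auto
    next
      case False
      let ?g = "(r, q, id, z, x)" and ?h = "(0, r + q, id, None, spb Y (r + q) k)"
      have "p \<noteq> 0" using sphere_bar_pos[OF ain a] .
      then have lt: "r + q < m" using balanced(3) by simp
      have g: "?g \<in> smash_gens sphere_bar Y (r + q) k"
        using False zin xin by (simp add: smash_gens_def permutes_id spx_sphere_bar)
      have h: "?h \<in> smash_gens sphere_bar Y (r + q) k" by (rule trivial_gen[OF Y])
      have "ev Y (r + q) k ?g = ev Y (r + q) k ?h"
        using base_gen_ev[OF Y h] b symact_base[OF Y permutes_id] by (simp del: id_apply)
      then have "equivclp (smash_rel sphere_bar Y (r + q) k) ?g ?h"
        using flat g h by (auto simp: flat_slice_def)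
      then have "base_gen k Y ?g = base_gen k Y ?h"
        by (rule equivclp_invariant) (rule less.IH[OF lt])
      then show ?thesis by simp
    qed
    have "sph_cat z a = None \<longleftrightarrow> z = None \<or> a = None"
      by (auto simp: sph_cat_def split: option.splits)
    then show ?thesis
      using 1 2 by (auto simp: balanced(1,2) strmap_iter_sphere_bar[OF zin ain])
  qed
qed

lemma base_gen_equivclp:
  assumes "is_symspec Y" "flat_slice k Y" "equivclp (smash_rel sphere_bar Y m k) g h"
  shows "base_gen k Y g \<longleftrightarrow> base_gen k Y h"
  using assms(3) by (rule equivclp_invariant) (rule base_gen_smash_rel[OF assms(1,2)])

lemma ev_equivclp:
  assumes "is_symspec X" "equivclp (smash_rel sphere_bar X m k) g h"
  shows "ev X m k g = ev X m k h"
  using assms(2) by (rule equivclp_invariant) (rule ev_smash_rel[OF assms(1) smash_rel_bar_sphere])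

lemma gens_equivclp:
  assumes "is_symspec X" "equivclp (smash_rel sphere_bar X m k) g h" "g \<in> smash_gens sphere_bar X m k"
  shows "h \<in> smash_gens sphere_bar X m k"
  using equivclp_invariant[OF assms(2), of "\<lambda>g. g \<in> smash_gens sphere_bar X m k"] assms(3)
    smash_rel_gens[OF assms(1)] by blast

context
  fixes k M :: nat and X :: "'a symspec" and Y :: "'b symspec" and u :: "nat \<Rightarrow> 'a \<Rightarrow> 'b"
  assumes X: "is_symspec X" and Y: "is_symspec Y" and flat: "flat_slice k Y" and u: "slice_map k X Y u"
    and reflects: "\<And>j. j < M \<Longrightarrow> reflects_decomposable k X Y u j"
begin

private lemma lift_structure_map:
  assumes chain: "\<And>g h. g \<in> smash_gens sphere_bar X (r + q) k \<Longrightarrow> \<not> base_gen k Y (gmap u g) \<Longrightarrow>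
      equivclp (smash_rel sphere_bar Y (r + q) k) (gmap u g) h \<Longrightarrow>
      \<exists>g'. gmap u g' = h \<and> equivclp (smash_rel sphere_bar X (r + q) k) g g'"
    and lt: "r + q < M" and x: "x \<in> spx X (r + q) k" and z: "z \<in> simplices (sph r) k" and y: "y \<in> spx Y q k"
    and eq: "u (r + q) x = strmap_iter Y r q k z y" and nb: "u (r + q) x \<noteq> spb Y (r + q) k"
  shows "\<exists>x'. x' \<in> spx X q k \<and> u q x' = y \<and> strmap_iter X r q k z x' = x"
proof -
  have zy: "z \<noteq> None" "y \<noteq> spb Y q k"
    using nb eq strmap_iter_trivial[OF Y z, of y q] by metis+
  show ?thesis
  proof (cases "r = 0")
    case True
    then have "strmap_iter X r q k z x = x" "strmap_iter Y r q k z y = y"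
      using strmap_iter_0[of z k] z zy by auto
    with True x eq show ?thesis by auto
  next
    case False
    let ?h = "(r, q, id, z, y)"
    have h: "?h \<in> smash_gens sphere_bar Y (r + q) k"
      using False z y by (simp add: smash_gens_def permutes_id spx_sphere_bar)
    have evh: "ev Y (r + q) k ?h = u (r + q) x"
      using symact_id[OF Y strmap_iter_in[OF Y z y]] eq by simp
    then have "decomposable k Y (r + q) (u (r + q) x)"
      using h by (metis decomposable_def image_eqI)
    then have "decomposable k X (r + q) x"
      using reflects[OF lt] x by (simp add: reflects_decomposable_def)
    then obtain g where g: "g \<in> smash_gens sphere_bar X (r + q) k" "x = ev X (r + q) k g"
      by (auto simp: decomposable_def)
    have "ev Y (r + q) k (gmap u g) = ev Y (r + q) k ?h"
      using ev_gmap[OF X u g(1)] g(2) evh by simp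
    then have e: "equivclp (smash_rel sphere_bar Y (r + q) k) (gmap u g) ?h"
      using flat h gmap_gens[OF u g(1)] by (auto simp: flat_slice_def)
    have "\<not> base_gen k Y (gmap u g)"
      using base_gen_equivclp[OF Y flat e] zy by simp
    from chain[OF g(1) this e] obtain g' where g': "gmap u g' = ?h" "equivclp (smash_rel sphere_bar X (r + q) k) g g'"
      by blast
    from g'(1) obtain x' where x': "g' = (r, q, id, z, x')" "u q x' = y"
      by (cases g') auto
    have "g' \<in> smash_gens sphere_bar X (r + q) k" by (rule gens_equivclp[OF X g'(2) g(1)])
    then have x'in: "x' \<in> spx X q k" by (simp add: x' smash_gens_def)
    have "x = ev X (r + q) k g'" using ev_equivclp[OF X g'(2)] g(2) by simp
    also have "\<dots> = strmap_iter X r q k z x'"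
      using symact_id[OF X strmap_iter_in[OF X z x'in]] by (simp add: x')
    finally show ?thesis using x' x'in by auto
  qed
qed

lemma lift_chain:
  assumes "m \<le> M" "g \<in> smash_gens sphere_bar X m k" "\<not> base_gen k Y (gmap u g)"
    "equivclp (smash_rel sphere_bar Y m k) (gmap u g) h"
  shows "\<exists>g'. gmap u g' = h \<and> equivclp (smash_rel sphere_bar X m k) g g'"
  using assms
proof (induction m arbitrary: g h rule: less_induct)
  case (less m)
  have forward: "\<exists>g'. gmap u g' = h \<and> equivclp (smash_rel sphere_bar X m k) g g'"
    if g: "g \<in> smash_gens sphere_bar X m k" and nb: "\<not> base_gen k Y (gmap u g)"
      and rel: "smash_rel sphere_bar Y m k (gmap u g) h" for g h
  proof -
    obtain p0 q0 \<gamma>0 a0 x0 where g0: "g = (p0, q0, \<gamma>0, a0, x0)" by (metis prod_cases5)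
    from rel show ?thesis
    proof cases
      case (base p q \<gamma> a x p' q' \<gamma>' a' x')
      with nb show ?thesis by (auto simp: g0)
    next
      case (equivariant p q \<gamma> a y \<alpha> \<beta>)
      then have e: "p0 = p" "q0 = q" "\<gamma>0 = \<gamma> \<circ> block_sum p \<alpha> \<beta>" "a0 = a" "y = u q x0"
        by (auto simp: g0)
      have "(p, q, \<gamma>, a, x0) \<in> smash_gens sphere_bar X m k"
        using g equivariant(3) by (auto simp: g0 e smash_gens_def)
      from smash_rel.equivariant[OF this equivariant(4,5)]
      have "smash_rel sphere_bar X m k g (p, q, \<gamma>, sph_act \<alpha> a, symact X q \<beta> k x0)"
        by (simp add: g0 e)
      moreover have "gmap u (p, q, \<gamma>, sph_act \<alpha> a, symact X q \<beta> k x0) = h"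
        using equivariant u g by (simp add: e g0 slice_map_def smash_gens_def)
      ultimately show ?thesis by (blast intro: r_into_equivclp)
    next
      case (balanced p r q \<gamma> a z y)
      then have e: "p0 = p" "q0 = r + q" "\<gamma>0 = \<gamma>" "a0 = a" "u (r + q) x0 = strmap_iter Y r q k z y"
        by (auto simp: g0)
      have x0: "x0 \<in> spx X (r + q) k" using g by (simp add: g0 e smash_gens_def)
      have "a \<noteq> None" and nb': "u (r + q) x0 \<noteq> spb Y (r + q) k" using nb by (auto simp: g0 e)
      then have "p \<noteq> 0" using sphere_bar_pos[OF balanced(5)] by simp
      then have lt: "r + q < m" using balanced(3) by simp
      have chain: "\<exists>g'. gmap u g' = h \<and> equivclp (smash_rel sphere_bar X (r + q) k) g g'"
        if "g \<in> smash_gens sphere_bar X (r + q) k" "\<not> base_gen k Y (gmap u g)"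
          "equivclp (smash_rel sphere_bar Y (r + q) k) (gmap u g) h" for g h
        using less.IH[OF lt _ that] lt less.prems(1) by simp
      obtain x' where x': "x' \<in> spx X q k" "u q x' = y" "strmap_iter X r q k z x' = x0"
        using lift_structure_map[OF chain _ x0 balanced(6,7) e(5) nb'] lt less.prems(1) by fastforce
      have "smash_rel sphere_bar X m k g
          (r + p, q, \<gamma> \<circ> block_sum (r + p) (shuffle r p) id, strmap_iter sphere_bar r p k z a, x')"
        using smash_rel.balanced[OF balanced(3-6) x'(1)] by (simp add: g0 e x'(3))
      then show ?thesis using balanced(2) x'(2) by (intro exI conjI r_into_equivclp) auto
    qed
  qed
  have backward: "\<exists>g'. gmap u g' = h \<and> equivclp (smash_rel sphere_bar X m k) g g'"
    if g: "g \<in> smash_gens sphere_bar X m k" and nb: "\<not> base_gen k Y (gmap u g)"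
      and rel: "smash_rel sphere_bar Y m k h (gmap u g)" for g h
  proof -
    obtain p0 q0 \<gamma>0 a0 x0 where g0: "g = (p0, q0, \<gamma>0, a0, x0)" by (metis prod_cases5)
    from rel show ?thesis
    proof cases
      case (base p q \<gamma> a x p' q' \<gamma>' a' x')
      with nb show ?thesis by (auto simp: g0)
    next
      case (equivariant p q \<gamma> a y \<alpha> \<beta>)
      then have e: "p0 = p" "q0 = q" "\<gamma>0 = \<gamma>" "a0 = sph_act \<alpha> a" "u q x0 = symact Y q \<beta> k y"
        by (auto simp: g0)
      have x0: "x0 \<in> spx X q k" and y: "y \<in> spx Y q k"
        using g equivariant(3) by (auto simp: g0 e smash_gens_def)
      let ?x = "symact X q (inv \<beta>) k x0"
      have x: "?x \<in> spx X q k" "symact X q \<beta> k ?x = x0"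
        using symact_in[OF X permutes_inv[OF equivariant(5)] x0] symact_inverse(2)[OF X equivariant(5) x0] by auto
      have uy: "u q ?x = y"
        using u x0 permutes_inv[OF equivariant(5)] symact_inverse(1)[OF Y equivariant(5) y]
        by (simp add: slice_map_def e)
      have "(p, q, \<gamma>, a, ?x) \<in> smash_gens sphere_bar X m k"
        using equivariant(3) x by (auto simp: smash_gens_def)
      from smash_rel.equivariant[OF this equivariant(4,5)]
      have "smash_rel sphere_bar X m k (p, q, \<gamma> \<circ> block_sum p \<alpha> \<beta>, a, ?x) g"
        by (simp add: g0 e x(2))
      then show ?thesis
        using uy equivariant(1)
        by (intro exI[of _ "(p, q, \<gamma> \<circ> block_sum p \<alpha> \<beta>, a, ?x)"] conjI) (auto intro: r_into_equivclp equivclp_sym)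
    next
      case (balanced p r q \<gamma> a z y)
      then have e: "p0 = r + p" "q0 = q" "\<gamma>0 = \<gamma> \<circ> block_sum (r + p) (shuffle r p) id"
        "a0 = strmap_iter sphere_bar r p k z a" "y = u q x0"
        by (auto simp: g0)
      have x0: "x0 \<in> spx X q k" using g by (simp add: g0 e smash_gens_def)
      have "smash_rel sphere_bar X m k (p, r + q, \<gamma>, a, strmap_iter X r q k z x0) g"
        using smash_rel.balanced[OF balanced(3-6) x0] by (simp add: g0 e)
      moreover have "gmap u (p, r + q, \<gamma>, a, strmap_iter X r q k z x0) = h"
        using slice_map_iter[OF X u balanced(6) x0] by (simp add: balanced(1) e)
      ultimately show ?thesis by (blast intro: r_into_equivclp equivclp_sym)
    qed
  qed
  from less.prems(4) show ?case
  proof (induction rule: equivclp_induct)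
    case base
    then show ?case by (intro exI[of _ g]) simp
  next
    case (step h h')
    then obtain g' where g': "gmap u g' = h" "equivclp (smash_rel sphere_bar X m k) g g'" by blast
    have "g' \<in> smash_gens sphere_bar X m k" by (rule gens_equivclp[OF X g'(2) less.prems(2)])
    moreover have "\<not> base_gen k Y (gmap u g')"
      using base_gen_equivclp[OF Y flat step(1)] less.prems(3) g'(1) by simp
    ultimately obtain g'' where "gmap u g'' = h'" "equivclp (smash_rel sphere_bar X m k) g' g''"
      using forward backward step(2) g'(1) by blast
    then show ?case using g'(2) by (blast intro: equivclp_trans)
  qed
qed

lemma gmap_reflects_equivclp:
  assumes inj: "\<And>j. j < M \<Longrightarrow> inj_on (u j) (spx X j k)"
    and g: "g \<in> smash_gens sphere_bar X M k" "h \<in> smash_gens sphere_bar X M k"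
    and rel: "equivclp (smash_rel sphere_bar Y M k) (gmap u g) (gmap u h)"
  shows "equivclp (smash_rel sphere_bar X M k) g h"
proof (cases "base_gen k Y (gmap u g)")
  case True
  have "base_gen k X g'" if "base_gen k Y (gmap u g')" "g' \<in> smash_gens sphere_bar X M k" for g'
  proof -
    obtain p q \<gamma> a x where g': "g' = (p, q, \<gamma>, a, x)" by (metis prod_cases5)
    show ?thesis
    proof (cases "a = None")
      case False
      then have "p \<noteq> 0" "p + q = M" "x \<in> spx X q k"
        using that(2) sphere_bar_pos[of a p k] by (auto simp: g' smash_gens_def)
      moreover have "u q x = u q (spb X q k)"
        using that(1) u False by (auto simp: g' slice_map_def)
      ultimately have "x = spb X q k"
        using inj_onD[OF inj] symspec_base_in[OF X] by (metis less_add_same_cancel2 neq0_conv)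
      then show ?thesis by (simp add: g')
    qed (simp add: g')
  qed
  moreover have "base_gen k Y (gmap u h)" using True base_gen_equivclp[OF Y flat rel] by simp
  ultimately show ?thesis
    using True g by (intro r_into_equivclp base_gens_related) auto
next
  case False
  from lift_chain[OF order.refl g(1) False rel]
  obtain g' where g': "gmap u g' = gmap u h" "equivclp (smash_rel sphere_bar X M k) g g'" by blast
  have "g' \<in> smash_gens sphere_bar X M k" by (rule gens_equivclp[OF X g'(2) g(1)])
  moreover obtain p q \<gamma> a x where h: "h = (p, q, \<gamma>, a, x)" by (metis prod_cases5)
  moreover from this g'(1) obtain x' where x': "g' = (p, q, \<gamma>, a, x')" "u q x' = u q x"
    by (cases g') auto
  moreover have "a \<noteq> None" using base_gen_equivclp[OF Y flat rel] False by (auto simp: h)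
  ultimately have "p \<noteq> 0" "p + q = M" "x \<in> spx X q k" "x' \<in> spx X q k"
    using g(2) sphere_bar_pos[of a p k] by (auto simp: smash_gens_def)
  then have "x' = x" using inj_onD[OF inj] x'(2) by (metis less_add_same_cancel2 neq0_conv)
  then show ?thesis using g'(2) x' h by simp
qed

end

lemma flat_cofibration_desc:
  assumes f: "is_spmap X Y f"
  shows "ppushout_desc (f m) (nu Y m) k
      (po_l (spectral_latch X m) (nu X m) (spectral_latch_map Y f m) k x) = f m k x"
    and "ppushout_desc (f m) (nu Y m) k
      (po_r (spectral_latch X m) (nu X m) (spectral_latch_map Y f m) k c) = nu Y m k c"
  using nu_natural[OF f] by (auto intro!: ppushout_desc_l ppushout_desc_r)

lemma flat_cofibration_spmap: "flat_cofibration X Y f \<Longrightarrow> is_spmap X Y f"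
  by (simp add: flat_cofibration_def)

lemma flat_cofibration_reflects_decomposable:
  assumes fc: "flat_cofibration X Y f"
  shows "reflects_decomposable k X Y (\<lambda>m. f m k) m"
  unfolding reflects_decomposable_def
proof (intro ballI impI)
  note f = flat_cofibration_spmap[OF fc]
  fix x assume x: "x \<in> spx X m k" and "decomposable k Y m (f m k x)"
  then obtain g where g: "g \<in> smash_gens sphere_bar Y m k" "f m k x = ev Y m k g"
    by (auto simp: decomposable_def)
  let ?po = "ppushout (spectral_latch X m) (level X m) (spectral_latch Y m) (nu X m) (spectral_latch_map Y f m)"
  let ?l = "po_l (spectral_latch X m) (nu X m) (spectral_latch_map Y f m) k x"
  let ?r = "po_r (spectral_latch X m) (nu X m) (spectral_latch_map Y f m) k (latch_class Y m k g)"
  have "ppushout_desc (f m) (nu Y m) k ?l = ppushout_desc (f m) (nu Y m) k ?r"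
    unfolding flat_cofibration_desc[OF f] by (simp add: g(2) nu_class[OF spmap_cod[OF f]])
  moreover have "?l \<in> simplices ?po k" "?r \<in> simplices ?po k"
    using x g(1) by (auto simp: simplices_ppushout simplices_spectral_latch)
  ultimately have "?l = ?r"
    using fc[unfolded flat_cofibration_iff[OF f]] by (blast dest: inj_onD)
  then have "x \<in> nu X m k ` simplices (spectral_latch X m) k"
    by (rule po_l_eq_po_r)
  then show "decomposable k X m x"
    unfolding simplices_spectral_latch decomposable_def image_image nu_class[OF spmap_dom[OF f]] .
qed

lemma flat_cofibration_inj:
  assumes fc: "flat_cofibration X Y f" and flat: "flat_slice k Y"
  shows "inj_on (f m k) (spx X m k)"
proof (induction m rule: less_induct)
  case (less m)
  note f = flat_cofibration_spmap[OF fc]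
  have latch_inj: "inj_on (spectral_latch_map Y f m k) (simplices (spectral_latch X m) k)"
  proof (rule inj_onI)
    fix c d assume "c \<in> simplices (spectral_latch X m) k" "d \<in> simplices (spectral_latch X m) k"
      and eq: "spectral_latch_map Y f m k c = spectral_latch_map Y f m k d"
    then obtain g h where gh: "g \<in> smash_gens sphere_bar X m k" "h \<in> smash_gens sphere_bar X m k"
      "c = latch_class X m k g" "d = latch_class X m k h"
      by (auto simp: simplices_spectral_latch)
    have "equivclp (smash_rel sphere_bar X m k) g h"
      using gmap_reflects_equivclp[OF spmap_dom[OF f] spmap_cod[OF f] flat slice_map_spmap[OF f]
          flat_cofibration_reflects_decomposable[OF fc] less.IH gh(1,2)] eq
      by (simp add: gh(3,4) spectral_latch_map_class[OF f] qclass_eq_iff)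
    then show "c = d" by (simp add: gh qclass_eq_iff)
  qed
  show ?case
  proof (rule inj_onI)
    fix x y assume xy: "x \<in> spx X m k" "y \<in> spx X m k" "f m k x = f m k y"
    let ?po = "ppushout (spectral_latch X m) (level X m) (spectral_latch Y m) (nu X m) (spectral_latch_map Y f m)"
    let ?l = "po_l (spectral_latch X m) (nu X m) (spectral_latch_map Y f m) k"
    have "ppushout_desc (f m) (nu Y m) k (?l x) = ppushout_desc (f m) (nu Y m) k (?l y)"
      using xy(3) by (simp add: flat_cofibration_desc[OF f])
    moreover have "?l x \<in> simplices ?po k" "?l y \<in> simplices ?po k"
      using xy by (auto simp: simplices_ppushout)
    ultimately have "?l x = ?l y"
      using fc[unfolded flat_cofibration_iff[OF f]] by (blast dest: inj_onD)
    then show "x = y" by (rule po_l_inj[of "spectral_latch_map Y f m" k, OF latch_inj])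
  qed
qed

lemma flat_cofibrationI:
  assumes f: "is_spmap X Y f" and flat: "\<And>k. flat_slice k Y"
    and inj: "\<And>m k. inj_on (f m k) (spx X m k)"
    and reflects: "\<And>m k. reflects_decomposable k X Y (\<lambda>m. f m k) m"
  shows "flat_cofibration X Y f"
  unfolding flat_cofibration_iff[OF f]
proof (intro allI inj_onI)
  fix m k v w
  let ?po = "ppushout (spectral_latch X m) (level X m) (spectral_latch Y m) (nu X m) (spectral_latch_map Y f m)"
  let ?l = "po_l (spectral_latch X m) (nu X m) (spectral_latch_map Y f m) k"
  let ?r = "po_r (spectral_latch X m) (nu X m) (spectral_latch_map Y f m) k"
  let ?d = "ppushout_desc (f m) (nu Y m) k"
  note d = flat_cofibration_desc[OF f] and X = spmap_dom[OF f] and Y = spmap_cod[OF f]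
  have nu_inj: "c = c'" if cc: "c \<in> simplices (spectral_latch Y m) k" "c' \<in> simplices (spectral_latch Y m) k"
    "nu Y m k c = nu Y m k c'" for c c'
  proof -
    obtain g h where "g \<in> smash_gens sphere_bar Y m k" "h \<in> smash_gens sphere_bar Y m k"
      "c = latch_class Y m k g" "c' = latch_class Y m k h"
      using cc(1,2) by (auto simp: simplices_spectral_latch)
    then show ?thesis using cc(3) flat[of k] by (auto simp: nu_class[OF Y] flat_slice_def qclass_eq_iff)
  qed
  have mixed: "?l x = ?r c" if xc: "x \<in> spx X m k" "c \<in> simplices (spectral_latch Y m) k" "f m k x = nu Y m k c" for x c
  proof -
    have "decomposable k Y m (f m k x)"
      using xc(2) unfolding xc(3) simplices_spectral_latch decomposable_def
      by (elim imageE) (simp only: nu_class[OF Y] imageI)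
    then have "decomposable k X m x" using reflects xc(1) by (auto simp: reflects_decomposable_def)
    then obtain g where g: "g \<in> smash_gens sphere_bar X m k" "x = ev X m k g"
      unfolding decomposable_def by blast
    define b where "b = latch_class X m k g"
    have b: "b \<in> simplices (spectral_latch X m) k" "x = nu X m k b"
      using g by (simp_all add: b_def simplices_spectral_latch nu_class[OF X])
    have "spectral_latch_map Y f m k b = c"
      using nu_natural[OF f b(1)] b(2) xc psset_map_in[OF is_psset_map_spectral_latch_map[OF f] b(1)]
      by (intro nu_inj) auto
    then show ?thesis using po_eq[OF b(1)] b(2) by metis
  qed
  assume "v \<in> simplices ?po k" "w \<in> simplices ?po k" "?d v = ?d w"
  then show "v = w"
  proof (elim ppushout_cases)
    fix x y assume "x \<in> spx X m k" "y \<in> spx X m k" "v = ?l x" "w = ?l y" "?d v = ?d w"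
    then show ?thesis using inj_onD[OF inj, of m k x y] by (simp add: d)
  next
    fix x c assume "x \<in> spx X m k" "c \<in> simplices (spectral_latch Y m) k" "v = ?l x" "w = ?r c" "?d v = ?d w"
    then show ?thesis using mixed by (simp add: d)
  next
    fix c x assume "x \<in> spx X m k" "c \<in> simplices (spectral_latch Y m) k" "v = ?r c" "w = ?l x" "?d v = ?d w"
    then show ?thesis using mixed[of x c] by (simp add: d)
  next
    fix c c' assume "c \<in> simplices (spectral_latch Y m) k" "c' \<in> simplices (spectral_latch Y m) k"
      "v = ?r c" "w = ?r c'" "?d v = ?d w"
    then show ?thesis using nu_inj[of c c'] by (simp add: d)
  qed
qed

lemma flat_cofibrant_slice:
  assumes "flat_cofibrant Y"
  shows "flat_slice k Y"
  unfolding flat_slice_def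
proof (intro allI ballI impI)
  let ?f = "\<lambda>m k _. spb Y m k" and ?Z = zero_spectrum
  have fc: "flat_cofibration ?Z Y ?f" using assms by (simp add: flat_cofibrant_def)
  note f = flat_cofibration_spmap[OF fc]
  note Y = spmap_cod[OF f] and Z = spmap_dom[OF f]
  fix m g h assume gh: "g \<in> smash_gens sphere_bar Y m k" "h \<in> smash_gens sphere_bar Y m k" "ev Y m k g = ev Y m k h"
  let ?po = "ppushout (spectral_latch ?Z m) (level ?Z m) (spectral_latch Y m) (nu ?Z m) (spectral_latch_map Y ?f m)"
  let ?r = "po_r (spectral_latch ?Z m) (nu ?Z m) (spectral_latch_map Y ?f m) k"
  have "ppushout_desc (?f m) (nu Y m) k (?r (latch_class Y m k g)) = ppushout_desc (?f m) (nu Y m) k (?r (latch_class Y m k h))"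
    using gh(3) by (simp add: flat_cofibration_desc[OF f] nu_class[OF Y])
  moreover have "?r (latch_class Y m k g) \<in> simplices ?po k" "?r (latch_class Y m k h) \<in> simplices ?po k"
    using gh by (auto simp: simplices_ppushout simplices_spectral_latch)
  ultimately have eq: "?r (latch_class Y m k g) = ?r (latch_class Y m k h)"
    using fc[unfolded flat_cofibration_iff[OF f]] by (blast dest: inj_onD)
  have base: "base_gen k ?Z g" for g by (cases g) simp
  have "inj_on (nu ?Z m k) (simplices (spectral_latch ?Z m) k)"
    unfolding simplices_spectral_latch
    by (intro inj_onI, elim imageE) (simp only: qclass_eq_iff base r_into_equivclp base_gens_related)
  from po_r_inj[OF this eq] show "equivclp (smash_rel sphere_bar Y m k) g h"
    by (simp add: qclass_eq_iff)
qed

lemma flat_slice_retract: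
  assumes X: "is_symspec X" and Y: "is_symspec Y" and flat: "flat_slice k X"
    and r: "slice_map k Y X r" and s: "slice_map k X Y s"
    and sr: "\<And>m y. y \<in> spx Y m k \<Longrightarrow> s m (r m y) = y"
  shows "flat_slice k Y"
  unfolding flat_slice_def
proof (intro allI ballI impI)
  fix m g h assume gh: "g \<in> smash_gens sphere_bar Y m k" "h \<in> smash_gens sphere_bar Y m k" "ev Y m k g = ev Y m k h"
  have "ev X m k (gmap r g) = ev X m k (gmap r h)"
    using ev_gmap[OF Y r] gh by simp
  then have "equivclp (smash_rel sphere_bar X m k) (gmap r g) (gmap r h)"
    using flat gmap_gens[OF r] gh(1,2) by (auto simp: flat_slice_def)
  then have "equivclp (smash_rel sphere_bar Y m k) (gmap s (gmap r g)) (gmap s (gmap r h))"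
    by (rule equivclp_gmap[OF X s])
  moreover have "gmap s (gmap r g) = g" "gmap s (gmap r h) = h"
    using gh(1,2) sr by (auto simp: smash_gens_def)
  ultimately show "equivclp (smash_rel sphere_bar Y m k) g h" by simp
qed

section \<open>Simplicial identities and latching objects\<close>

declare One_nat_def [simp del]

lemma
  assumes X: "is_simpspec X"
  shows sop_spmap: "\<theta> \<in> simp_op a b \<Longrightarrow> is_spmap (obj X b) (obj X a) (sop X a b \<theta>)"
    and sop_id: "x \<in> spx (obj X a) m k \<Longrightarrow> sop X a a (\<lambda>i\<in>{..a}. i) m k x = x"
    and sop_comp: "\<phi> \<in> simp_op a b \<Longrightarrow> \<theta> \<in> simp_op b c \<Longrightarrow> x \<in> spx (obj X c) m k \<Longrightarrow>
      sop X a b \<phi> m k (sop X b c \<theta> m k x) = sop X a c (compose {..a} \<theta> \<phi>) m k x"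
  using X unfolding is_simpspec_def by simp_all

lemma obj_symspec: "is_simpspec X \<Longrightarrow> is_symspec (obj X n)"
  using spmap_dom[OF sop_spmap[OF _ simp_op_id]] by blast

lemma
  assumes f: "is_simpspec_map X Y f"
  shows simpspec_map_dom: "is_simpspec X" and simpspec_map_cod: "is_simpspec Y"
    and simpspec_map_level: "is_spmap (obj X n) (obj Y n) (f n)"
    and simpspec_map_sop: "\<theta> \<in> simp_op a b \<Longrightarrow> x \<in> spx (obj X b) m k \<Longrightarrow>
      f a m k (sop X a b \<theta> m k x) = sop Y a b \<theta> m k (f b m k x)"
  using f unfolding is_simpspec_map_def by blast+

definition deg_op :: "nat \<Rightarrow> nat \<Rightarrow> nat \<Rightarrow> nat" where
  "deg_op n i = (\<lambda>j\<in>{..Suc n}. if j \<le> i then j else j - 1)"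

definition face_op :: "nat \<Rightarrow> nat \<Rightarrow> nat \<Rightarrow> nat" where
  "face_op n i = (\<lambda>j\<in>{..n}. if j < i then j else Suc j)"

definition face :: "'a simpspec \<Rightarrow> nat \<Rightarrow> nat \<Rightarrow> ('a, 'a) spmap" where
  "face X n i = sop X n (Suc n) (face_op n i)"

lemma degen_eq: "degen X n i = sop X (Suc n) n (deg_op n i)"
  by (simp add: degen_def deg_op_def)

lemma deg_op_in: "i \<le> n \<Longrightarrow> deg_op n i \<in> simp_op (Suc n) n"
  by (auto simp: deg_op_def simp_op_def mono_on_def)

lemma face_op_in: "face_op n i \<in> simp_op n (Suc n)"
  by (auto simp: face_op_def simp_op_def mono_on_def)

lemma compose_deg_face:
  assumes "t = i \<or> t = Suc i" "i \<le> n"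
  shows "compose {..n} (deg_op n i) (face_op n t) = (\<lambda>j\<in>{..n}. j)"
  using assms by (auto simp: deg_op_def face_op_def compose_def fun_eq_iff)

lemma compose_deg_face_commute:
  assumes "i < j" "j \<le> Suc n"
  shows "compose {..Suc n} (deg_op (Suc n) i) (face_op (Suc n) (Suc j)) =
    compose {..Suc n} (face_op n j) (deg_op n i)"
  using assms by (auto simp: deg_op_def face_op_def compose_def fun_eq_iff)

lemma compose_deg_deg:
  assumes "i < j" "j \<le> Suc n"
  shows "compose {..Suc (Suc n)} (deg_op n i) (deg_op (Suc n) j) =
    compose {..Suc (Suc n)} (deg_op n (j - 1)) (deg_op (Suc n) i)"
  using assms by (auto simp: deg_op_def compose_def fun_eq_iff)

context
  fixes X :: "'a simpspec"
  assumes X: "is_simpspec X"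
begin

lemma degen_spmap: "i \<le> n \<Longrightarrow> is_spmap (obj X n) (obj X (Suc n)) (degen X n i)"
  unfolding degen_eq by (rule sop_spmap[OF X deg_op_in])

lemma degen_in: "i \<le> n \<Longrightarrow> x \<in> spx (obj X n) m k \<Longrightarrow> degen X n i m k x \<in> spx (obj X (Suc n)) m k"
  by (rule spmap_in[OF degen_spmap])

lemma face_spmap: "is_spmap (obj X (Suc n)) (obj X n) (face X n i)"
  unfolding face_def by (rule sop_spmap[OF X face_op_in])

lemma face_in: "x \<in> spx (obj X (Suc n)) m k \<Longrightarrow> face X n i m k x \<in> spx (obj X n) m k"
  by (rule spmap_in[OF face_spmap])

lemma face_degen:
  assumes "t = i \<or> t = Suc i" "i \<le> n" "x \<in> spx (obj X n) m k"
  shows "face X n t m k (degen X n i m k x) = x"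
  unfolding face_def degen_eq
  using sop_comp[OF X face_op_in deg_op_in[OF assms(2)] assms(3)] compose_deg_face[OF assms(1,2)]
    sop_id[OF X assms(3)] by simp

lemma face_degen_commute:
  assumes "i < j" "j \<le> Suc n" "x \<in> spx (obj X (Suc n)) m k"
  shows "face X (Suc n) (Suc j) m k (degen X (Suc n) i m k x) = degen X n i m k (face X n j m k x)"
  unfolding face_def degen_eq
  using sop_comp[OF X face_op_in deg_op_in[of i "Suc n"] assms(3)]
    sop_comp[OF X deg_op_in[of i n] face_op_in assms(3)] compose_deg_face_commute[OF assms(1,2)] assms(1,2)
  by simp

lemma degen_degen:
  assumes "i < j" "j \<le> Suc n" "x \<in> spx (obj X n) m k"
  shows "degen X (Suc n) j m k (degen X n i m k x) = degen X (Suc n) i m k (degen X n (j - 1) m k x)"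
  unfolding degen_eq
  using sop_comp[OF X deg_op_in[of j "Suc n"] deg_op_in[of i n] assms(3)]
    sop_comp[OF X deg_op_in[of i "Suc n"] deg_op_in[of "j - 1" n] assms(3)] compose_deg_deg[OF assms(1,2)] assms(1,2)
  by simp

lemma degen_eq_degen:
  assumes ij: "i < j" "j \<le> n" and x: "x \<in> spx (obj X n) m k" and y: "y \<in> spx (obj X n) m k"
    and eq: "degen X n i m k x = degen X n j m k y"
  obtains n' z where "n = Suc n'" "z \<in> spx (obj X n') m k" "y = degen X n' i m k z" "x = degen X n' (j - 1) m k z"
proof -
  obtain n' where n: "n = Suc n'" using ij by (cases n) auto
  let ?z = "face X n' j m k x"
  have z: "?z \<in> spx (obj X n') m k" using x by (simp add: n face_in)
  have y': "y = degen X n' i m k ?z"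
    using face_degen[of "Suc j" j n y m k] face_degen_commute[of i j n' x m k] eq ij x y by (simp add: n)
  have "degen X n i m k x = degen X n i m k (degen X n' (j - 1) m k ?z)"
    by (subst eq, subst y') (use degen_degen[of i j n' ?z m k] z ij in \<open>simp add: n\<close>)
  moreover have "degen X n' (j - 1) m k ?z \<in> spx (obj X n) m k"
    using degen_in[of "j - 1" n' ?z] z ij by (simp add: n)
  moreover have "i \<le> n" using ij by simp
  ultimately have "x = degen X n' (j - 1) m k ?z"
    using face_degen[of i i n] x by metis
  then show ?thesis using that n z y' by blast
qed

lemma degen_spmap_pred:
  assumes "i < n"
  shows "is_spmap (obj X (n - 1)) (obj X n) (degen X (n - 1) i)"
  using degen_spmap[of i "n - 1"] assms by simp

lemma degen_spmap_rels:
  assumes "i < j" "j < n"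
  shows "is_spmap (obj X (n - 2)) (obj X (n - 1)) (degen X (n - 2) i)"
    "is_spmap (obj X (n - 2)) (obj X (n - 1)) (degen X (n - 2) (j - 1))"
proof -
  have "n - 1 = Suc (n - 2)" using assms by simp
  then show "is_spmap (obj X (n - 2)) (obj X (n - 1)) (degen X (n - 2) i)"
    "is_spmap (obj X (n - 2)) (obj X (n - 1)) (degen X (n - 2) (j - 1))"
    using degen_spmap[of i "n - 2"] degen_spmap[of "j - 1" "n - 2"] assms by simp_all
qed

lemma latch_S1_spmap: "is_spmap (latch_rels X n) (latch_gens X n) (latch_S1 X n)"
  unfolding latch_rels_def latch_gens_def latch_S1_def
  by (rule is_spmap_sp_coprod_map) (auto intro: degen_spmap_rels obj_symspec[OF X])

lemma latch_S2_spmap: "is_spmap (latch_rels X n) (latch_gens X n) (latch_S2 X n)"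
  unfolding latch_rels_def latch_gens_def latch_S2_def
  by (rule is_spmap_sp_coprod_map) (auto intro: degen_spmap_rels obj_symspec[OF X])

end

definition latch_in :: "'a simpspec \<Rightarrow> nat \<Rightarrow> nat \<Rightarrow> ('a, (nat \<times> 'a) option set) spmap" where
  "latch_in X n i m k x = sp_proj (latch_rels X n) (latch_S1 X n) (latch_S2 X n) m k
     (sp_in (\<lambda>_. obj X (n - 1)) i m k x)"

lemma latch_rels_cases:
  assumes "a \<in> spx (latch_rels X n) m k"
  obtains "a = None"
    | i j x where "i < j" "j < n" "x \<in> spx (obj X (n - 2)) m k" "a = sp_in (\<lambda>_. obj X (n - 2)) (i, j) m k x"
  using assms unfolding latch_rels_def by (auto elim!: sp_coprod_cases)

context
  fixes X :: "'a simpspec"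
  assumes X: "is_simpspec X"
begin

lemmas latch_S = latch_S1_spmap[OF X] latch_S2_spmap[OF X]

lemma simp_latch_symspec: "is_symspec (simp_latch X n)"
  unfolding simp_latch_def by (rule is_symspec_sp_coeq[OF latch_S])

lemma simp_latch_cases:
  assumes "c \<in> spx (simp_latch X n) m k"
  obtains "c = spb (simp_latch X n) m k" | i x where "i < n" "x \<in> spx (obj X (n - 1)) m k" "c = latch_in X n i m k x"
proof -
  obtain z where z: "z \<in> spx (latch_gens X n) m k"
    "c = sp_proj (latch_rels X n) (latch_S1 X n) (latch_S2 X n) m k z"
    using assms by (auto simp: simp_latch_def simplices_sp_coeq)
  have None: "sp_proj (latch_rels X n) (latch_S1 X n) (latch_S2 X n) m k None = spb (simp_latch X n) m k"
    using spmap_base[OF is_spmap_sp_proj[OF latch_S], of n m k] by (simp add: latch_gens_def simp_latch_def)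
  from z(1) show ?thesis
    unfolding latch_gens_def
    by (cases rule: sp_coprod_cases) (use that None z(2) in \<open>auto simp: latch_in_def\<close>)
qed

lemma latch_in_spmap:
  assumes "i < n"
  shows "is_spmap (obj X (n - 1)) (simp_latch X n) (latch_in X n i)"
  unfolding latch_in_def[abs_def] simp_latch_def
  by (rule is_spmap_comp[OF _ is_spmap_sp_proj[OF latch_S]])
    (use assms is_spmap_sp_in[of "{..<n}" "\<lambda>_. obj X (n - 1)" i] in \<open>simp add: latch_gens_def obj_symspec[OF X]\<close>)

lemma latch_S_in:
  assumes "i < j" "j < n"
  shows "latch_S1 X n m k (sp_in (\<lambda>_. obj X (n - 2)) (i, j) m k x) =
      sp_in (\<lambda>_. obj X (n - 1)) j m k (degen X (n - 2) i m k x)"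
    and "latch_S2 X n m k (sp_in (\<lambda>_. obj X (n - 2)) (i, j) m k x) =
      sp_in (\<lambda>_. obj X (n - 1)) i m k (degen X (n - 2) (j - 1) m k x)"
  unfolding latch_S1_def latch_S2_def using degen_spmap_rels[OF X assms]
  by (simp_all add: sp_coprod_map_sp_in[where X = "\<lambda>_. obj X (n - 2)"])

lemma latch_in_eq:
  assumes "i < j" "j < n" "x \<in> spx (obj X (n - 2)) m k"
  shows "latch_in X n j m k (degen X (n - 2) i m k x) = latch_in X n i m k (degen X (n - 2) (j - 1) m k x)"
proof -
  have "sp_in (\<lambda>_. obj X (n - 2)) (i, j) m k x \<in> spx (latch_rels X n) m k"
    unfolding latch_rels_def
    by (rule spmap_in[OF is_spmap_sp_in[of _ "\<lambda>_. obj X (n - 2)"]]) (use assms obj_symspec[OF X] in auto)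
  from sp_proj_eq[OF this, of "latch_S1 X n" "latch_S2 X n"] show ?thesis
    by (simp add: latch_in_def latch_S_in[OF assms(1,2)])
qed

lemma latch_in_cong:
  assumes "i < n" "j < n" and x: "x \<in> spx (obj X (n - 1)) m k" and y: "y \<in> spx (obj X (n - 1)) m k"
    and eq: "degen X (n - 1) i m k x = degen X (n - 1) j m k y"
  shows "latch_in X n i m k x = latch_in X n j m k y"
proof -
  have *: "latch_in X n i m k x = latch_in X n j m k y"
    if lt: "i < j" "j < n" and xy: "x \<in> spx (obj X (n - 1)) m k" "y \<in> spx (obj X (n - 1)) m k"
      "degen X (n - 1) i m k x = degen X (n - 1) j m k y" for i j x y
  proof -
    obtain n' z where z: "n - 1 = Suc n'" "z \<in> spx (obj X n') m k" "y = degen X n' i m k z"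
      "x = degen X n' (j - 1) m k z"
      by (rule degen_eq_degen[OF X lt(1) _ xy]) (use lt(2) in simp)
    then have "n' = n - 2" by simp
    with z show ?thesis using latch_in_eq[OF lt, of z] by simp
  qed
  show ?thesis
  proof (cases i j rule: linorder_cases)
    case equal
    have "i \<le> n - 1" using assms by simp
    then have "x = y" using face_degen[OF X, of i i "n - 1"] x y eq equal by metis
    with equal show ?thesis by simp
  next
    case less
    show ?thesis by (rule *[OF less \<open>j < n\<close> x y eq])
  next
    case greater
    show ?thesis by (rule *[OF greater \<open>i < n\<close> y x eq[symmetric], symmetric])
  qed
qed

lemma latching_gens_map_eq:
  assumes "a \<in> spx (latch_rels X n) m k"
  shows "sp_coprod_desc (obj X n) (\<lambda>k. degen X (n - 1) k) m k (latch_S1 X n m k a) =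
    sp_coprod_desc (obj X n) (\<lambda>k. degen X (n - 1) k) m k (latch_S2 X n m k a)"
  using assms
proof (cases rule: latch_rels_cases)
  case (2 i j x)
  have "n = Suc (Suc (n - 2))" using 2(1,2) by simp
  then obtain n' where n: "n = Suc (Suc n')" by blast
  have d: "is_spmap (obj X (n - 1)) (obj X n) (degen X (n - 1) l)" if "l < n" for l
    using degen_spmap_pred[OF X] that by simp
  show ?thesis
    using 2 d[of i] d[of j] degen_degen[OF X, of i j n' x m k]
    by (simp add: latch_S_in sp_coprod_desc_sp_in[where X = "\<lambda>_. obj X (n - 1)"]) (simp add: n)
qed (simp add: latch_S1_def latch_S2_def)

lemma latching_map_in:
  assumes "i < n"
  shows "latching_map X n m k (latch_in X n i m k x) = degen X (n - 1) i m k x"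
  unfolding latching_map_def latch_in_def
  using degen_spmap_pred[OF X assms] assms latching_gens_map_eq
  by (subst sp_coeq_desc_proj) (auto simp: sp_coprod_desc_sp_in[where X = "\<lambda>_. obj X (n - 1)"])

lemma latching_map_spmap: "is_spmap (simp_latch X n) (obj X n) (latching_map X n)"
  unfolding simp_latch_def
proof (rule is_spmap_sp_coeq[OF latch_S])
  show "is_spmap (latch_gens X n) (obj X n) (sp_coprod_desc (obj X n) (\<lambda>k. degen X (n - 1) k))"
    unfolding latch_gens_def
    by (rule is_spmap_sp_coprod_desc) (auto intro: degen_spmap_pred[OF X] obj_symspec[OF X])
  show "latching_map X n m k (sp_proj (latch_rels X n) (latch_S1 X n) (latch_S2 X n) m k x) =
    sp_coprod_desc (obj X n) (\<lambda>k. degen X (n - 1) k) m k x" for m k x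
    unfolding latching_map_def by (rule sp_coeq_desc_proj) (rule latching_gens_map_eq)
qed

end

context
  fixes X :: "'a simpspec" and Y :: "'b simpspec" and f :: "nat \<Rightarrow> ('a, 'b) spmap"
  assumes f: "is_simpspec_map X Y f"
begin

lemma simpspec_map_degen:
  "i \<le> n \<Longrightarrow> x \<in> spx (obj X n) m k \<Longrightarrow> f (Suc n) m k (degen X n i m k x) = degen Y n i m k (f n m k x)"
  unfolding degen_eq by (rule simpspec_map_sop[OF f deg_op_in])

lemma simpspec_map_face:
  "x \<in> spx (obj X (Suc n)) m k \<Longrightarrow> f n m k (face X n i m k x) = face Y n i m k (f (Suc n) m k x)"
  unfolding face_def by (rule simpspec_map_sop[OF f face_op_in])

lemma latch_gens_map:
  "sp_coprod_map (\<lambda>_. obj Y (n - 1)) (\<lambda>k. k) (\<lambda>_. f (n - 1)) m k (sp_in (\<lambda>_. obj X (n - 1)) i m k x) =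
    sp_in (\<lambda>_. obj Y (n - 1)) i m k (f (n - 1) m k x)"
  by (rule sp_coprod_map_sp_in[where Y = "\<lambda>_. obj Y (n - 1)" and u = "\<lambda>k. k" and h = "\<lambda>_. f (n - 1)"])
    (rule simpspec_map_level[OF f])

lemma simp_latch_map_proj:
  "simp_latch_map Y f n m k (sp_proj (latch_rels X n) (latch_S1 X n) (latch_S2 X n) m k z) =
    sp_proj (latch_rels Y n) (latch_S1 Y n) (latch_S2 Y n) m k
      (sp_coprod_map (\<lambda>_. obj Y (n - 1)) (\<lambda>k. k) (\<lambda>_. f (n - 1)) m k z)"
  unfolding simp_latch_map_def
proof (rule sp_coeq_map_proj)
  note X = simpspec_map_dom[OF f] and Y = simpspec_map_cod[OF f]
  let ?P = "sp_proj (latch_rels Y n) (latch_S1 Y n) (latch_S2 Y n) m k"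
  let ?F = "sp_coprod_map (\<lambda>_. obj Y (n - 1)) (\<lambda>k. k) (\<lambda>_. f (n - 1)) m k"
  fix a assume "a \<in> spx (latch_rels X n) m k"
  then show "?P (?F (latch_S1 X n m k a)) = ?P (?F (latch_S2 X n m k a))"
  proof (cases rule: latch_rels_cases)
    case (2 i j x)
    have e: "n - 1 = Suc (n - 2)" using 2 by simp
    have "f (n - 1) m k (degen X (n - 2) l m k x) = degen Y (n - 2) l m k (f (n - 2) m k x)" if "l \<le> n - 2" for l
      unfolding e by (rule simpspec_map_degen[OF that 2(3)])
    moreover have "f (n - 2) m k x \<in> spx (obj Y (n - 2)) m k"
      by (rule spmap_in[OF simpspec_map_level[OF f] 2(3)])
    ultimately show ?thesis
      using latch_in_eq[OF Y 2(1,2), of "f (n - 2) m k x" m k] 2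
      by (simp add: latch_S_in[OF X] latch_gens_map latch_in_def)
  qed (simp add: latch_S1_def latch_S2_def)
qed

lemma simp_latch_map_in: "simp_latch_map Y f n m k (latch_in X n i m k x) = latch_in Y n i m k (f (n - 1) m k x)"
  by (simp add: latch_in_def simp_latch_map_proj latch_gens_map)

lemma simp_latch_map_spmap: "is_spmap (simp_latch X n) (simp_latch Y n) (simp_latch_map Y f n)"
  unfolding simp_latch_def[of X]
proof (rule is_spmap_sp_coeq[OF latch_S[OF simpspec_map_dom[OF f]]])
  note Y = simpspec_map_cod[OF f]
  have F: "is_spmap (latch_gens X n) (latch_gens Y n) (sp_coprod_map (\<lambda>_. obj Y (n - 1)) (\<lambda>k. k) (\<lambda>_. f (n - 1)))"
    unfolding latch_gens_def
    by (rule is_spmap_sp_coprod_map) (auto intro: simpspec_map_level[OF f] obj_symspec[OF Y])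
  show "is_spmap (latch_gens X n) (simp_latch Y n) (\<lambda>m k z. sp_proj (latch_rels Y n) (latch_S1 Y n) (latch_S2 Y n) m k
      (sp_coprod_map (\<lambda>_. obj Y (n - 1)) (\<lambda>k. k) (\<lambda>_. f (n - 1)) m k z))"
    unfolding simp_latch_def by (rule is_spmap_comp[OF F is_spmap_sp_proj[OF latch_S[OF Y]]])
qed (rule simp_latch_map_proj)

lemma latching_map_natural:
  assumes "c \<in> spx (simp_latch X n) m k"
  shows "f n m k (latching_map X n m k c) = latching_map Y n m k (simp_latch_map Y f n m k c)"
proof -
  note X = simpspec_map_dom[OF f] and Y = simpspec_map_cod[OF f]
  from assms show ?thesis
  proof (cases rule: simp_latch_cases[OF X, consumes 1])
    case 1
    show ?thesis
      unfolding 1 spmap_base[OF latching_map_spmap[OF X]] spmap_base[OF simp_latch_map_spmap]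
        spmap_base[OF latching_map_spmap[OF Y]] spmap_base[OF simpspec_map_level[OF f]] ..
  next
    case (2 i x)
    then show ?thesis
      using simpspec_map_degen[of i "n - 1" x]
      by (simp add: latching_map_in[OF X] latching_map_in[OF Y] simp_latch_map_in)
  qed
qed

lemma latching_corner_map_spmap:
  "is_spmap (latching_corner X Y f n) (obj Y n) (latching_corner_map Y f n)"
  unfolding latching_corner_def latching_corner_map_def
  by (rule is_spmap_sp_pushout_desc[OF latching_map_spmap[OF simpspec_map_dom[OF f]] simp_latch_map_spmap
      simpspec_map_level[OF f] latching_map_spmap[OF simpspec_map_cod[OF f]] latching_map_natural])

abbreviation corner_inl :: "nat \<Rightarrow> ('a, ('a + (nat \<times> 'b) option set) set) spmap" where
  "corner_inl n \<equiv> sp_inl (simp_latch X n) (latching_map X n) (simp_latch_map Y f n)"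

abbreviation corner_inr :: "nat \<Rightarrow> ((nat \<times> 'b) option set, ('a + (nat \<times> 'b) option set) set) spmap" where
  "corner_inr n \<equiv> sp_inr (simp_latch X n) (latching_map X n) (simp_latch_map Y f n)"

lemma latching_corner_map_in:
  "latching_corner_map Y f n m k (corner_inl n m k x) = f n m k x"
  "latching_corner_map Y f n m k (corner_inr n m k c) = latching_map Y n m k c"
  unfolding latching_corner_map_def
  by (rule sp_pushout_desc_in[OF latching_map_spmap[OF simpspec_map_dom[OF f]] simp_latch_map_spmap,
      where u = "f n" and v = "latching_map Y n", OF latching_map_natural], assumption)+

lemma latching_corner_cases:
  assumes "v \<in> spx (latching_corner X Y f n) m k"
  obtains x where "x \<in> spx (obj X n) m k" "v = corner_inl n m k x"
    | i y where "i < n" "y \<in> spx (obj Y (n - 1)) m k" "v = corner_inr n m k (latch_in Y n i m k y)"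
proof -
  note X = simpspec_map_dom[OF f] and Y = simpspec_map_cod[OF f]
  note po = latching_map_spmap[OF X, of n] simp_latch_map_spmap[of n]
  from assms show ?thesis
    unfolding latching_corner_def
  proof (cases rule: sp_pushout_cases[OF po, consumes 1])
    case (2 c)
    from 2(1) show ?thesis
    proof (cases rule: simp_latch_cases[OF Y, consumes 1])
      case 1
      have "v = corner_inl n m k (spb (obj X n) m k)"
        using pre_spmap_base[OF pre_spmap_sp_inr[OF po]] pre_spmap_base[OF pre_spmap_sp_inl[OF po]]
        by (simp add: 2 1)
      then show ?thesis using that(1) symspec_base_in[OF obj_symspec[OF X]] by blast
    qed (use that(2) 2(2) in auto)
  qed (use that(1) in auto)
qed

lemma latching_corner_map_inj:
  assumes inj: "inj_on (f n m k) (spx (obj X n) m k)"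
  shows "inj_on (latching_corner_map Y f n m k) (spx (latching_corner X Y f n) m k)"
proof (rule inj_onI)
  note X = simpspec_map_dom[OF f] and Y = simpspec_map_cod[OF f]
  note po = latching_map_spmap[OF X, of n] simp_latch_map_spmap[of n]
  have mixed: "corner_inl n m k x = corner_inr n m k (latch_in Y n i m k y)"
    if x: "x \<in> spx (obj X n) m k" and i: "i < n" and y: "y \<in> spx (obj Y (n - 1)) m k"
      and eq: "f n m k x = degen Y (n - 1) i m k y" for x i y
  proof -
    have n: "Suc (n - 1) = n" and i': "i \<le> n - 1" using i by simp_all
    let ?x = "face X (n - 1) i m k x"
    have x': "?x \<in> spx (obj X (n - 1)) m k" using face_in[OF X, of x "n - 1"] x n by simp
    have fx: "f (n - 1) m k ?x = y"
      using simpspec_map_face[of x "n - 1" m k i] face_degen[OF Y _ i' y, of i] x eq n by simp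
    have "degen X (n - 1) i m k ?x \<in> spx (obj X n) m k" using degen_in[OF X i' x'] n by simp
    moreover have "f n m k (degen X (n - 1) i m k ?x) = f n m k x"
      using simpspec_map_degen[OF i' x'] fx eq n by simp
    ultimately have "latching_map X n m k (latch_in X n i m k ?x) = x"
      using inj x by (simp add: latching_map_in[OF X i] inj_on_eq_iff)
    moreover have "simp_latch_map Y f n m k (latch_in X n i m k ?x) = latch_in Y n i m k y"
      by (simp add: simp_latch_map_in fx)
    ultimately show ?thesis
      using sp_pushout_eq[OF po spmap_in[OF latch_in_spmap[OF X i] x']] by simp
  qed
  fix v w assume "v \<in> spx (latching_corner X Y f n) m k" "w \<in> spx (latching_corner X Y f n) m k"
    and "latching_corner_map Y f n m k v = latching_corner_map Y f n m k w"
  then show "v = w"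
  proof (elim latching_corner_cases, goal_cases)
    case (1 x x')
    then have "x = x'" using inj by (simp add: latching_corner_map_in inj_on_eq_iff)
    then show ?thesis using 1 by simp
  next
    case (2 x i y)
    then show ?thesis using mixed[of x i y] by (simp add: latching_corner_map_in latching_map_in[OF Y])
  next
    case (3 i y x)
    then show ?thesis using mixed[of x i y] by (simp add: latching_corner_map_in latching_map_in[OF Y])
  next
    case (4 i y j y')
    then show ?thesis using latch_in_cong[OF Y, of i n j y m k y'] by (simp add: latching_corner_map_in latching_map_in[OF Y])
  qed
qed

lemma latching_corner_map_reflects_decomposable:
  assumes refl: "reflects_decomposable k (obj X n) (obj Y n) (\<lambda>m. f n m k) m"
  shows "reflects_decomposable k (latching_corner X Y f n) (obj Y n) (\<lambda>m. latching_corner_map Y f n m k) m"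
  unfolding reflects_decomposable_def
proof (intro ballI impI)
  note X = simpspec_map_dom[OF f] and Y = simpspec_map_cod[OF f]
  note po = latching_map_spmap[OF X, of n] simp_latch_map_spmap[of n]
  have inl: "is_spmap (obj X n) (latching_corner X Y f n) (corner_inl n)"
    and inr: "is_spmap (simp_latch Y n) (latching_corner X Y f n) (corner_inr n)"
    unfolding latching_corner_def
    by (simp_all add: is_spmap_iff is_symspec_sp_pushout[OF po] pre_spmap_sp_inl[OF po] pre_spmap_sp_inr[OF po]
      obj_symspec[OF X] simp_latch_symspec[OF Y])
  fix v assume "v \<in> spx (latching_corner X Y f n) m k"
    and dec: "decomposable k (obj Y n) m (latching_corner_map Y f n m k v)"
  from this(1) show "decomposable k (latching_corner X Y f n) m v"
  proof (cases rule: latching_corner_cases)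
    case (1 x)
    then have "decomposable k (obj X n) m x"
      using refl dec by (simp add: latching_corner_map_in reflects_decomposable_def)
    then show ?thesis
      using decomposable_image[OF obj_symspec[OF X] slice_map_spmap[OF inl]] by (simp add: 1)
  next
    case (2 i y)
    then have n: "Suc (n - 1) = n" and i: "i \<le> n - 1" by simp_all
    have "decomposable k (obj Y n) m (degen Y (n - 1) i m k y)"
      using dec 2 by (simp add: latching_corner_map_in latching_map_in[OF Y])
    moreover have face: "is_spmap (obj Y n) (obj Y (n - 1)) (face Y (n - 1) i)"
      using face_spmap[OF Y, of "n - 1" i] n by simp
    ultimately have "decomposable k (obj Y (n - 1)) m (face Y (n - 1) i m k (degen Y (n - 1) i m k y))"
      using decomposable_image[OF obj_symspec[OF Y] slice_map_spmap[OF face]] by blast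
    then have "decomposable k (obj Y (n - 1)) m y"
      using face_degen[OF Y _ i 2(2)] by simp
    then have "decomposable k (simp_latch Y n) m (latch_in Y n i m k y)"
      using decomposable_image[OF obj_symspec[OF Y] slice_map_spmap[OF latch_in_spmap[OF Y 2(1)]]] by blast
    then show ?thesis
      using decomposable_image[OF simp_latch_symspec[OF Y] slice_map_spmap[OF inr]] by (simp add: 2)
  qed
qed

end

section \<open>Geometric realization\<close>

lemma std_simplex_simps [simp]:
  "simplices (std_simplex_plus n) k = insert None (Some ` simp_op k n)"
  "basepoint (std_simplex_plus n) k = None"
  "operator (std_simplex_plus n) l k \<phi> t = map_option (\<lambda>t. compose {..l} t \<phi>) t"
  by (simp_all add: std_simplex_plus_def)

lemma is_psset_std_simplex_plus: "is_psset (std_simplex_plus n)"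
proof (rule is_pssetI)
  fix l m k \<phi> \<theta> t
  assume "\<phi> \<in> simp_op l m" "\<theta> \<in> simp_op m k" "t \<in> simplices (std_simplex_plus n) k"
  then show "operator (std_simplex_plus n) l k (compose {..l} \<theta> \<phi>) t =
    operator (std_simplex_plus n) l m \<phi> (operator (std_simplex_plus n) m k \<theta> t)"
    by (auto simp: simp_op_assoc)
qed (auto simp: simp_op_compose simp_op_id_right)

lemma is_psset_map_std_simplex_map:
  assumes "\<theta> \<in> simp_op a b"
  shows "is_psset_map (std_simplex_plus a) (std_simplex_plus b) (std_simplex_map \<theta>)"
  by (rule is_psset_mapI)
    (use assms in \<open>auto simp: is_psset_std_simplex_plus std_simplex_map_def simp_op_compose simp_op_assoc\<close>)

lemma is_psset_map_id: "is_psset K \<Longrightarrow> is_psset_map K K (\<lambda>_ t. t)"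
  by (rule is_psset_mapI) auto

abbreviation real_summand :: "'a simpspec \<Rightarrow> nat \<Rightarrow> ('a \<times> (nat \<Rightarrow> nat) option) option symspec" where
  "real_summand X n \<equiv> sp_tensor (obj X n) (std_simplex_plus n)"

abbreviation real_proj :: "'a simpspec \<Rightarrow> ((nat \<times> ('a \<times> (nat \<Rightarrow> nat) option) option) option,
    (nat \<times> ('a \<times> (nat \<Rightarrow> nat) option) option) option set) spmap" where
  "real_proj X \<equiv> sp_proj (real_rels X) (real_left X) (real_right X)"

abbreviation real_gen :: "'a simpspec \<Rightarrow> nat \<Rightarrow> nat \<Rightarrow> nat \<Rightarrow> 'a \<Rightarrow> (nat \<Rightarrow> nat) option \<Rightarrow>
    (nat \<times> ('a \<times> (nat \<Rightarrow> nat) option) option) option" where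
  "real_gen X n m k x t \<equiv> sp_in (real_summand X) n m k (tens (obj X n) (std_simplex_plus n) m k x t)"

definition real_elt :: "'a simpspec \<Rightarrow> nat \<Rightarrow> nat \<Rightarrow> nat \<Rightarrow> 'a \<Rightarrow> (nat \<Rightarrow> nat) option \<Rightarrow>
    (nat \<times> ('a \<times> (nat \<Rightarrow> nat) option) option) option set" where
  "real_elt X n m k x t = real_proj X m k (real_gen X n m k x t)"

abbreviation real_rel_summand :: "'a simpspec \<Rightarrow> nat \<times> nat \<times> (nat \<Rightarrow> nat) \<Rightarrow> ('a \<times> (nat \<Rightarrow> nat) option) option symspec" where
  "real_rel_summand X \<equiv> (\<lambda>(a, b, \<theta>). sp_tensor (obj X b) (std_simplex_plus a))"

text \<open>In degree \<open>k\<close>, the coend is \<open>X\<^sub>k\<close>: every element equals \<open>t\<^sup>* x \<and> id\<close> for a unique \<open>t\<^sup>* x\<close>.\<close>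

definition real_diag_gen :: "'a simpspec \<Rightarrow> ((nat \<times> ('a \<times> (nat \<Rightarrow> nat) option) option) option, 'a) spmap" where
  "real_diag_gen X m k z = (case z of Some (n, Some (x, Some t)) \<Rightarrow> sop X k n t m k x | _ \<Rightarrow> spb (obj X k) m k)"

definition real_diag :: "'a simpspec \<Rightarrow> nat \<Rightarrow> nat \<Rightarrow> (nat \<times> ('a \<times> (nat \<Rightarrow> nat) option) option) option set \<Rightarrow> 'a" where
  "real_diag X k m = sp_coeq_desc (real_diag_gen X) m k"

definition real_undiag :: "'a simpspec \<Rightarrow> nat \<Rightarrow> nat \<Rightarrow> 'a \<Rightarrow> (nat \<times> ('a \<times> (nat \<Rightarrow> nat) option) option) option set" where
  "real_undiag X k m x = real_elt X k m k x (Some (\<lambda>i\<in>{..k}. i))"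

context
  fixes X :: "'a simpspec"
  assumes X: "is_simpspec X"
begin

lemma real_summand_symspec: "is_symspec (real_summand X n)"
  by (rule is_symspec_sp_tensor[OF obj_symspec[OF X] is_psset_std_simplex_plus])

lemma real_rel_summand_symspec: "is_symspec (real_rel_summand X i)"
  by (cases i) (simp add: is_symspec_sp_tensor[OF obj_symspec[OF X] is_psset_std_simplex_plus])

lemma real_left_spmap: "is_spmap (real_rels X) (real_gens X) (real_left X)"
  unfolding real_rels_def real_gens_def real_left_def
proof (rule is_spmap_sp_coprod_map)
  fix i assume "i \<in> {(a, b, \<theta>). \<theta> \<in> simp_op a b}"
  then obtain a b \<theta> where i: "i = (a, b, \<theta>)" and \<theta>: "\<theta> \<in> simp_op a b" by auto
  show "is_spmap (real_rel_summand X i) (real_summand X (case i of (a, b, \<theta>) \<Rightarrow> a))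
    (case i of (a, b, \<theta>) \<Rightarrow> sp_tensor_map (obj X a) (std_simplex_plus a) (sop X a b \<theta>) (\<lambda>_ t. t))"
    unfolding i prod.case
    by (rule is_spmap_sp_tensor_map[OF sop_spmap[OF X \<theta>] is_psset_map_id[OF is_psset_std_simplex_plus]])
qed (simp_all add: real_summand_symspec)

lemma real_right_spmap: "is_spmap (real_rels X) (real_gens X) (real_right X)"
  unfolding real_rels_def real_gens_def real_right_def
proof (rule is_spmap_sp_coprod_map)
  fix i assume "i \<in> {(a, b, \<theta>). \<theta> \<in> simp_op a b}"
  then obtain a b \<theta> where i: "i = (a, b, \<theta>)" and \<theta>: "\<theta> \<in> simp_op a b" by auto
  show "is_spmap (real_rel_summand X i) (real_summand X (case i of (a, b, \<theta>) \<Rightarrow> b))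
    (case i of (a, b, \<theta>) \<Rightarrow> sp_tensor_map (obj X b) (std_simplex_plus b) (\<lambda>_ _ x. x) (std_simplex_map \<theta>))"
    unfolding i prod.case
    by (rule is_spmap_sp_tensor_map[OF is_spmap_id[OF obj_symspec[OF X]] is_psset_map_std_simplex_map[OF \<theta>]])
qed (simp_all add: real_summand_symspec)

lemmas real_LR = real_left_spmap real_right_spmap

lemma realization_symspec: "is_symspec (realization X)"
  unfolding realization_def by (rule is_symspec_sp_coeq[OF real_LR])

lemma real_summand_spmap: "is_spmap (real_summand X n) (realization X) (\<lambda>m k w. real_proj X m k (sp_in (real_summand X) n m k w))"
  unfolding realization_def
  by (rule is_spmap_comp[OF _ is_spmap_sp_proj[OF real_LR]])
    (use is_spmap_sp_in[of UNIV "real_summand X" n] in \<open>simp add: real_gens_def real_summand_symspec\<close>)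

lemma real_elt_in:
  assumes "x \<in> spx (obj X n) m k" "t = None \<or> t \<in> Some ` simp_op k n"
  shows "real_elt X n m k x t \<in> spx (realization X) m k"
  unfolding real_elt_def
  by (rule spmap_in[OF real_summand_spmap])
    (use assms in \<open>auto intro: tens_in[OF obj_symspec[OF X] is_psset_std_simplex_plus]\<close>)

lemma real_elt_base:
  "real_elt X n m k (spb (obj X n) m k) t = spb (realization X) m k"
  "real_elt X n m k x None = spb (realization X) m k"
  using spmap_base[OF real_summand_spmap[of n], of m k] tens_base(2)[of "obj X n" "std_simplex_plus n" m k x]
  by (simp_all add: real_elt_def)

lemma real_elt_symact:
  assumes "\<gamma> permutes {..<m}" "x \<in> spx (obj X n) m k" "t = None \<or> t \<in> Some ` simp_op k n"
  shows "symact (realization X) m \<gamma> k (real_elt X n m k x t) = real_elt X n m k (symact (obj X n) m \<gamma> k x) t"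
proof -
  note T = obj_symspec[OF X, of n] is_psset_std_simplex_plus[of n]
  have w: "tens (obj X n) (std_simplex_plus n) m k x t \<in> spx (real_summand X n) m k"
    by (rule tens_in[OF T]) (use assms in auto)
  show ?thesis
    unfolding real_elt_def spmap_symact[OF real_summand_spmap w assms(1), symmetric] symact_sp_tensor[OF T assms(1)] ..
qed

lemma real_elt_strmap:
  assumes "s \<in> simplices circle k" "x \<in> spx (obj X n) m k" "t = None \<or> t \<in> Some ` simp_op k n"
  shows "strmap (realization X) m k s (real_elt X n m k x t) = real_elt X n (Suc m) k (strmap (obj X n) m k s x) t"
proof -
  note T = obj_symspec[OF X, of n] is_psset_std_simplex_plus[of n]
  have w: "tens (obj X n) (std_simplex_plus n) m k x t \<in> spx (real_summand X n) m k"
    by (rule tens_in[OF T]) (use assms in auto)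
  show ?thesis
    unfolding real_elt_def spmap_strmap[OF real_summand_spmap w assms(1), symmetric] strmap_sp_tensor[OF T assms(1)] ..
qed

lemma realization_cases:
  assumes "z \<in> spx (realization X) m k"
  obtains "z = spb (realization X) m k"
    | n x t where "x \<in> spx (obj X n) m k" "t \<in> simp_op k n" "z = real_elt X n m k x (Some t)"
proof -
  obtain g where g: "g \<in> spx (real_gens X) m k" "z = real_proj X m k g"
    using assms by (auto simp: realization_def simplices_sp_coeq)
  from g(1) show ?thesis
    unfolding real_gens_def
  proof (cases rule: sp_coprod_cases)
    case 1
    then show ?thesis
      using that(1) g(2) spmap_base[OF is_spmap_sp_proj[OF real_LR], of m k]
      by (simp add: real_gens_def realization_def)
  next
    case (2 n w)
    then obtain x t where w: "w = tens (obj X n) (std_simplex_plus n) m k x t" "x \<in> spx (obj X n) m k"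
      "t = None \<or> t \<in> Some ` simp_op k n"
      using simplices_sp_tensor[OF obj_symspec[OF X] is_psset_std_simplex_plus] by auto
    then have "z = real_elt X n m k x t" by (simp add: g(2) 2 real_elt_def)
    with w that show ?thesis by (auto simp: real_elt_base)
  qed
qed

lemma real_rels_cases:
  assumes "c \<in> spx (real_rels X) m k"
  obtains "c = None"
    | a b \<theta> x t where "\<theta> \<in> simp_op a b" "x \<in> spx (obj X b) m k" "t = None \<or> t \<in> Some ` simp_op k a"
      "c = sp_in (real_rel_summand X) (a, b, \<theta>) m k (tens (obj X b) (std_simplex_plus a) m k x t)"
proof -
  from assms show ?thesis
    unfolding real_rels_def
  proof (cases rule: sp_coprod_cases)
    case (2 i w)
    then obtain a b \<theta> where i: "i = (a, b, \<theta>)" "\<theta> \<in> simp_op a b" by auto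
    then obtain x t where "w = tens (obj X b) (std_simplex_plus a) m k x t" "x \<in> spx (obj X b) m k"
      "t = None \<or> t \<in> Some ` simp_op k a"
      using 2 simplices_sp_tensor[OF obj_symspec[OF X] is_psset_std_simplex_plus] by auto
    with 2 i that(2) show ?thesis by blast
  qed (use that(1) in auto)
qed

lemma real_left_right_in:
  assumes \<theta>: "\<theta> \<in> simp_op a b"
  shows "real_left X m k (sp_in (real_rel_summand X) (a, b, \<theta>) m k (tens (obj X b) (std_simplex_plus a) m k x t)) =
      real_gen X a m k (sop X a b \<theta> m k x) t"
    and "real_right X m k (sp_in (real_rel_summand X) (a, b, \<theta>) m k (tens (obj X b) (std_simplex_plus a) m k x t)) =
      real_gen X b m k x (std_simplex_map \<theta> k t)"
proof -
  note s = sop_spmap[OF X \<theta>] and i = is_psset_map_id[OF is_psset_std_simplex_plus[of a]]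
    and j = is_spmap_id[OF obj_symspec[OF X, of b]] and g = is_psset_map_std_simplex_map[OF \<theta>]
  show "real_left X m k (sp_in (real_rel_summand X) (a, b, \<theta>) m k (tens (obj X b) (std_simplex_plus a) m k x t)) =
      real_gen X a m k (sop X a b \<theta> m k x) t"
    unfolding real_left_def
    by (subst sp_coprod_map_sp_in)
      (simp_all add: is_spmap_sp_tensor_map[OF s i] sp_tensor_map_tens[OF s i])
  show "real_right X m k (sp_in (real_rel_summand X) (a, b, \<theta>) m k (tens (obj X b) (std_simplex_plus a) m k x t)) =
      real_gen X b m k x (std_simplex_map \<theta> k t)"
    unfolding real_right_def
    by (subst sp_coprod_map_sp_in)
      (simp_all add: is_spmap_sp_tensor_map[OF j g] sp_tensor_map_tens[OF j g])
qed

lemma real_elt_eq: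
  assumes \<theta>: "\<theta> \<in> simp_op a b" and x: "x \<in> spx (obj X b) m k" and t: "t = None \<or> t \<in> Some ` simp_op k a"
  shows "real_elt X a m k (sop X a b \<theta> m k x) t = real_elt X b m k x (std_simplex_map \<theta> k t)"
proof -
  have "tens (obj X b) (std_simplex_plus a) m k x t \<in> spx (real_rel_summand X (a, b, \<theta>)) m k"
    unfolding prod.case
    by (rule tens_in[OF obj_symspec[OF X] is_psset_std_simplex_plus]) (use x t in auto)
  then have "sp_in (real_rel_summand X) (a, b, \<theta>) m k (tens (obj X b) (std_simplex_plus a) m k x t) \<in> spx (real_rels X) m k"
    unfolding real_rels_def
    by (rule spmap_in[OF is_spmap_sp_in[OF real_rel_summand_symspec], rotated]) (use \<theta> in simp)
  from sp_proj_eq[OF this, of "real_left X" "real_right X"] show ?thesis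
    by (simp add: real_elt_def real_left_right_in[OF \<theta>])
qed

lemma real_diag_gen_in:
  assumes "t \<in> simp_op k n"
  shows "real_diag_gen X m k (real_gen X n m k x (Some t)) = sop X k n t m k x"
  using spmap_base[OF sop_spmap[OF X assms], of m k]
  by (auto simp: real_diag_gen_def sp_in_def cin_def tens_def smash_elt_def)

lemma real_diag_gen_None [simp]: "real_diag_gen X m k None = spb (obj X k) m k"
  by (simp add: real_diag_gen_def)

lemma real_gen_None [simp]: "real_gen X n m k x None = None"
  using tens_base(2)[of "obj X n" "std_simplex_plus n" m k x] by (simp add: sp_in_def cin_def)

lemma real_diag_proj: "real_diag X k m (real_proj X m k g) = real_diag_gen X m k g"
  unfolding real_diag_def
proof (rule sp_coeq_desc_proj)
  fix c assume "c \<in> spx (real_rels X) m k"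
  then show "real_diag_gen X m k (real_left X m k c) = real_diag_gen X m k (real_right X m k c)"
  proof (cases rule: real_rels_cases)
    case 1
    then show ?thesis by (simp add: real_left_def real_right_def)
  next
    case (2 a b \<theta> x t)
    show ?thesis
    proof (cases t)
      case None
      then show ?thesis by (simp add: 2 real_left_right_in std_simplex_map_def)
    next
      case (Some \<tau>)
      then have \<tau>: "\<tau> \<in> simp_op k a" using 2(3) by auto
      show ?thesis
        using sop_comp[OF X \<tau> 2(1,2)] simp_op_compose[OF \<tau> 2(1)]
        by (simp add: 2 Some real_left_right_in std_simplex_map_def real_diag_gen_in \<tau>)
    qed
  qed
qed

lemma real_diag_elt:
  assumes "t \<in> simp_op k n"
  shows "real_diag X k m (real_elt X n m k x (Some t)) = sop X k n t m k x"
  by (simp add: real_elt_def real_diag_proj real_diag_gen_in[OF assms])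

lemma real_diag_base: "real_diag X k m (spb (realization X) m k) = spb (obj X k) m k"
  using real_diag_proj[of k m None] spmap_base[OF is_spmap_sp_proj[OF real_LR], of m k]
  by (simp add: realization_def real_gens_def)

lemma real_diag_slice_map: "slice_map k (realization X) (obj X k) (real_diag X k)"
  unfolding slice_map_def
proof (intro conjI allI ballI impI)
  note R = realization_symspec and K = obj_symspec[OF X]
  show "real_diag X k m (spb (realization X) m k) = spb (obj X k) m k" for m by (rule real_diag_base)
  fix m z assume z: "z \<in> spx (realization X) m k"
  from z show "real_diag X k m z \<in> spx (obj X k) m k"
    by (cases rule: realization_cases)
      (simp_all add: real_diag_base real_diag_elt symspec_base_in[OF K] spmap_in[OF sop_spmap[OF X]])
  show "real_diag X k m (symact (realization X) m \<gamma> k z) = symact (obj X k) m \<gamma> k (real_diag X k m z)"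
    if "\<gamma> permutes {..<m}" for \<gamma>
    using z by (cases rule: realization_cases)
      (simp_all add: that real_diag_base real_diag_elt symact_base[OF K] symact_base[OF R] real_elt_symact
        spmap_symact[OF sop_spmap[OF X]])
  show "real_diag X k (Suc m) (strmap (realization X) m k s z) = strmap (obj X k) m k s (real_diag X k m z)"
    if "s \<in> simplices circle k" for s
    using z by (cases rule: realization_cases)
      (simp_all add: that real_diag_base real_diag_elt strmap_base[OF K] strmap_base[OF R] real_elt_strmap
        spmap_strmap[OF sop_spmap[OF X]])
qed

lemma real_undiag_slice_map: "slice_map k (obj X k) (realization X) (real_undiag X k)"
  unfolding slice_map_def real_undiag_def
  by (simp add: real_elt_base real_elt_in real_elt_symact real_elt_strmap simp_op_id)

lemma real_undiag_diag:
  assumes "z \<in> spx (realization X) m k"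
  shows "real_undiag X k m (real_diag X k m z) = z"
  using assms
proof (cases rule: realization_cases)
  case 1
  then show ?thesis by (simp add: real_diag_base real_undiag_def real_elt_base)
next
  case (2 n x t)
  then show ?thesis
    using real_elt_eq[OF 2(2,1), of "Some (\<lambda>i\<in>{..k}. i)"]
    by (simp add: real_diag_elt real_undiag_def simp_op_id std_simplex_map_def simp_op_id_right)
qed

end

context
  fixes X :: "'a simpspec" and Y :: "'b simpspec" and f :: "nat \<Rightarrow> ('a, 'b) spmap"
  assumes f: "is_simpspec_map X Y f"
begin

abbreviation real_gens_map where
  "real_gens_map \<equiv> sp_coprod_map (real_summand Y) (\<lambda>n. n)
     (\<lambda>n. sp_tensor_map (obj Y n) (std_simplex_plus n) (f n) (\<lambda>_ t. t))"

lemma real_summand_map: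
  "is_spmap (real_summand X n) (real_summand Y n) (sp_tensor_map (obj Y n) (std_simplex_plus n) (f n) (\<lambda>_ t. t))"
  by (rule is_spmap_sp_tensor_map[OF simpspec_map_level[OF f] is_psset_map_id[OF is_psset_std_simplex_plus]])

lemma real_gens_map_gen: "real_gens_map m k (real_gen X n m k x t) = real_gen Y n m k (f n m k x) t"
  using sp_coprod_map_sp_in[of "real_summand X" n "real_summand Y" "\<lambda>n. n"
      "\<lambda>n. sp_tensor_map (obj Y n) (std_simplex_plus n) (f n) (\<lambda>_ t. t)", OF real_summand_map]
    sp_tensor_map_tens[OF simpspec_map_level[OF f] is_psset_map_id[OF is_psset_std_simplex_plus]]
  by simp

lemma realization_map_proj: "realization_map Y f m k (real_proj X m k z) = real_proj Y m k (real_gens_map m k z)"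
  unfolding realization_map_def
proof (rule sp_coeq_map_proj)
  note X = simpspec_map_dom[OF f] and Y = simpspec_map_cod[OF f]
  fix c assume "c \<in> spx (real_rels X) m k"
  then show "real_proj Y m k (real_gens_map m k (real_left X m k c)) = real_proj Y m k (real_gens_map m k (real_right X m k c))"
  proof (cases rule: real_rels_cases[OF X, consumes 1])
    case 1
    then show ?thesis by (simp add: real_left_def real_right_def)
  next
    case (2 a b \<theta> x t)
    then show ?thesis
      using real_elt_eq[OF Y 2(1) spmap_in[OF simpspec_map_level[OF f] 2(2)] 2(3)] simpspec_map_sop[OF f 2(1,2)]
      by (simp add: real_left_right_in[OF X] real_gens_map_gen real_elt_def)
  qed
qed

lemma realization_map_elt: "realization_map Y f m k (real_elt X n m k x t) = real_elt Y n m k (f n m k x) t"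
  by (simp add: real_elt_def realization_map_proj real_gens_map_gen)

lemma realization_map_spmap: "is_spmap (realization X) (realization Y) (realization_map Y f)"
  unfolding realization_def[of X]
proof (rule is_spmap_sp_coeq[OF real_LR[OF simpspec_map_dom[OF f]]])
  note Y = simpspec_map_cod[OF f]
  have "is_spmap (real_gens X) (real_gens Y) real_gens_map"
    unfolding real_gens_def
    by (rule is_spmap_sp_coprod_map) (auto intro: real_summand_map real_summand_symspec[OF Y])
  then show "is_spmap (real_gens X) (realization Y) (\<lambda>m k z. real_proj Y m k (real_gens_map m k z))"
    unfolding realization_def by (rule is_spmap_comp[OF _ is_spmap_sp_proj[OF real_LR[OF Y]]])
qed (rule realization_map_proj)

lemma real_diag_natural:
  assumes "z \<in> spx (realization X) m k"
  shows "real_diag Y k m (realization_map Y f m k z) = f k m k (real_diag X k m z)"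
proof -
  note X = simpspec_map_dom[OF f] and Y = simpspec_map_cod[OF f]
  from assms show ?thesis
  proof (cases rule: realization_cases[OF X, consumes 1])
    case 1
    show ?thesis
      unfolding 1 spmap_base[OF realization_map_spmap] real_diag_base[OF X] real_diag_base[OF Y]
        spmap_base[OF simpspec_map_level[OF f]] ..
  next
    case (2 n x t)
    then show ?thesis
      by (simp add: realization_map_elt real_diag_elt[OF X] real_diag_elt[OF Y] simpspec_map_sop[OF f])
  qed
qed

lemma realization_map_inj:
  assumes inj: "inj_on (f k m k) (spx (obj X k) m k)"
  shows "inj_on (realization_map Y f m k) (spx (realization X) m k)"
proof (rule inj_onI)
  note X = simpspec_map_dom[OF f]
  fix z w assume zw: "z \<in> spx (realization X) m k" "w \<in> spx (realization X) m k"
    "realization_map Y f m k z = realization_map Y f m k w"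
  have "real_diag X k m z \<in> spx (obj X k) m k" "real_diag X k m w \<in> spx (obj X k) m k"
    using real_diag_slice_map[OF X] zw(1,2) by (simp_all add: slice_map_def)
  then have "real_diag X k m z = real_diag X k m w"
    using real_diag_natural zw inj_onD[OF inj] by metis
  then show "z = w" using real_undiag_diag[OF X] zw(1,2) by metis
qed

lemma realization_map_reflects_decomposable:
  assumes refl: "reflects_decomposable k (obj X k) (obj Y k) (\<lambda>m. f k m k) m"
  shows "reflects_decomposable k (realization X) (realization Y) (\<lambda>m. realization_map Y f m k) m"
  unfolding reflects_decomposable_def
proof (intro ballI impI)
  note X = simpspec_map_dom[OF f] and Y = simpspec_map_cod[OF f]
  fix z assume z: "z \<in> spx (realization X) m k" and dec: "decomposable k (realization Y) m (realization_map Y f m k z)"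
  have "decomposable k (obj Y k) m (f k m k (real_diag X k m z))"
    using decomposable_image[OF realization_symspec[OF Y] real_diag_slice_map[OF Y] dec]
    by (simp add: real_diag_natural[OF z])
  moreover have "real_diag X k m z \<in> spx (obj X k) m k"
    using real_diag_slice_map[OF X] z by (simp add: slice_map_def)
  ultimately have "decomposable k (obj X k) m (real_diag X k m z)"
    using refl by (simp add: reflects_decomposable_def)
  from decomposable_image[OF obj_symspec[OF X] real_undiag_slice_map[OF X] this]
  show "decomposable k (realization X) m z" by (simp add: real_undiag_diag[OF X z])
qed

end

section \<open>Positive flat cofibrations\<close>

lemma positive_flat_cofibrantD:
  assumes "positive_flat_cofibrant X"
  shows "spx X 0 k = {spb X 0 k}"
proof -
  have fc: "is_spmap zero_spectrum X (\<lambda>m k _. spb X m k)"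
    and "is_psset_iso (level zero_spectrum 0) (level X 0) (\<lambda>k _. spb X 0 k)"
    using assms by (auto simp: positive_flat_cofibrant_def positive_flat_cofibration_def flat_cofibration_def)
  then have "x = spb X 0 k" if "x \<in> spx X 0 k" for x
    using that unfolding is_psset_iso_def by metis
  then show ?thesis using symspec_base_in[OF spmap_cod[OF fc], of 0 k] by blast
qed

lemma positive_flat_cofibrationI:
  assumes fc: "flat_cofibration X Y f" and inj: "\<And>k. inj_on (f 0 k) (spx X 0 k)"
    and Y0: "\<And>k. spx Y 0 k = {spb Y 0 k}"
  shows "positive_flat_cofibration X Y f"
proof -
  note f = flat_cofibration_spmap[OF fc]
  note X = spmap_dom[OF f] and Y = spmap_cod[OF f]
  have f0: "f 0 k x = f 0 k (spb X 0 k)" if "x \<in> spx X 0 k" for k x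
    using spmap_in[OF f that] spmap_base[OF f, of 0 k] Y0 by simp
  have "is_psset_map (level Y 0) (level X 0) (\<lambda>k _. spb X 0 k)"
    by (rule is_psset_mapI)
      (simp_all add: symspec_psset[OF X] symspec_psset[OF Y] symspec_base_in[OF X] symspec_op_base[OF X])
  moreover have "spb X 0 k = x" if "x \<in> spx X 0 k" for k x
    using inj_onD[OF inj, of k "spb X 0 k" x] f0[OF that] that symspec_base_in[OF X] by metis
  moreover have "f 0 k (spb X 0 k) = y" if "y \<in> spx Y 0 k" for k y
    using that Y0 spmap_base[OF f, of 0 k] by simp
  ultimately have "is_psset_iso (level X 0) (level Y 0) (f 0)"
    unfolding is_psset_iso_def using spmap_level[OF f] by blast
  with fc show ?thesis by (simp add: positive_flat_cofibration_def)
qed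

theorem theorem1p1:
  fixes X :: "'a simpspec" and Y :: "'b simpspec" and f :: "nat \<Rightarrow> ('a, 'b) spmap"
  assumes map: "is_simpspec_map X Y f"
    and cofibrant: "\<forall>n. flat_cofibrant (obj X n) \<and> flat_cofibrant (obj Y n)"
    and degen_X: "\<forall>n. \<forall>i\<le>n. levelwise_cofibration (obj X n) (obj X (Suc n)) (degen X n i)"
    and degen_Y: "\<forall>n. \<forall>i\<le>n. levelwise_cofibration (obj Y n) (obj Y (Suc n)) (degen Y n i)"
    and flat: "\<forall>n. flat_cofibration (obj X n) (obj Y n) (f n)"
  shows "reedy_flat_cofibration X Y f \<and>
    flat_cofibration (realization X) (realization Y) (realization_map Y f) \<and>
    ((\<forall>n. positive_flat_cofibrant (obj X n) \<and> positive_flat_cofibrant (obj Y n)) \<and>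
     (\<forall>n. positive_flat_cofibration (obj X n) (obj Y n) (f n)) \<longrightarrow>
       reedy_positive_flat_cofibration X Y f \<and>
       positive_flat_cofibration (realization X) (realization Y) (realization_map Y f))"
proof -
  note Y = simpspec_map_cod[OF map]
  have flat_Y: "flat_slice k (obj Y n)" for k n
    using cofibrant by (simp add: flat_cofibrant_slice)
  have inj: "inj_on (f n m k) (spx (obj X n) m k)" for n m k
    by (rule flat_cofibration_inj[OF flat[rule_format] flat_Y])
  have refl: "reflects_decomposable k (obj X n) (obj Y n) (\<lambda>m. f n m k) m" for n m k
    by (rule flat_cofibration_reflects_decomposable[OF flat[rule_format]])
  have flat_real: "flat_slice k (realization Y)" for k
    by (rule flat_slice_retract[OF obj_symspec[OF Y] realization_symspec[OF Y] flat_Y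
      real_diag_slice_map[OF Y] real_undiag_slice_map[OF Y] real_undiag_diag[OF Y]])
  have corner: "flat_cofibration (latching_corner X Y f n) (obj Y n) (latching_corner_map Y f n)" for n
    by (rule flat_cofibrationI[OF latching_corner_map_spmap[OF map] flat_Y latching_corner_map_inj[OF map inj]
      latching_corner_map_reflects_decomposable[OF map refl]])
  have real: "flat_cofibration (realization X) (realization Y) (realization_map Y f)"
    by (rule flat_cofibrationI[OF realization_map_spmap[OF map] flat_real realization_map_inj[OF map inj]
      realization_map_reflects_decomposable[OF map refl]])
  have positive: "reedy_positive_flat_cofibration X Y f \<and>
      positive_flat_cofibration (realization X) (realization Y) (realization_map Y f)"
    if pos: "\<forall>n. positive_flat_cofibrant (obj Y n)"
  proof -
    have Y0: "spx (obj Y n) 0 k = {spb (obj Y n) 0 k}" for n k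
      using pos by (simp add: positive_flat_cofibrantD)
    have "z = spb (realization Y) 0 k" if z: "z \<in> spx (realization Y) 0 k" for z k
    proof -
      have "real_diag Y k 0 z = spb (obj Y k) 0 k"
        using real_diag_slice_map[OF Y, of k] z Y0[of k k] by (metis singletonD slice_map_def)
      then show ?thesis
        using real_undiag_diag[OF Y z] real_undiag_slice_map[OF Y, of k] by (simp add: slice_map_def)
    qed
    then have "spx (realization Y) 0 k = {spb (realization Y) 0 k}" for k
      using symspec_base_in[OF realization_symspec[OF Y]] by blast
    then have "positive_flat_cofibration (realization X) (realization Y) (realization_map Y f)"
      by (intro positive_flat_cofibrationI[OF real] realization_map_inj[OF map inj])
    moreover have "positive_flat_cofibration (latching_corner X Y f n) (obj Y n) (latching_corner_map Y f n)" for n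
      by (intro positive_flat_cofibrationI[OF corner] latching_corner_map_inj[OF map inj] Y0)
    ultimately show ?thesis using map by (simp add: reedy_positive_flat_cofibration_def)
  qed
  show ?thesis
    using map corner real positive by (simp add: reedy_flat_cofibration_def)
qed

end
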